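(* Let $\overline\rho>0$, $f\in C^1[0,\overline\rho]$ with $f(0)=0$, $h:=f'$. Let $g_0\in C[0,\overline\rho]$ satisfy $$g_0(\rho)>0\ \text{for }\rho\in(0,\overline\rho),\qquad g_0(0)=g_0(\overline\rho)=0,\qquad \limsup_{\rho\to0^+}\frac{D(\rho)g_0(\rho)}{\rho}<+\infty,$$ and let $\{g_n\}_{n\ge1}\subset C[0,\overline\rho]$ be a decreasing sequence of functions such that, for each $n\ge1$, $g_n(\rho)>0$ for $\rho\in[0,\overline\rho)$ and $g_n(\overline\rho)=0$, and such that $g_n\to g_0$ uniformly. Assume one of the following conditions on $D$: ($\hat{\rm D}$) $D\in C^1[0,\overline\rho]$ and $D(\rho)>0$ for $\rho\in(0,\overline\rho)$; ($\tilde{\rm D}$) $D\in C[0,\overline\rho]\cap C^1[0,\overline\rho)$, $D(\overline\rho)=0$, $D(\rho)>0$ for $\rho\in(0,\overline\rho)$, $\dot D(\overline\rho)=-\infty$, and for every $n\ge0$ the limit $\lim_{\varphi\to\overline\rho^-}\frac{D(\varphi)g_n(\varphi)}{\varphi-\overline\rho}$ exists in $(-\infty,0]$. For $c\ge c_0^*$, let $\varphi_0$ be the wavefront profile, connecting $\overline\rho$ with $0$, of $$\rho_t+f(\rho)_x=\left(D(\rho)\rho_x\right)_x+g_0(\rho),$$ and for $n\ge1$ let $\varphi_n$ be the semi-wavefront profile from $\overline\rho$ of $$\rho_t+f(\rho)_x=\left(D(\rho)\rho_x\right)_x+g_n(\rho),$$ all of them with wave speed $c$ and normalized by $\varphi_n(0)=\overline\rho/2$,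 $n\ge0$. Then $\varphi_n\to\varphi_0$ in $C^1_{\rm loc}(J)$, where $J$ is the maximal open interval where $0<\varphi_0<\overline\rho$.
   Context: A dot denotes differentiation with respect to the state variable, a prime on profiles denotes differentiation with respect to $\xi$. Traveling waves (for the equation with source term $g$). Let $I\subseteq\mathbb R$ be an open interval and $\varphi\colon I\to[0,\overline\rho]$ with $\varphi\in C(I)$ and $D(\varphi)\varphi'\in L^1_{\rm loc}(I)$ (in particular $\varphi$ is differentiable a.e.). The function $\rho(x,t)=\varphi(x-ct)$, defined for $x-ct\in I$, is a traveling-wave solution with wave speed $c$ and wave profile $\varphi$ if $$\int_I\left\{\left(D(\varphi(\xi))\varphi'(\xi)-f(\varphi(\xi))+c\varphi(\xi)\right)\psi'(\xi)-g(\varphi(\xi))\psi(\xi)\right\}d\xi=0\quad\text{for every }\psi\in C_0^\infty(I).$$ It is classical if $\varphi$ is differentiable, $D(\varphi)\varphi'$ is absolutely continuous and $(D(\varphi)\varphi')'+(c-h(\varphi))\varphi'+g(\varphi)=0$ holds a.e. in $I$; sharp at $\ell$ if $g(\ell)=0$ and there is $\xi_0\in I$ with $\varphi(\xi_0)=\ell$, $\varphi$ classical in $I\setminus\{\xi_0\}$ and not differentiable at $\xi_0$. Only classical or sharp traveling waves are considered ($\varphi_0$ may be sharp at one or both of the equilibria $0,\overline\rho$). A wavefront solution is a traveling-wave solution with $I=\mathbb R$ whose profile has limits at $\pm\infty$ that are zeros of $g$. The wavefront profile $\varphi_0$ is decreasing, with $\varphi_0(-\infty)=\overline\rho$ and $\varphi_0(+\infty)=0$.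 The real number $c_0^*$ is the threshold speed for the equation with source $g_0$: such wavefronts exist if and only if $c\ge c_0^*$; equivalently, the problem $\dot z=h(\varphi)-c-\frac{D(\varphi)g_0(\varphi)}{z}$, $z<0$ in $(0,\overline\rho)$, $z(0^+)=z(\overline\rho^-)=0$ is solvable if and only if $c\ge c_0^*$. For fixed $c$ the profile is unique up to shifts. A semi-wavefront solution from $\overline\rho$ is a traveling-wave solution whose profile $\varphi$ is defined in $(-\infty,\varpi)$ for some $\varpi\in\mathbb R$, is monotonic (weakly), non-constant, and satisfies $\varphi(\xi)\to\overline\rho$ as $\xi\to-\infty$ (with $g(\overline\rho)=0$). Profiles $\varphi_n$ are taken on their maximal interval of definition $(-\infty,\varpi_n)$, $\varpi_n\in\mathbb R$, and are unique up to shifts. Convergence in $C^1_{\rm loc}(J)$ means: for every compact interval $[\alpha,\beta]\subset J$, $\varphi_n$ is defined on $[\alpha,\beta]$ for $n$ large, and $\varphi_n\to\varphi_0$, $\varphi_n'\to\varphi_0'$ uniformly on $[\alpha,\beta]$. *)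

theory Defs
  imports "HOL-Analysis.Analysis"
begin

text \<open>
  Throughout, \<open>R\<close> is the maximal density, \<open>D\<close> the diffusivity, \<open>f\<close> the flux, \<open>h\<close> its derivative,
  \<open>g\<close> the source term and \<open>c\<close> the wave speed. Functions on an interval are total functions whose
  values outside of it are never used.
\<close>

text \<open>\<open>u \<in> C\<^sup>1(S)\<close> with derivative \<open>u'\<close>; the derivative is one-sided at end points belonging to \<open>S\<close>.\<close>

definition C1_on :: "real set \<Rightarrow> (real \<Rightarrow> real) \<Rightarrow> (real \<Rightarrow> real) \<Rightarrow> bool" where
  "C1_on S u u' \<longleftrightarrow>
     (\<forall>x\<in>S. (u has_real_derivative u' x) (at x within S)) \<and> continuous_on S u'"

definition D_hat :: "real \<Rightarrow> (real \<Rightarrow> real) \<Rightarrow> bool" where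
  "D_hat R D \<longleftrightarrow> (\<exists>D'. C1_on {0..R} D D') \<and> (\<forall>\<rho>\<in>{0<..<R}. D \<rho> > 0)"

text \<open>
  The requirement that the derivative of \<open>D\<close> at \<open>R\<close> be \<open>-\<infinity>\<close> is read as divergence of the
  difference quotients at \<open>R\<close>. The index \<open>n\<close> includes the limit source \<open>g 0\<close>.
\<close>

definition D_tilde :: "real \<Rightarrow> (real \<Rightarrow> real) \<Rightarrow> (nat \<Rightarrow> real \<Rightarrow> real) \<Rightarrow> bool" where
  "D_tilde R D g \<longleftrightarrow>
     continuous_on {0..R} D \<and> (\<exists>D'. C1_on {0..<R} D D') \<and> D R = 0 \<and>
     (\<forall>\<rho>\<in>{0<..<R}. D \<rho> > 0) \<and>
     filterlim (\<lambda>\<rho>. (D \<rho> - D R) / (\<rho> - R)) at_bot (at_left R) \<and>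
     (\<forall>n. \<exists>l\<le>0. ((\<lambda>\<rho>. D \<rho> * g n \<rho> / (\<rho> - R)) \<longlongrightarrow> l) (at_left R))"

text \<open>Absolute continuity on \<open>S\<close>, tested on finite families of non-overlapping intervals in \<open>S\<close>.\<close>

definition abs_continuous_on :: "real set \<Rightarrow> (real \<Rightarrow> real) \<Rightarrow> bool" where
  "abs_continuous_on S F \<longleftrightarrow>
     (\<forall>\<epsilon>>0. \<exists>\<delta>>0. \<forall>(m::nat) a b.
        (\<forall>i<m. a i \<le> b i \<and> {a i..b i} \<subseteq> S) \<and>
        (\<forall>i<m. \<forall>j<m. i \<noteq> j \<longrightarrow> {a i<..<b i} \<inter> {a j<..<b j} = {}) \<and>
        (\<Sum>i<m. b i - a i) < \<delta>
        \<longrightarrow> (\<Sum>i<m. \<bar>F (b i) - F (a i)\<bar>) < \<epsilon>)"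

text \<open>The space \<open>C\<^sub>0\<^sup>\<infinity>(I)\<close>, its elements being extended by zero to the real line.\<close>

definition test_function :: "real set \<Rightarrow> (real \<Rightarrow> real) \<Rightarrow> bool" where
  "test_function I \<psi> \<longleftrightarrow>
     (\<forall>k. (deriv ^^ k) \<psi> differentiable_on UNIV) \<and>
     compact (closure {\<xi>. \<psi> \<xi> \<noteq> 0}) \<and> closure {\<xi>. \<psi> \<xi> \<noteq> 0} \<subseteq> I"

text \<open>
  \<open>deriv \<phi> \<xi>\<close> is unspecified where \<open>\<phi>\<close> is not differentiable; almost everywhere
  differentiability is therefore stated explicitly.
\<close>

definition traveling_wave ::
  "real \<Rightarrow> (real \<Rightarrow> real) \<Rightarrow> (real \<Rightarrow> real) \<Rightarrow> (real \<Rightarrow> real) \<Rightarrow> real \<Rightarrow> real set \<Rightarrow> (real \<Rightarrow> real) \<Rightarrow> bool"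
where
  "traveling_wave R D f g c I \<phi> \<longleftrightarrow>
     open I \<and> is_interval I \<and> I \<noteq> {} \<and>
     \<phi> ` I \<subseteq> {0..R} \<and> continuous_on I \<phi> \<and>
     (AE \<xi> in lebesgue. \<xi> \<in> I \<longrightarrow> \<phi> differentiable (at \<xi>)) \<and>
     (\<forall>K. compact K \<and> K \<subseteq> I \<longrightarrow> set_integrable lebesgue K (\<lambda>\<xi>. D (\<phi> \<xi>) * deriv \<phi> \<xi>)) \<and>
     (\<forall>\<psi>. test_function I \<psi> \<longrightarrow>
        (LINT \<xi>:I|lebesgue.
           (D (\<phi> \<xi>) * deriv \<phi> \<xi> - f (\<phi> \<xi>) + c * \<phi> \<xi>) * deriv \<psi> \<xi> - g (\<phi> \<xi>) * \<psi> \<xi>) = 0)"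

definition classical_on ::
  "(real \<Rightarrow> real) \<Rightarrow> (real \<Rightarrow> real) \<Rightarrow> (real \<Rightarrow> real) \<Rightarrow> real \<Rightarrow> real set \<Rightarrow> (real \<Rightarrow> real) \<Rightarrow> bool"
where
  "classical_on D h g c S \<phi> \<longleftrightarrow>
     (\<forall>\<xi>\<in>S. \<phi> differentiable (at \<xi>)) \<and>
     abs_continuous_on S (\<lambda>\<xi>. D (\<phi> \<xi>) * deriv \<phi> \<xi>) \<and>
     (AE \<xi> in lebesgue. \<xi> \<in> S \<longrightarrow>
        (\<exists>w. ((\<lambda>\<xi>. D (\<phi> \<xi>) * deriv \<phi> \<xi>) has_real_derivative w) (at \<xi>) \<and>
             w + (c - h (\<phi> \<xi>)) * deriv \<phi> \<xi> + g (\<phi> \<xi>) = 0))"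

text \<open>
  \<open>E\<close> is the set of points at which the profile is sharp: none for a classical profile, and at most
  one for each equilibrium. Letting \<open>E\<close> have several elements covers profiles that are sharp at
  both equilibria.
\<close>

definition classical_or_sharp ::
  "(real \<Rightarrow> real) \<Rightarrow> (real \<Rightarrow> real) \<Rightarrow> (real \<Rightarrow> real) \<Rightarrow> real \<Rightarrow> real set \<Rightarrow> (real \<Rightarrow> real) \<Rightarrow> bool"
where
  "classical_or_sharp D h g c I \<phi> \<longleftrightarrow>
     (\<exists>E. finite E \<and> E \<subseteq> I \<and> inj_on \<phi> E \<and>
          (\<forall>\<xi>\<^sub>0\<in>E. g (\<phi> \<xi>\<^sub>0) = 0 \<and> \<not> \<phi> differentiable (at \<xi>\<^sub>0)) \<and>
          classical_on D h g c (I - E) \<phi>)"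

definition wavefront ::
  "real \<Rightarrow> (real \<Rightarrow> real) \<Rightarrow> (real \<Rightarrow> real) \<Rightarrow> (real \<Rightarrow> real) \<Rightarrow> (real \<Rightarrow> real) \<Rightarrow> real
     \<Rightarrow> real \<Rightarrow> real \<Rightarrow> (real \<Rightarrow> real) \<Rightarrow> bool"
where
  "wavefront R D f h g c l\<^sub>1 l\<^sub>2 \<phi> \<longleftrightarrow>
     traveling_wave R D f g c UNIV \<phi> \<and> classical_or_sharp D h g c UNIV \<phi> \<and>
     g l\<^sub>1 = 0 \<and> g l\<^sub>2 = 0 \<and> (\<phi> \<longlongrightarrow> l\<^sub>1) at_bot \<and> (\<phi> \<longlongrightarrow> l\<^sub>2) at_top"

text \<open>Decreasing is meant weakly: a sharp profile is constant beyond its sharp points.\<close>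

definition decreasing_wavefront ::
  "real \<Rightarrow> (real \<Rightarrow> real) \<Rightarrow> (real \<Rightarrow> real) \<Rightarrow> (real \<Rightarrow> real) \<Rightarrow> (real \<Rightarrow> real) \<Rightarrow> real
     \<Rightarrow> (real \<Rightarrow> real) \<Rightarrow> bool"
where
  "decreasing_wavefront R D f h g c \<phi> \<longleftrightarrow> wavefront R D f h g c R 0 \<phi> \<and> antimono \<phi>"

definition threshold_speed ::
  "real \<Rightarrow> (real \<Rightarrow> real) \<Rightarrow> (real \<Rightarrow> real) \<Rightarrow> (real \<Rightarrow> real) \<Rightarrow> (real \<Rightarrow> real) \<Rightarrow> real \<Rightarrow> bool"
where
  "threshold_speed R D f h g c\<^sub>0 \<longleftrightarrow>
     (\<forall>c. (\<exists>\<phi>. decreasing_wavefront R D f h g c \<phi>) \<longleftrightarrow> c\<^sub>0 \<le> c)"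

definition semi_wavefront ::
  "real \<Rightarrow> (real \<Rightarrow> real) \<Rightarrow> (real \<Rightarrow> real) \<Rightarrow> (real \<Rightarrow> real) \<Rightarrow> (real \<Rightarrow> real) \<Rightarrow> real
     \<Rightarrow> real \<Rightarrow> (real \<Rightarrow> real) \<Rightarrow> bool"
where
  "semi_wavefront R D f h g c \<omega> \<phi> \<longleftrightarrow>
     traveling_wave R D f g c {..<\<omega>} \<phi> \<and> classical_or_sharp D h g c {..<\<omega>} \<phi> \<and>
     (mono_on {..<\<omega>} \<phi> \<or> antimono_on {..<\<omega>} \<phi>) \<and> \<not> \<phi> constant_on {..<\<omega>} \<and>
     g R = 0 \<and> (\<phi> \<longlongrightarrow> R) at_bot"

definition maximal_semi_wavefront ::
  "real \<Rightarrow> (real \<Rightarrow> real) \<Rightarrow> (real \<Rightarrow> real) \<Rightarrow> (real \<Rightarrow> real) \<Rightarrow> (real \<Rightarrow> real) \<Rightarrow> real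
     \<Rightarrow> real \<Rightarrow> (real \<Rightarrow> real) \<Rightarrow> bool"
where
  "maximal_semi_wavefront R D f h g c \<omega> \<phi> \<longleftrightarrow>
     semi_wavefront R D f h g c \<omega> \<phi> \<and>
     \<not> (\<exists>\<omega>' \<eta>. \<omega> < \<omega>' \<and> semi_wavefront R D f h g c \<omega>' \<eta> \<and> (\<forall>\<xi><\<omega>. \<eta> \<xi> = \<phi> \<xi>))"

definition maximal_open_interval :: "(real \<Rightarrow> bool) \<Rightarrow> real set \<Rightarrow> bool" where
  "maximal_open_interval P J \<longleftrightarrow>
     open J \<and> is_interval J \<and> (\<forall>\<xi>\<in>J. P \<xi>) \<and>
     (\<forall>J'. open J' \<and> is_interval J' \<and> (\<forall>\<xi>\<in>J'. P \<xi>) \<and> J \<subseteq> J' \<longrightarrow> J' = J)"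

text \<open>Here \<open>I n\<close> is the interval of definition of \<open>u n\<close>.\<close>

definition C1_loc_convergence ::
  "real set \<Rightarrow> (nat \<Rightarrow> real set) \<Rightarrow> (nat \<Rightarrow> real \<Rightarrow> real) \<Rightarrow> (real \<Rightarrow> real) \<Rightarrow> bool"
where
  "C1_loc_convergence J I u v \<longleftrightarrow>
     (\<forall>\<alpha> \<beta>. \<alpha> \<le> \<beta> \<and> {\<alpha>..\<beta>} \<subseteq> J \<longrightarrow>
        v C1_differentiable_on {\<alpha>..\<beta>} \<and>
        (\<forall>\<^sub>F n in sequentially. {\<alpha>..\<beta>} \<subseteq> I n \<and> u n C1_differentiable_on {\<alpha>..\<beta>}) \<and>
        uniform_limit {\<alpha>..\<beta>} u v sequentially \<and>
        uniform_limit {\<alpha>..\<beta>} (\<lambda>n. deriv (u n)) (deriv v) sequentially)"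

end

theory Submission
  imports Defs
begin

text \<open>
  Put \<open>F = D(\<phi>) \<phi>'\<close> and \<open>W = F - f(\<phi>) + c \<phi>\<close>. Where \<open>0 < \<phi> < R\<close> one has \<open>W' = - g(\<phi>)\<close> and \<open>\<phi>' < 0\<close>,
  so \<open>\<phi>\<close> has an inverse \<open>T\<close>, and \<open>z(s) = F(T(s))\<close> solves \<open>(z - f + c s)' = - D g / z\<close> with \<open>T' = D / z\<close>.
  Moreover \<open>z \<rightarrow> 0\<close> at \<open>R\<close>; when \<open>\<phi>\<close> reaches \<open>R\<close> at a finite point, the weak formulation, tested with a bump
  function there, rules out a jump of \<open>F\<close>. Since \<open>- D g / z\<close> increases with \<open>z\<close>, solutions vanishing at \<open>R\<close> are
  ordered oppositely to their sources: \<open>z\<^sub>1 \<le> z\<^sub>n \<le> z\<^sub>0\<close>. As \<open>(z\<^sub>0 - z\<^sub>n)' \<ge> - D (g\<^sub>n - g\<^sub>0) / \<bar>z\<^sub>0\<bar>\<close> and \<open>z\<^sub>1\<close> is small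
  near \<open>R\<close>, integrating backwards from a point near \<open>R\<close> gives \<open>z\<^sub>n \<rightarrow> z\<^sub>0\<close> locally uniformly in \<open>(0, R)\<close>,
  hence \<open>T\<^sub>n \<rightarrow> T\<^sub>0\<close>, \<open>\<phi>\<^sub>n \<rightarrow> \<phi>\<^sub>0\<close> and \<open>\<phi>\<^sub>n' = z\<^sub>n(\<phi>\<^sub>n) / D(\<phi>\<^sub>n) \<rightarrow> \<phi>\<^sub>0'\<close>. For \<open>z\<^sub>n\<close> to be defined on all of \<open>(0, R)\<close>,
  the maximal profile \<open>\<phi>\<^sub>n\<close> must decrease down to \<open>0\<close>: if it stopped at \<open>l > 0\<close>, then \<open>z\<close> would have a negative
  limit at \<open>l\<close> and Picard iteration would continue \<open>z\<close>, and with it the profile, below \<open>l\<close>.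
\<close>

section \<open>Absolute continuity\<close>

text \<open>Absolute continuity of the flux is given on the interval minus the sharp points and is
  tested on closed intervals contained in that set. None of them crosses a sharp point, so a jump of
  the flux there is not excluded; this is what calls for the weak formulation and an actual smooth
  test function. Elsewhere the equation is given almost everywhere only; its right-hand side being
  continuous where \<open>0 < \<phi> < R\<close>, integration of the absolutely continuous flux
  upgrades it to every point of that set.

  Comparison starts from \<open>R\<close> because all the \<open>z\<close> vanish there, whereas no
  common value is available at \<open>0\<close>. The quotient \<open>D / \<bar>z\<bar>\<close> is
  not bounded a priori near \<open>R\<close>, so the backward integration starts at an interior
  point, where the single function \<open>z\<^sub>1\<close> bounds the gap for every
  \<open>n \<ge> 1\<close> at once. Passing to \<open>T\<close> replaces profiles on different
  domains by functions of \<open>s\<close> on the common interval \<open>(0, R)\<close>; this is why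
  each profile must be shown to take every value in it. The normalisation becomes
  \<open>T(R / 2) = 0\<close> and fixes the constant of integration.\<close>

definition nonoverlapping_in :: "real set \<Rightarrow> nat \<Rightarrow> (nat \<Rightarrow> real) \<Rightarrow> (nat \<Rightarrow> real) \<Rightarrow> bool" where
  "nonoverlapping_in S m a b \<longleftrightarrow> (\<forall>i<m. a i \<le> b i \<and> {a i..b i} \<subseteq> S) \<and>
     (\<forall>i<m. \<forall>j<m. i \<noteq> j \<longrightarrow> {a i<..<b i} \<inter> {a j<..<b j} = {})"

lemma abs_continuous_on_iff:
  "abs_continuous_on S F \<longleftrightarrow>
     (\<forall>\<epsilon>>0. \<exists>\<delta>>0. \<forall>m a b. nonoverlapping_in S m a b \<and> (\<Sum>i<m. b i - a i) < \<delta>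
        \<longrightarrow> (\<Sum>i<m. \<bar>F (b i) - F (a i)\<bar>) < \<epsilon>)"
  unfolding abs_continuous_on_def nonoverlapping_in_def by (simp only: conj_assoc)

lemma nonoverlapping_in_mono: "nonoverlapping_in T m a b \<Longrightarrow> T \<subseteq> S \<Longrightarrow> nonoverlapping_in S m a b"
  unfolding nonoverlapping_in_def by (meson subset_trans)

lemma abs_continuous_on_subset:
  assumes "abs_continuous_on S F" "T \<subseteq> S"
  shows "abs_continuous_on T F"
  using assms unfolding abs_continuous_on_iff by (meson nonoverlapping_in_mono)

text \<open>The gauge treats two kinds of tags differently: off \<open>N\<close> the derivative
  controls each piece, while tags in \<open>N\<close> are confined to an open set of measure below
  \<delta>, so that their pieces form a family to which absolute continuity applies.\<close>

lemma abs_continuous_on_has_integral: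
  fixes F k :: "real \<Rightarrow> real"
  assumes AC: "abs_continuous_on {a..b} F" and ab: "a \<le> b" and N: "negligible N"
    and D: "\<And>x. x \<in> {a..b} - N \<Longrightarrow> (F has_real_derivative k x) (at x within {a..b})"
  shows "(k has_integral (F b - F a)) {a..b}"
proof -
  \<comment> \<open>With the value 0 on \<open>N\<close>, a piece tagged in \<open>N\<close>
    contributes only its increment of \<open>F\<close> to the error of the Riemann sum.\<close>
  define k' where "k' = (\<lambda>x. if x \<in> N then 0 else k x)"
  have "(k' has_integral (F b - F a)) {a..b}"
    unfolding has_integral_real
  proof (intro allI impI)
    fix e :: real assume e: "e > 0"
    define e' where "e' = e / (2 * (b - a + 1))"
    have e': "e' > 0" "e' * (b - a) < e / 2"
      using e ab by (auto simp: e'_def field_simps)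
    obtain \<delta> where \<delta>: "\<delta> > 0" and ac: "\<And>m u v. nonoverlapping_in {a..b} m u v \<Longrightarrow>
        (\<Sum>i<m. v i - u i) < \<delta> \<Longrightarrow> (\<Sum>i<m. \<bar>F (v i) - F (u i)\<bar>) < e/2"
      using AC half_gt_zero[OF e] unfolding abs_continuous_on_iff by metis
    obtain U where U: "open U" "N \<subseteq> U" "U \<in> lmeasurable" "measure lebesgue U < \<delta>"
    proof -
      have "N \<in> null_sets lebesgue" using N by (simp add: negligible_iff_null_sets)
      then have NL: "N \<in> lmeasurable" "measure lebesgue N = 0" "N \<in> sets lebesgue"
        by (auto simp: fmeasurableI_null_sets measure_eq_0_null_sets)
      obtain T where T: "open T" "N \<subseteq> T" "T - N \<in> lmeasurable" "emeasure lebesgue (T - N) < ennreal \<delta>"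
        using sets_lebesgue_outer_open[OF NL(3) \<delta>] by blast
      have TL: "T \<in> lmeasurable"
        by (metis Diff_partition NL(1) T(2,3) fmeasurable.Un)
      have "measure lebesgue (T - N) < \<delta>"
        using T(3,4) \<delta> by (metis emeasure_eq_measure2 ennreal_less_iff measure_nonneg)
      moreover have "measure lebesgue (T - N) = measure lebesgue T"
        using \<open>N \<in> null_sets lebesgue\<close> TL by (simp add: fmeasurableD measure_Diff_null_set)
      ultimately show thesis using that T TL by auto
    qed
    have "\<exists>d>0. \<forall>y\<in>{a..b}. \<bar>y - x\<bar> < d \<longrightarrow> \<bar>F y - F x - k x * (y - x)\<bar> \<le> e' * \<bar>y - x\<bar>"
      if "x \<in> {a..b} - N" for x
    proof -
      have "(F has_derivative (\<lambda>h. k x * h)) (at x within {a..b})"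
        using D[OF that] by (simp add: has_field_derivative_def)
      then show ?thesis
        using e'(1) unfolding has_derivative_within_alt by fastforce
    qed
    then obtain d where d: "\<And>x. x \<in> {a..b} - N \<Longrightarrow> d x > 0"
      "\<And>x y. x \<in> {a..b} - N \<Longrightarrow> y \<in> {a..b} \<Longrightarrow> \<bar>y - x\<bar> < d x \<Longrightarrow> \<bar>F y - F x - k x * (y - x)\<bar> \<le> e' * \<bar>y - x\<bar>"
      by metis
    define \<gamma> where "\<gamma> = (\<lambda>x. if x \<in> N then U else if x \<in> {a..b} then ball x (d x) else UNIV)"
    have gauge: "gauge \<gamma>"
      unfolding gauge_def \<gamma>_def using U d(1) by auto
    show "\<exists>\<gamma>. gauge \<gamma> \<and> (\<forall>\<D>. \<D> tagged_division_of {a..b} \<and> \<gamma> fine \<D> \<longrightarrow>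
        norm ((\<Sum>(x, K)\<in>\<D>. measure lborel K *\<^sub>R k' x) - (F b - F a)) < e)"
    proof (intro exI[of _ \<gamma>] conjI allI impI gauge)
      fix p assume "p tagged_division_of {a..b} \<and> \<gamma> fine p"
      then have p: "p tagged_division_of {a..b}" and fine: "\<gamma> fine p" by auto
      have fin: "finite p" using p by auto
      have pK: "\<exists>u v. u \<le> v \<and> K = {u..v} \<and> x \<in> {u..v} \<and> {u..v} \<subseteq> {a..b}" if "(x,K) \<in> p" for x K
        using tagged_division_ofD(2,3,4)[OF p that] that
        by (metis atLeastatMost_empty_iff empty_iff interval_cbox)
      define pN where "pN = {xK \<in> p. fst xK \<in> N}"
      have pNp: "pN \<subseteq> p" "finite pN" using fin by (auto simp: pN_def)
      define \<Delta> where "\<Delta> = (\<lambda>K::real set. F (Sup K) - F (Inf K))"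
      have "F b - F a = (\<Sum>(x,K)\<in>p. \<Delta> K)"
        unfolding \<Delta>_def by (rule additive_tagged_division_1[OF ab p, symmetric])
      then have "\<bar>(\<Sum>(x, K)\<in>p. measure lborel K *\<^sub>R k' x) - (F b - F a)\<bar> = \<bar>\<Sum>(x,K)\<in>p. measure lborel K *\<^sub>R k' x - \<Delta> K\<bar>"
        by (simp add: sum_subtractf split_def)
      also have "\<dots> \<le> (\<Sum>(x,K)\<in>p. \<bar>measure lborel K *\<^sub>R k' x - \<Delta> K\<bar>)"
        by (metis (no_types, lifting) split_def sum.cong sum_abs)
      also have "\<dots> = (\<Sum>(x,K)\<in>p - pN. \<bar>measure lborel K *\<^sub>R k' x - \<Delta> K\<bar>) + (\<Sum>(x,K)\<in>pN. \<bar>measure lborel K *\<^sub>R k' x - \<Delta> K\<bar>)"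
        using sum.subset_diff[OF pNp(1) fin] by blast
      also have "(\<Sum>(x,K)\<in>p - pN. \<bar>measure lborel K *\<^sub>R k' x - \<Delta> K\<bar>) \<le> (\<Sum>(x,K)\<in>p - pN. e' * measure lborel K)"
      proof (rule sum_mono, clarify)
        fix x K assume xK: "(x,K) \<in> p" "(x,K) \<notin> pN"
        then obtain u v where uv: "u \<le> v" "K = {u..v}" "x \<in> {u..v}" "{u..v} \<subseteq> {a..b}" using pK by blast
        have x: "x \<in> {a..b} - N" using xK uv by (auto simp: pN_def)
        have "K \<subseteq> ball x (d x)" using fine xK x unfolding fine_def \<gamma>_def by fastforce
        then have "v \<in> ball x (d x)" "u \<in> ball x (d x)"
          using uv by (metis atLeastAtMost_iff order_refl subset_eq)+
        then have "\<bar>v - x\<bar> < d x" "\<bar>u - x\<bar> < d x" by (auto simp: dist_real_def abs_minus_commute)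
        then have "\<bar>F v - F x - k x * (v - x)\<bar> \<le> e' * (v - x)" "\<bar>F u - F x - k x * (u - x)\<bar> \<le> e' * (x - u)"
          using d(2)[OF x, of v] d(2)[OF x, of u] uv by auto
        then have "\<bar>(v - u) * k x - (F v - F u)\<bar> \<le> e' * (v - u)"
          by (simp add: abs_le_iff algebra_simps)
        then show "\<bar>measure lborel K *\<^sub>R k' x - \<Delta> K\<bar> \<le> e' * measure lborel K"
          using uv x by (simp add: k'_def \<Delta>_def)
      qed
      also have "(\<Sum>(x,K)\<in>p - pN. e' * measure lborel K) \<le> (\<Sum>(x,K)\<in>p. e' * measure lborel K)"
        using fin e' by (intro sum_mono2) auto
      also have "\<dots> = e' * (b - a)"
        using additive_content_tagged_division[of p a b] p ab
        by (simp add: sum_distrib_left[symmetric] split_def)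
      also have "(\<Sum>(x,K)\<in>pN. \<bar>measure lborel K *\<^sub>R k' x - \<Delta> K\<bar>) = (\<Sum>(x,K)\<in>pN. \<bar>\<Delta> K\<bar>)"
        by (intro sum.cong) (auto simp: k'_def pN_def)
      also have "\<dots> < e/2"
      proof -
        \<comment> \<open>Absolute continuity speaks of indexed families, so the finitely many
          pieces with tag in \<open>N\<close> are enumerated.\<close>
        obtain \<pi> where \<pi>: "bij_betw \<pi> {..<card pN} pN"
          using ex_bij_betw_nat_finite[OF pNp(2)] by (auto simp: lessThan_atLeast0)
        define u where "u = (\<lambda>i. Inf (snd (\<pi> i)))"
        define v where "v = (\<lambda>i. Sup (snd (\<pi> i)))"
        have uv: "u i \<le> v i \<and> snd (\<pi> i) = {u i..v i} \<and> {u i..v i} \<subseteq> {a..b} \<and> {u i..v i} \<subseteq> U" if "i < card pN" for i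
        proof -
          have "\<pi> i \<in> pN" using \<pi> that by (auto simp: bij_betw_def)
          then have *: "(fst (\<pi> i), snd (\<pi> i)) \<in> p" "fst (\<pi> i) \<in> N" by (auto simp: pN_def)
          from pK[OF *(1)] obtain r s where "r \<le> s" "snd (\<pi> i) = {r..s}" "{r..s} \<subseteq> {a..b}" by blast
          moreover have "snd (\<pi> i) \<subseteq> U" using fine * unfolding fine_def \<gamma>_def by fastforce
          ultimately show ?thesis by (auto simp: u_def v_def)
        qed
        have disj: "\<forall>i<card pN. \<forall>j<card pN. i \<noteq> j \<longrightarrow> {u i<..<v i} \<inter> {u j<..<v j} = {}"
        proof (intro allI impI)
          fix i j assume ij: "i < card pN" "j < card pN" "i \<noteq> j"
          then have "\<pi> i \<in> pN" "\<pi> j \<in> pN" "\<pi> i \<noteq> \<pi> j" using \<pi> by (auto simp: bij_betw_def inj_on_def)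
          then have "interior (snd (\<pi> i)) \<inter> interior (snd (\<pi> j)) = {}"
            using tagged_division_ofD(5)[OF p, of "fst (\<pi> i)" "snd (\<pi> i)" "fst (\<pi> j)" "snd (\<pi> j)"]
            by (auto simp: pN_def)
          then show "{u i<..<v i} \<inter> {u j<..<v j} = {}" using uv ij by simp
        qed
        have "(\<Sum>i<card pN. v i - u i) = (\<Sum>i<card pN. measure lebesgue {u i<..<v i})"
          using uv by (intro sum.cong) auto
        also have "\<dots> = measure lebesgue (\<Union>i<card pN. {u i<..<v i})"
          using disj by (intro measure_UNION'[symmetric]) (auto simp: pairwise_def disjnt_def)
        also have "\<dots> \<le> measure lebesgue U"
        proof (rule measure_mono_fmeasurable[OF _ _ U(3)])
          show "(\<Union>i<card pN. {u i<..<v i}) \<subseteq> U"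
            using uv by (force simp: subset_eq)
        qed auto
        also have "\<dots> < \<delta>" by (rule U)
        finally have "(\<Sum>i<card pN. \<bar>F (v i) - F (u i)\<bar>) < e/2"
          using ac[of "card pN" u v] uv disj by (auto simp: nonoverlapping_in_def)
        moreover have "(\<Sum>i<card pN. \<bar>F (v i) - F (u i)\<bar>) = (\<Sum>i<card pN. \<bar>\<Delta> (snd (\<pi> i))\<bar>)"
          by (auto simp: \<Delta>_def u_def v_def)
        moreover have "\<dots> = (\<Sum>xK\<in>pN. \<bar>\<Delta> (snd xK)\<bar>)"
          by (rule sum.reindex_bij_betw[OF \<pi>])
        ultimately show ?thesis by (simp add: split_def)
      qed
      finally show "norm ((\<Sum>(x, K)\<in>p. measure lborel K *\<^sub>R k' x) - (F b - F a)) < e"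
        using e'(2) by simp
    qed
  qed
  moreover have "(k' has_integral (F b - F a)) {a..b} \<longleftrightarrow> (k has_integral (F b - F a)) {a..b}"
    by (rule has_integral_spike_eq[OF N]) (auto simp: k'_def)
  ultimately show ?thesis by simp
qed

lemma abs_continuous_on_imp_continuous:
  assumes "abs_continuous_on S F" "open S"
  shows "continuous_on S F"
proof -
  have "\<exists>d>0. \<forall>y. dist y x < d \<longrightarrow> dist (F y) (F x) < e" if x: "x \<in> S" and e: "e > 0" for x e :: real
  proof -
    obtain r where r: "r > 0" "ball x r \<subseteq> S" using openE[OF assms(2) x] .
    obtain \<delta> where \<delta>: "\<delta> > 0" and ac: "\<And>m u v. nonoverlapping_in S m u v \<Longrightarrow>
        (\<Sum>i<m. v i - u i) < \<delta> \<Longrightarrow> (\<Sum>i<m. \<bar>F (v i) - F (u i)\<bar>) < e"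
      using assms(1) \<open>e > 0\<close> unfolding abs_continuous_on_iff by metis
    have "dist (F y) (F x) < e" if "dist y x < min r \<delta>" for y
    proof -
      have "{min x y..max x y} \<subseteq> ball x r" using that by (auto simp: dist_real_def)
      then have "nonoverlapping_in S 1 (\<lambda>_. min x y) (\<lambda>_. max x y)"
        using r(2) by (auto simp: nonoverlapping_in_def)
      moreover have "(\<Sum>i<1::nat. max x y - min x y) < \<delta>"
        using that by (cases "x \<le> y") (simp_all add: dist_real_def)
      ultimately have "(\<Sum>i<1::nat. \<bar>F (max x y) - F (min x y)\<bar>) < e"
        by (rule ac)
      then show ?thesis
        by (cases "x \<le> y") (simp_all add: dist_real_def abs_minus_commute)
    qed
    then show ?thesis using r \<delta> by (intro exI[of _ "min r \<delta>"]) auto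
  qed
  then show ?thesis
    by (intro continuous_at_imp_continuous_on ballI) (simp add: continuous_at_eps_delta)
qed


section \<open>Closure properties of absolute continuity\<close>

lemma abs_continuous_on_eq:
  assumes "abs_continuous_on S F" "\<And>x. x \<in> S \<Longrightarrow> G x = F x"
  shows "abs_continuous_on S G"
proof -
  have "(\<Sum>i<m. \<bar>G (b i) - G (a i)\<bar>) = (\<Sum>i<m. \<bar>F (b i) - F (a i)\<bar>)" if "nonoverlapping_in S m a b" for m a b
  proof (intro sum.cong refl)
    fix i assume "i \<in> {..<m}"
    then have "a i \<in> S" "b i \<in> S" using that by (auto simp: nonoverlapping_in_def subset_iff)
    then show "\<bar>G (b i) - G (a i)\<bar> = \<bar>F (b i) - F (a i)\<bar>" using assms(2) by simp
  qed
  then show ?thesis using assms(1) unfolding abs_continuous_on_iff by metis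
qed

lemma abs_continuous_on_add:
  assumes "abs_continuous_on S F" "abs_continuous_on S G"
  shows "abs_continuous_on S (\<lambda>x. F x + G x)"
  unfolding abs_continuous_on_iff
proof (intro allI impI)
  fix e :: real assume "e > 0"
  then have e: "e / 2 > 0" by simp
  obtain d1 where d1: "d1 > 0" "\<And>m a b. nonoverlapping_in S m a b \<Longrightarrow> (\<Sum>i<m. b i - a i) < d1
      \<Longrightarrow> (\<Sum>i<m. \<bar>F (b i) - F (a i)\<bar>) < e / 2"
    using assms(1) e unfolding abs_continuous_on_iff by metis
  obtain d2 where d2: "d2 > 0" "\<And>m a b. nonoverlapping_in S m a b \<Longrightarrow> (\<Sum>i<m. b i - a i) < d2
      \<Longrightarrow> (\<Sum>i<m. \<bar>G (b i) - G (a i)\<bar>) < e / 2"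
    using assms(2) e unfolding abs_continuous_on_iff by metis
  have "(\<Sum>i<m. \<bar>F (b i) + G (b i) - (F (a i) + G (a i))\<bar>) < e"
    if "nonoverlapping_in S m a b" "(\<Sum>i<m. b i - a i) < min d1 d2" for m a b
  proof -
    have "(\<Sum>i<m. \<bar>F (b i) + G (b i) - (F (a i) + G (a i))\<bar>)
        \<le> (\<Sum>i<m. \<bar>F (b i) - F (a i)\<bar> + \<bar>G (b i) - G (a i)\<bar>)"
      by (intro sum_mono) linarith
    also have "\<dots> < e"
      using d1(2)[OF that(1)] d2(2)[OF that(1)] that(2) by (simp add: sum.distrib)
    finally show ?thesis .
  qed
  then show "\<exists>\<delta>>0. \<forall>m a b. nonoverlapping_in S m a b \<and> (\<Sum>i<m. b i - a i) < \<delta>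
        \<longrightarrow> (\<Sum>i<m. \<bar>F (b i) + G (b i) - (F (a i) + G (a i))\<bar>) < e"
    using d1(1) d2(1) by (intro exI[of _ "min d1 d2"]) auto
qed

lemma abs_continuous_on_lipschitz:
  assumes "\<And>x y. x \<in> S \<Longrightarrow> y \<in> S \<Longrightarrow> x \<le> y \<Longrightarrow> {x..y} \<subseteq> S \<Longrightarrow> \<bar>F y - F x\<bar> \<le> L * (y - x)"
  shows "abs_continuous_on S F"
  unfolding abs_continuous_on_iff
proof (intro allI impI)
  fix e :: real assume e: "e > 0"
  have "(\<Sum>i<m. \<bar>F (b i) - F (a i)\<bar>) < e"
    if no: "nonoverlapping_in S m a b" and d: "(\<Sum>i<m. b i - a i) < e / (\<bar>L\<bar> + 1)" for m a b
  proof -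
    have "(\<Sum>i<m. \<bar>F (b i) - F (a i)\<bar>) \<le> (\<Sum>i<m. (\<bar>L\<bar> + 1) * (b i - a i))"
    proof (intro sum_mono)
      fix i assume "i \<in> {..<m}"
      then have i: "a i \<le> b i" "{a i..b i} \<subseteq> S" using no by (auto simp: nonoverlapping_in_def)
      then have "\<bar>F (b i) - F (a i)\<bar> \<le> L * (b i - a i)" by (intro assms) auto
      also have "\<dots> \<le> (\<bar>L\<bar> + 1) * (b i - a i)" using i(1) by (intro mult_right_mono) auto
      finally show "\<bar>F (b i) - F (a i)\<bar> \<le> (\<bar>L\<bar> + 1) * (b i - a i)" .
    qed
    also have "\<dots> = (\<bar>L\<bar> + 1) * (\<Sum>i<m. b i - a i)" by (simp add: sum_distrib_left)
    also have "\<dots> < e" using d by (simp add: field_simps)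
    finally show ?thesis .
  qed
  moreover have "e / (\<bar>L\<bar> + 1) > 0" using e by simp
  ultimately show "\<exists>\<delta>>0. \<forall>m a b. nonoverlapping_in S m a b \<and> (\<Sum>i<m. b i - a i) < \<delta>
        \<longrightarrow> (\<Sum>i<m. \<bar>F (b i) - F (a i)\<bar>) < e"
    by blast
qed

text \<open>Meant for clamps such as \<open>min x q\<close>: a monotone map that does not stretch
  lengths sends non-overlapping intervals to non-overlapping, possibly degenerate, ones of no
  greater total length.\<close>

lemma abs_continuous_on_comp:
  assumes F: "abs_continuous_on T F" and "mono r"
    and lip: "\<And>x y. x \<le> y \<Longrightarrow> r y - r x \<le> y - x"
    and im: "\<And>x y. x \<le> y \<Longrightarrow> {x..y} \<subseteq> S \<Longrightarrow> {r x..r y} \<subseteq> T"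
  shows "abs_continuous_on S (\<lambda>x. F (r x))"
  unfolding abs_continuous_on_iff
proof (intro allI impI)
  fix e :: real assume e: "e > 0"
  obtain d where d: "d > 0" "\<And>m a b. nonoverlapping_in T m a b \<Longrightarrow> (\<Sum>i<m. b i - a i) < d
      \<Longrightarrow> (\<Sum>i<m. \<bar>F (b i) - F (a i)\<bar>) < e"
    using F e unfolding abs_continuous_on_iff by metis
  have "(\<Sum>i<m. \<bar>F (r (b i)) - F (r (a i))\<bar>) < e"
    if no: "nonoverlapping_in S m a b" and s: "(\<Sum>i<m. b i - a i) < d" for m a b
  proof (rule d(2))
    have rab: "r (a i) \<le> r (b i)" if "i < m" for i
      using no that \<open>mono r\<close> by (auto simp: nonoverlapping_in_def mono_def)
    have "{r (a i)<..<r (b i)} \<inter> {r (a j)<..<r (b j)} = {}" if "i < m" "j < m" "i \<noteq> j" for i j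
    proof -
      have "{a i<..<b i} \<inter> {a j<..<b j} = {}" "a i \<le> b i" "a j \<le> b j"
        using no that by (auto simp: nonoverlapping_in_def)
      \<comment> \<open>Disjointness of the open intervals is restated as an inequality between end
        points, a form that survives a monotone map.\<close>
      then have "max (a i) (a j) \<ge> min (b i) (b j)"
        using dense[of "max (a i) (a j)" "min (b i) (b j)"] by (force simp: disjoint_iff)
      then have "r (min (b i) (b j)) \<le> r (max (a i) (a j))" using \<open>mono r\<close> by (simp add: mono_def)
      moreover have "r (min (b i) (b j)) = min (r (b i)) (r (b j))"
        "r (max (a i) (a j)) = max (r (a i)) (r (a j))"
        using \<open>mono r\<close> by (simp_all add: min_of_mono max_of_mono)
      ultimately show ?thesis by auto
    qed
    then show "nonoverlapping_in T m (\<lambda>i. r (a i)) (\<lambda>i. r (b i))"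
      using no rab im by (auto simp: nonoverlapping_in_def)
    have "(\<Sum>i<m. r (b i) - r (a i)) \<le> (\<Sum>i<m. b i - a i)"
      using no lip by (intro sum_mono) (auto simp: nonoverlapping_in_def)
    then show "(\<Sum>i<m. r (b i) - r (a i)) < d" using s by simp
  qed
  then show "\<exists>\<delta>>0. \<forall>m a b. nonoverlapping_in S m a b \<and> (\<Sum>i<m. b i - a i) < \<delta>
        \<longrightarrow> (\<Sum>i<m. \<bar>F (r (b i)) - F (r (a i))\<bar>) < e"
    using d(1) by blast
qed

section \<open>Test functions and the weak formulation\<close>

text \<open>The classical bump times rational factors: a family closed under differentiation, so
  that smoothness of the bump follows by induction, without explicit higher derivatives.\<close>

definition bump_poly :: "real poly \<Rightarrow> nat \<Rightarrow> real \<Rightarrow> real" where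
  "bump_poly p m x = (if \<bar>x\<bar> < 1 then poly p x / (1 - x\<^sup>2) ^ m * exp (- (1 / (1 - x\<^sup>2))) else 0)"

lemma exp_inverse_div_power_tendsto:
  "((\<lambda>s::real. exp (- (1 / s)) / s ^ m) \<longlongrightarrow> 0) (at_right 0)"
proof -
  have "((\<lambda>s::real. (inverse s) ^ m / exp (inverse s)) \<longlongrightarrow> 0) (at_right 0)"
    by (rule filterlim_compose[OF tendsto_power_div_exp_0 filterlim_inverse_at_top_right])
  then show ?thesis
    by (simp add: exp_minus field_simps)
qed

lemma bump_poly_tendsto_boundary:
  assumes "\<bar>a\<bar> = 1"
  shows "(bump_poly p m \<longlongrightarrow> 0) (at a)"
proof -
  have lim: "((\<lambda>x::real. exp (- (1 / (1 - x\<^sup>2))) / (1 - x\<^sup>2) ^ m) \<longlongrightarrow> 0) (at a within {x. \<bar>x\<bar> < 1})"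
  proof (rule filterlim_compose[OF exp_inverse_div_power_tendsto])
    have "((\<lambda>x. 1 - x\<^sup>2) \<longlongrightarrow> 0) (at a within {x. \<bar>x\<bar> < 1})"
      using assms by (auto intro!: tendsto_eq_intros simp: abs_square_eq_1)
    moreover have "\<forall>\<^sub>F x in at a within {x. \<bar>x\<bar> < 1}. 1 - x\<^sup>2 > 0"
      by (auto simp: eventually_at_filter abs_square_less_1)
    ultimately show "filterlim (\<lambda>x. 1 - x\<^sup>2) (at_right 0) (at a within {x. \<bar>x\<bar> < 1})"
      by (auto simp: filterlim_at elim: eventually_mono)
  qed
  have "((\<lambda>x. poly p x * (exp (- (1 / (1 - x\<^sup>2))) / (1 - x\<^sup>2) ^ m)) \<longlongrightarrow> poly p a * 0) (at a within {x. \<bar>x\<bar> < 1})"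
    by (intro tendsto_mult lim tendsto_poly tendsto_ident_at)
  then have "(bump_poly p m \<longlongrightarrow> poly p a * 0) (at a within {x. \<bar>x\<bar> < 1})"
    by (rule Lim_transform_eventually) (auto simp: eventually_at_filter bump_poly_def)
  then have "(bump_poly p m \<longlongrightarrow> 0) (at a within {x. \<bar>x\<bar> < 1})" by simp
  moreover have "(bump_poly p m \<longlongrightarrow> 0) (at a within {x. \<not> \<bar>x\<bar> < 1})"
    by (rule tendsto_eventually) (auto simp: eventually_at_filter bump_poly_def)
  ultimately have "(bump_poly p m \<longlongrightarrow> 0) (at a within {x. \<bar>x\<bar> < 1} \<union> {x. \<not> \<bar>x\<bar> < 1})"
    by (simp add: Lim_within_Un)
  moreover have "{x::real. \<bar>x\<bar> < 1} \<union> {x. \<not> \<bar>x\<bar> < 1} = UNIV" by auto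
  ultimately show ?thesis by simp
qed

lemma has_real_derivative_bump_poly:
  "\<exists>q n. \<forall>x. (bump_poly p m has_real_derivative bump_poly q n x) (at x)"
proof -
  define r where "r = [:1, 0, -1:: real:]"
  \<comment> \<open>Numerator of the derivative over the common denominator
    \<open>(1 - x\<^sup>2) ^ (m + 2)\<close>; the three summands come from \<open>p\<close>, from
    the power and from the exponential.\<close>
  define q where "q = pderiv p * r^2 + [:0, 2 * real m:] * p * r - [:0, 2:] * p"
  have r: "poly r x = 1 - x\<^sup>2" for x by (simp add: r_def power2_eq_square)
  have "(bump_poly p m has_real_derivative bump_poly q (m + 2) x) (at x)" for x
  proof (cases "\<bar>x\<bar> < 1")
    case True
    then have nz: "1 - x\<^sup>2 \<noteq> 0" by (simp add: abs_square_eq_1)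
    define u where "u = (\<lambda>x::real. 1 / (1 - x\<^sup>2))"
    have u: "(u has_real_derivative 2 * x * (u x)\<^sup>2) (at x)"
      unfolding u_def using nz by (auto intro!: derivative_eq_intros simp: power2_eq_square)
    have "((\<lambda>x. poly p x * u x ^ m * exp (- u x)) has_real_derivative
        (poly (pderiv p) x * u x ^ m + poly p x * (real m * u x ^ (m - 1) * (2 * x * (u x)\<^sup>2))
         - poly p x * u x ^ m * (2 * x * (u x)\<^sup>2)) * exp (- u x)) (at x)"
      by (rule derivative_eq_intros u poly_DERIV refl)+ (simp add: algebra_simps)
    also have "(poly (pderiv p) x * u x ^ m + poly p x * (real m * u x ^ (m - 1) * (2 * x * (u x)\<^sup>2))
         - poly p x * u x ^ m * (2 * x * (u x)\<^sup>2)) * exp (- u x) = bump_poly q (m + 2) x"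
    proof -
      have su: "(1 - x\<^sup>2) * u x = 1" using nz by (simp add: u_def)
      have 1: "real m * u x ^ (m - 1) * (2 * x * (u x)\<^sup>2) = 2 * real m * x * u x ^ (m + 1)"
        by (cases m) (simp_all add: power2_eq_square algebra_simps)
      have "(1 - x\<^sup>2)\<^sup>2 * u x ^ (m + 2) = ((1 - x\<^sup>2) * u x)\<^sup>2 * u x ^ m"
        "(1 - x\<^sup>2) * u x ^ (m + 2) = ((1 - x\<^sup>2) * u x) * u x ^ (m + 1)"
        by (simp_all only: power_mult_distrib power_add power_one_right power2_eq_square mult_ac)
      then have 2: "u x ^ m = (1 - x\<^sup>2)\<^sup>2 * u x ^ (m + 2)" "u x ^ (m + 1) = (1 - x\<^sup>2) * u x ^ (m + 2)"
        unfolding su by simp_all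
      have 3: "poly q x = poly (pderiv p) x * (1 - x\<^sup>2)\<^sup>2 + 2 * real m * x * poly p x * (1 - x\<^sup>2) - 2 * x * poly p x"
        by (simp add: q_def r algebra_simps)
      have "(poly (pderiv p) x * u x ^ m + poly p x * (real m * u x ^ (m - 1) * (2 * x * (u x)\<^sup>2))
         - poly p x * u x ^ m * (2 * x * (u x)\<^sup>2)) * exp (- u x)
        = (poly (pderiv p) x * u x ^ m + poly p x * (2 * real m * x * u x ^ (m + 1))
         - poly p x * (2 * x * u x ^ (m + 2))) * exp (- u x)"
        unfolding 1 by (simp add: power_add power2_eq_square)
      also have "\<dots> = poly q x * u x ^ (m + 2) * exp (- u x)"
        unfolding 2 3 by (simp add: algebra_simps)
      also have "\<dots> = bump_poly q (m + 2) x"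
        using True by (simp add: bump_poly_def u_def power_one_over)
      finally show ?thesis .
    qed
    finally have "((\<lambda>x. poly p x / (1 - x\<^sup>2) ^ m * exp (- (1 / (1 - x\<^sup>2)))) has_real_derivative bump_poly q (m + 2) x) (at x)"
      by (simp add: u_def power_one_over)
    then show ?thesis
    proof (rule DERIV_cong_ev[OF refl _ refl, THEN iffD1, rotated])
      have "open {x::real. \<bar>x\<bar> < 1}" by (intro open_Collect_less continuous_intros)
      then show "\<forall>\<^sub>F x in nhds x. poly p x / (1 - x\<^sup>2) ^ m * exp (- (1 / (1 - x\<^sup>2))) = bump_poly p m x"
        using True by (auto simp: eventually_nhds bump_poly_def)
    qed
  next
    case False
    show ?thesis
    proof (cases "\<bar>x\<bar> = 1")
      case True
      \<comment> \<open>For \<open>\<bar>x\<bar> = 1\<close> the factor \<open>1 - y\<^sup>2\<close>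
        equals \<open>- ((y - x) * (y + x))\<close>, so the difference quotient at \<open>x\<close>
        is itself a member of the family, with a known limit.\<close>
      have "(bump_poly (- p * [:x, 1:]) (m + 1) \<longlongrightarrow> 0) (at x)"
        by (rule bump_poly_tendsto_boundary[OF True])
      moreover have "bump_poly (- p * [:x, 1:]) (m + 1) y = (bump_poly p m y - bump_poly p m x) / (y - x)"
        if "y \<noteq> x" for y
      proof (cases "\<bar>y\<bar> < 1")
        case True
        then have "1 - y\<^sup>2 \<noteq> 0" by (simp add: abs_square_eq_1)
        moreover have "1 - y\<^sup>2 = - ((y - x) * (y + x))"
          using \<open>\<bar>x\<bar> = 1\<close> by (auto simp: algebra_simps power2_eq_square abs_if split: if_splits)
        ultimately have "(x + y) / (1 - y\<^sup>2) = - 1 / (y - x)"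
          using that by (simp add: field_simps)
        moreover have "bump_poly (- p * [:x, 1:]) (m + 1) y
            = - (poly p y / (1 - y\<^sup>2) ^ m * exp (- (1 / (1 - y\<^sup>2)))) * ((x + y) / (1 - y\<^sup>2))"
          using True \<open>1 - y\<^sup>2 \<noteq> 0\<close> by (simp add: bump_poly_def) (simp add: field_simps)
        ultimately show ?thesis
          using True \<open>\<bar>x\<bar> = 1\<close> by (simp add: bump_poly_def)
      qed (use \<open>\<bar>x\<bar> = 1\<close> in \<open>simp add: bump_poly_def\<close>)
      ultimately have "((\<lambda>y. (bump_poly p m y - bump_poly p m x) / (y - x)) \<longlongrightarrow> 0) (at x)"
        by (simp cong: LIM_cong)
      then show ?thesis
        using \<open>\<bar>x\<bar> = 1\<close> by (simp add: has_field_derivative_iff bump_poly_def)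
    next
      case False
      then have "\<bar>x\<bar> > 1" using \<open>\<not> \<bar>x\<bar> < 1\<close> by simp
      have "((\<lambda>_. 0) has_real_derivative bump_poly q (m + 2) x) (at x)"
        using \<open>\<bar>x\<bar> > 1\<close> by (simp add: bump_poly_def)
      then show ?thesis
      proof (rule DERIV_cong_ev[OF refl _ refl, THEN iffD1, rotated])
        have "open {x::real. \<bar>x\<bar> > 1}" by (intro open_Collect_less continuous_intros)
        then show "\<forall>\<^sub>F x in nhds x. 0 = bump_poly p m x"
          using \<open>\<bar>x\<bar> > 1\<close> by (auto simp: eventually_nhds bump_poly_def)
      qed
    qed
  qed
  then show ?thesis by blast
qed


lemma higher_deriv_bump_poly:
  assumes "r \<noteq> 0"
  shows "\<exists>q n. (deriv ^^ k) (\<lambda>x. bump_poly p m ((x - a) / r)) = (\<lambda>x. bump_poly q n ((x - a) / r))"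
proof (induction k)
  case (Suc k)
  then obtain q n where q: "(deriv ^^ k) (\<lambda>x. bump_poly p m ((x - a) / r)) = (\<lambda>x. bump_poly q n ((x - a) / r))"
    by blast
  obtain q' n' where "\<And>x. (bump_poly q n has_real_derivative bump_poly q' n' x) (at x)"
    using has_real_derivative_bump_poly by blast
  then have "((\<lambda>x. bump_poly q n ((x - a) / r)) has_real_derivative bump_poly q' n' ((x - a) / r) * (1 / r)) (at x)" for x
    by (rule DERIV_chain2) (auto intro!: derivative_eq_intros simp: assms)
  then have "(deriv ^^ Suc k) (\<lambda>x. bump_poly p m ((x - a) / r)) = (\<lambda>x. bump_poly q' n' ((x - a) / r) * (1 / r))"
    by (auto simp: q intro!: DERIV_imp_deriv)
  also have "\<dots> = (\<lambda>x. bump_poly (smult (1 / r) q') n' ((x - a) / r))"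
    by (auto simp: bump_poly_def)
  finally show ?case by blast
qed auto

text \<open>A jump of the flux at \<open>a\<close> is paired with \<open>\<psi> a\<close>, so a
  nonzero value at the prescribed point is what has to be secured.\<close>

lemma ex_test_function:
  assumes "open I" "a \<in> I"
  shows "\<exists>\<psi>. test_function I \<psi> \<and> \<psi> a \<noteq> 0"
proof -
  obtain r where r: "r > 0" "cball a r \<subseteq> I"
    using assms by (meson open_contains_cball)
  define \<psi> where "\<psi> = (\<lambda>x. bump_poly 1 0 ((x - a) / r))"
  have "(deriv ^^ k) \<psi> differentiable_on UNIV" for k
  proof -
    obtain q n where q: "(deriv ^^ k) \<psi> = (\<lambda>x. bump_poly q n ((x - a) / r))"
      using higher_deriv_bump_poly[of r k 1 0 a] r(1) unfolding \<psi>_def by auto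
    obtain q' n' where "\<And>x. (bump_poly q n has_real_derivative bump_poly q' n' x) (at x)"
      using has_real_derivative_bump_poly by blast
    then have "((\<lambda>x. bump_poly q n ((x - a) / r)) has_real_derivative bump_poly q' n' ((x - a) / r) * (1 / r)) (at x)" for x
      by (rule DERIV_chain2) (use r(1) in \<open>auto intro!: derivative_eq_intros\<close>)
    then show ?thesis
      unfolding q by (auto simp: differentiable_on_def real_differentiable_def)
  qed
  moreover have cl: "closure {x. \<psi> x \<noteq> 0} \<subseteq> cball a r"
    using r(1) by (intro closure_minimal) (auto simp: \<psi>_def bump_poly_def dist_real_def field_simps split: if_splits)
  then have "compact (closure {x. \<psi> x \<noteq> 0})"
    using compact_cball compact_closure bounded_subset closure_subset
    by (meson bounded_cball order_trans)
  moreover have "\<psi> a \<noteq> 0" by (simp add: \<psi>_def bump_poly_def)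
  ultimately show ?thesis using r(2) cl unfolding test_function_def by blast
qed

text \<open>Between exceptional points \<open>G\<close> is an indefinite integral of the continuous
  \<open>K\<close>, and continuity of \<open>G\<close> carries this across them. It removes the seam
  when two solutions are glued at a point.\<close>

lemma has_real_derivative_continuous_extension:
  fixes G K :: "real \<Rightarrow> real"
  assumes S: "open S" and G: "continuous_on S G" and K: "continuous_on S K" and "finite E"
    and D: "\<And>x. x \<in> S - E \<Longrightarrow> (G has_real_derivative K x) (at x)" and x: "x \<in> S"
  shows "(G has_real_derivative K x) (at x)"
proof -
  obtain r where r: "r > 0" "cball x r \<subseteq> S" using S x by (meson open_contains_cball)
  have sub: "{x - r..x + r} \<subseteq> S" using r by (auto simp: cball_def dist_real_def subset_eq abs_le_iff)
  have "((\<lambda>y. integral {x - r..y} K) has_real_derivative K x) (at x within {x - r..x + r})"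
    using r(1) by (intro integral_has_real_derivative continuous_on_subset[OF K sub]) auto
  then have *: "((\<lambda>y. integral {x - r..y} K) has_real_derivative K x) (at x)"
    using at_within_Icc_at[of "x - r" x "x + r"] r(1) by (simp del: add_uminus_conv_diff)
  have "G y = G (x - r) + integral {x - r..y} K" if "y \<in> {x - r<..<x + r}" for y
  proof -
    have "(K has_integral (G y - G (x - r))) {x - r..y}"
    proof (rule fundamental_theorem_of_calculus_interior_strong[OF \<open>finite E\<close>])
      show "continuous_on {x - r..y} G"
        using that sub by (intro continuous_on_subset[OF G]) auto
      show "(G has_vector_derivative K z) (at z)" if "z \<in> {x - r<..<y} - E" for z
        using D[of z] that \<open>y \<in> _\<close> sub by (auto simp: has_real_derivative_iff_has_vector_derivative subset_eq)
    qed (use that in auto)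
    then show ?thesis by (simp add: integral_unique)
  qed
  then have "\<forall>\<^sub>F y in nhds x. G y = G (x - r) + integral {x - r..y} K"
    using r(1) unfolding eventually_nhds
    by (intro exI[of _ "{x - r<..<x + r}"]) auto
  moreover have "((\<lambda>y. G (x - r) + integral {x - r..y} K) has_real_derivative K x) (at x)"
    using * by (auto intro!: derivative_eq_intros)
  ultimately show ?thesis by (metis DERIV_cong_ev)
qed

section \<open>Integration by parts against test functions\<close>

lemma test_function_has_derivative:
  assumes "test_function I \<psi>"
  shows "(\<psi> has_real_derivative deriv \<psi> x) (at x)" "continuous_on UNIV (deriv \<psi>)"
proof -
  have "(deriv ^^ 0) \<psi> differentiable_on UNIV" "(deriv ^^ 1) \<psi> differentiable_on UNIV"
    using assms unfolding test_function_def by blast+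
  then show "(\<psi> has_real_derivative deriv \<psi> x) (at x)" "continuous_on UNIV (deriv \<psi>)"
    by (auto simp: differentiable_on_def DERIV_deriv_iff_real_differentiable
        intro: differentiable_imp_continuous_on)
qed

text \<open>Reduces integrals over an unbounded \<open>I\<close> to a compact interval, taken
  slightly larger than the support so that \<open>\<psi>\<close> vanishes at its end points.\<close>

lemma test_function_support:
  assumes "test_function I \<psi>" "open I" "is_interval I" "I \<noteq> {}"
  obtains x y where "x < y" "{x..y} \<subseteq> I" "\<And>t. t \<notin> {x<..<y} \<Longrightarrow> \<psi> t = 0 \<and> deriv \<psi> t = 0"
proof -
  define K where "K = closure {t. \<psi> t \<noteq> 0}"
  have K: "compact K" "K \<subseteq> I" using assms unfolding test_function_def K_def by auto
  have out: "\<psi> t = 0 \<and> deriv \<psi> t = 0" if "t \<notin> K" for t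
  proof -
    have "open (- K)" by (simp add: K_def open_Compl)
    moreover have "\<psi> s = 0" if "s \<in> - K" for s
      using that closure_subset[of "{t. \<psi> t \<noteq> 0}"] by (auto simp: K_def)
    ultimately have "\<forall>\<^sub>F s in nhds t. \<psi> s = 0"
      using \<open>t \<notin> K\<close> by (auto simp: eventually_nhds)
    then have "(\<psi> has_real_derivative 0) (at t)"
      using DERIV_cong_ev[of t t \<psi> "\<lambda>_. 0" 0 0] by simp
    then show ?thesis using \<open>\<And>s. s \<in> - K \<Longrightarrow> \<psi> s = 0\<close> that by (auto intro: DERIV_imp_deriv)
  qed
  have "\<exists>x0 y0. x0 \<in> I \<and> y0 \<in> I \<and> K \<subseteq> {x0..y0} \<and> x0 \<le> y0"
  proof (cases "K = {}")
    case True then show ?thesis using assms(4) by auto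
  next
    case False
    obtain u v where "u \<in> K" "v \<in> K" "\<forall>t\<in>K. u \<le> t" "\<forall>t\<in>K. t \<le> v"
      using compact_attains_inf[OF K(1) False] compact_attains_sup[OF K(1) False] by blast
    then show ?thesis using K(2) by (intro exI[of _ u] exI[of _ v]) (auto simp: subset_eq)
  qed
  then obtain x0 y0 where xy: "x0 \<in> I" "y0 \<in> I" "K \<subseteq> {x0..y0}" "x0 \<le> y0" by blast
  obtain r where r: "r > 0" "cball x0 r \<subseteq> I" using assms(2) xy(1) by (meson open_contains_cball)
  obtain r' where r': "r' > 0" "cball y0 r' \<subseteq> I" using assms(2) xy(2) by (meson open_contains_cball)
  have "x0 - r \<in> I" "y0 + r' \<in> I" using r r' by (auto simp: subset_eq dist_real_def)
  then have "{x0 - r..y0 + r'} \<subseteq> I"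
    using assms(3) by (meson atLeastAtMost_iff is_interval_1 subsetI)
  then show thesis
    using that[of "x0 - r" "y0 + r'"] xy r(1) r'(1) out
    by (smt (verit) atLeastAtMost_iff greaterThanLessThan_iff subset_iff)
qed

text \<open>The actual flux term \<open>w\<close> may have arbitrary values at finitely many points,
  because \<open>deriv\<close> is unspecified at a sharp point. Continuity is therefore asked of
  \<open>V\<close>, which differs from \<open>w\<close> on a negligible set; the product
  \<open>V * \<psi>\<close> is a primitive of the integrand and vanishes at both ends of the
  support.\<close>

lemma weak_form_by_parts:
  fixes V k \<psi> :: "real \<Rightarrow> real"
  assumes I: "open I" "is_interval I" "I \<noteq> {}" and \<psi>: "test_function I \<psi>"
    and V: "continuous_on I V" and k: "continuous_on I k" and "finite E"
    and D: "\<And>x. x \<in> I - E \<Longrightarrow> (V has_real_derivative - k x) (at x)"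
    and w: "\<And>x. x \<in> I - E' \<Longrightarrow> w x = V x" and "finite E'"
  shows "(LINT x:I|lebesgue. w x * deriv \<psi> x - k x * \<psi> x) = 0"
    and "set_integrable lebesgue I (\<lambda>x. w x * deriv \<psi> x - k x * \<psi> x)"
proof -
  obtain x y where xy: "x < y" "{x..y} \<subseteq> I" and out: "\<And>t. t \<notin> {x<..<y} \<Longrightarrow> \<psi> t = 0 \<and> deriv \<psi> t = 0"
    using test_function_support[OF \<psi> I] by blast
  have \<psi>c: "continuous_on {x..y} \<psi>" "continuous_on {x..y} (deriv \<psi>)"
    using test_function_has_derivative[OF \<psi>]
    by (auto intro: continuous_on_subset DERIV_isCont continuous_at_imp_continuous_on)
  define q where "q = (\<lambda>t. V t * deriv \<psi> t - k t * \<psi> t)"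
  have "(q has_integral (V y * \<psi> y - V x * \<psi> x)) {x..y}"
  proof (rule fundamental_theorem_of_calculus_interior_strong[OF \<open>finite E\<close>])
    show "continuous_on {x..y} (\<lambda>t. V t * \<psi> t)"
      using \<psi>c xy by (intro continuous_intros continuous_on_subset[OF V]) auto
    fix z assume z: "z \<in> {x<..<y} - E"
    have "((\<lambda>t. V t * \<psi> t) has_real_derivative (V z * deriv \<psi> z + - k z * \<psi> z)) (at z)"
      using z xy by (intro DERIV_mult' test_function_has_derivative[OF \<psi>] D) auto
    then show "((\<lambda>t. V t * \<psi> t) has_vector_derivative q z) (at z)"
      by (simp add: has_real_derivative_iff_has_vector_derivative q_def)
  qed (use xy in auto)
  then have int: "integral {x..y} q = 0" using out[of x] out[of y] by (auto intro: integral_unique)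
  have "continuous_on {x..y} q"
    unfolding q_def using \<psi>c xy by (intro continuous_intros continuous_on_subset[OF V] continuous_on_subset[OF k]) auto
  then have ai: "q absolutely_integrable_on {x..y}"
    using absolutely_integrable_continuous_real by blast
  let ?w = "\<lambda>x. w x * deriv \<psi> x - k x * \<psi> x"
  have wq: "?w t = q t" if "t \<in> {x..y} - E'" for t using that w[of t] xy by (auto simp: q_def)
  have N: "negligible E'" using \<open>finite E'\<close> by (rule negligible_finite)
  have ai': "?w absolutely_integrable_on {x..y}"
    using absolutely_integrable_spike[OF ai N, of ?w] wq by blast
  have ind: "indicator I t *\<^sub>R ?w t = indicator {x..y} t *\<^sub>R ?w t" for t
    using out[of t] xy by (auto simp: indicator_def)
  show "set_integrable lebesgue I ?w"
    using ai' unfolding set_integrable_def ind .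
  have "(LINT t:I|lebesgue. ?w t) = (LINT t:{x..y}|lebesgue. ?w t)"
    unfolding set_lebesgue_integral_def ind ..
  also have "\<dots> = integral {x..y} ?w" by (rule set_lebesgue_integral_eq_integral[OF ai'])
  also have "\<dots> = integral {x..y} q"
    by (rule integral_spike[OF N]) (use wq in auto)
  finally show "(LINT t:I|lebesgue. ?w t) = 0" using int by simp
qed

section \<open>The flux of a profile\<close>

text \<open>One locale serves the front (\<open>I = UNIV\<close>) and the semi-wavefronts
  (\<open>I\<close> a left half-line): the interval is described by being closed downwards and
  containing \<open>0\<close>, and the value \<open>g 0\<close> is left free, since there the two
  kinds of sources differ.\<close>

locale profile =
  fixes R c :: real and D f h g \<phi> :: "real \<Rightarrow> real" and I :: "real set"
  assumes R_pos: "R > 0"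
    and f_C1: "C1_on {0..R} f h"
    and g_cont: "continuous_on {0..R} g"
    and g_pos: "\<And>s. s \<in> {0<..<R} \<Longrightarrow> g s > 0"
    and g_R: "g R = 0"
    and D_cont: "continuous_on {0..R} D"
    and D_pos: "\<And>s. s \<in> {0<..<R} \<Longrightarrow> D s > 0"
    and I_down: "\<And>x y. x \<in> I \<Longrightarrow> y \<le> x \<Longrightarrow> y \<in> I"
    and wave: "traveling_wave R D f g c I \<phi>"
    and sharp: "classical_or_sharp D h g c I \<phi>"
    and anti: "antimono_on I \<phi>"
    and lim_bot: "(\<phi> \<longlongrightarrow> R) at_bot"
    and zero_I: "0 \<in> I"
    and \<phi>_0: "\<phi> 0 = R / 2"
begin

definition "reg = {x \<in> I. 0 < \<phi> x \<and> \<phi> x < R}"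
definition "F x = D (\<phi> x) * deriv \<phi> x"
definition "W x = F x - f (\<phi> x) + c * \<phi> x"

lemma I_open: "open I" and I_interval: "is_interval I" and \<phi>_cont: "continuous_on I \<phi>"
  and \<phi>_range: "x \<in> I \<Longrightarrow> 0 \<le> \<phi> x \<and> \<phi> x \<le> R"
  using wave unfolding traveling_wave_def by auto

lemma anti_D: "y \<in> I \<Longrightarrow> x \<le> y \<Longrightarrow> \<phi> y \<le> \<phi> x"
  using anti I_down by (auto simp: monotone_on_def)

lemma reg_sub: "reg \<subseteq> I" by (auto simp: reg_def)

lemma reg_open: "open reg"
proof -
  have "reg = I \<inter> \<phi> -` {0<..<R}" by (auto simp: reg_def)
  then show ?thesis using \<phi>_cont I_open by (simp add: continuous_open_preimage)
qed

lemma reg_between: "x \<in> reg \<Longrightarrow> y \<in> reg \<Longrightarrow> {x..y} \<subseteq> reg"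
proof
  fix z assume "x \<in> reg" "y \<in> reg" and z: "z \<in> {x..y}"
  then have "x \<in> I" "y \<in> I" "0 < \<phi> y" "\<phi> x < R" by (auto simp: reg_def)
  moreover have "z \<in> I" using I_down[OF \<open>y \<in> I\<close>] z by simp
  ultimately show "z \<in> reg"
    using anti_D[of y z] anti_D[of z x] z by (auto simp: reg_def)
qed

lemma zero_reg: "0 \<in> reg"
  using zero_I \<phi>_0 R_pos by (simp add: reg_def)

lemma reg_range: "x \<in> reg \<Longrightarrow> \<phi> x \<in> {0<..<R}" by (simp add: reg_def)

text \<open>\<open>g\<close> vanishes at the image of a sharp point but is positive between
  \<open>0\<close> and \<open>R\<close>, which keeps sharp points out of \<open>reg\<close>.\<close>

lemma classical_on_reg:
  "\<exists>E. finite E \<and> reg \<subseteq> I - E \<and> E \<subseteq> I \<and> inj_on \<phi> E \<and>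
    (\<forall>\<xi>\<in>E. g (\<phi> \<xi>) = 0 \<and> \<not> \<phi> differentiable (at \<xi>)) \<and> classical_on D h g c (I - E) \<phi>"
proof -
  obtain E where E: "finite E" "E \<subseteq> I" "inj_on \<phi> E"
    "\<And>\<xi>. \<xi> \<in> E \<Longrightarrow> g (\<phi> \<xi>) = 0 \<and> \<not> \<phi> differentiable (at \<xi>)" "classical_on D h g c (I - E) \<phi>"
    using sharp unfolding classical_or_sharp_def by blast
  have "reg \<subseteq> I - E"
  proof
    fix x assume x: "x \<in> reg"
    then have "g (\<phi> x) \<noteq> 0" using g_pos[OF reg_range[OF x]] by simp
    then show "x \<in> I - E" using E(4)[of x] reg_sub x by blast
  qed
  then show ?thesis using E by blast
qed

lemma \<phi>_deriv: "x \<in> reg \<Longrightarrow> (\<phi> has_real_derivative deriv \<phi> x) (at x)"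
proof -
  assume x: "x \<in> reg"
  obtain E where "reg \<subseteq> I - E" "classical_on D h g c (I - E) \<phi>"
    using classical_on_reg by blast
  then have "\<phi> differentiable (at x)" using x unfolding classical_on_def by blast
  then show ?thesis by (simp add: DERIV_deriv_iff_real_differentiable)
qed

lemma f_deriv: "s \<in> {0<..<R} \<Longrightarrow> (f has_real_derivative h s) (at s)"
  using f_C1 at_within_Icc_at[of 0 s R] unfolding C1_on_def
  by (metis atLeastAtMost_iff greaterThanLessThan_iff less_imp_le)

lemma comp_\<phi>_cont:
  assumes "continuous_on {0..R} u" shows "continuous_on I (\<lambda>x. u (\<phi> x))"
  using \<phi>_range by (intro continuous_on_compose2[OF assms \<phi>_cont]) auto

lemma F_cont: "continuous_on reg F"
proof -
  obtain E where E: "finite E" "reg \<subseteq> I - E" "classical_on D h g c (I - E) \<phi>"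
    using classical_on_reg by blast
  have "continuous_on (I - E) F"
    using E(1,3) I_open unfolding classical_on_def F_def
    by (intro abs_continuous_on_imp_continuous) (auto intro: open_Diff finite_imp_closed)
  then show ?thesis using E(2) continuous_on_subset by blast
qed

lemma deriv_\<phi>_cont: "continuous_on reg (deriv \<phi>)"
proof -
  have "D (\<phi> x) \<noteq> 0" if "x \<in> reg" for x using D_pos[OF reg_range[OF that]] by simp
  then have "continuous_on reg (\<lambda>x. F x / D (\<phi> x))"
    by (intro continuous_intros F_cont continuous_on_subset[OF comp_\<phi>_cont[OF D_cont] reg_sub]) auto
  moreover have "F x / D (\<phi> x) = deriv \<phi> x" if "x \<in> reg" for x
    using D_pos[OF reg_range[OF that]] by (simp add: F_def)
  ultimately show ?thesis by (simp cong: continuous_on_cong)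
qed

text \<open>Absolute continuity makes \<open>F\<close> the integral of its almost everywhere
  derivative, and that derivative agrees with the continuous function \<open>k\<close> below; so no
  exceptional set remains.\<close>

lemma F_deriv:
  assumes "x \<in> reg"
  shows "(F has_real_derivative - (c - h (\<phi> x)) * deriv \<phi> x - g (\<phi> x)) (at x)"
proof -
  obtain E where E: "finite E" "reg \<subseteq> I - E" and cl: "classical_on D h g c (I - E) \<phi>"
    using classical_on_reg by blast
  define k where "k = (\<lambda>x. - (c - h (\<phi> x)) * deriv \<phi> x - g (\<phi> x))"
  have "continuous_on {0..R} h" using f_C1 by (simp add: C1_on_def)
  then have k: "continuous_on reg k"
    unfolding k_def
    by (intro continuous_intros deriv_\<phi>_cont continuous_on_subset[OF comp_\<phi>_cont reg_sub] g_cont)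
  have "AE x in lebesgue. x \<in> I - E \<longrightarrow> (F has_real_derivative k x) (at x)"
  proof -
    have "AE \<xi> in lebesgue. \<xi> \<in> I - E \<longrightarrow> (\<exists>w. (F has_real_derivative w) (at \<xi>) \<and>
             w + (c - h (\<phi> \<xi>)) * deriv \<phi> \<xi> + g (\<phi> \<xi>) = 0)"
      using cl unfolding classical_on_def F_def by blast
    then show ?thesis
    proof eventually_elim
      case (elim \<xi>)
      show ?case
      proof
        assume "\<xi> \<in> I - E"
        then obtain w where w: "(F has_real_derivative w) (at \<xi>)" "w + (c - h (\<phi> \<xi>)) * deriv \<phi> \<xi> + g (\<phi> \<xi>) = 0"
          using elim by blast
        then have "w = k \<xi>" by (simp add: k_def algebra_simps)
        with w show "(F has_real_derivative k \<xi>) (at \<xi>)" by simp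
      qed
    qed
  qed
  then obtain N where N: "negligible N" and kN: "\<And>x. x \<in> reg - N \<Longrightarrow> (F has_real_derivative k x) (at x)"
    using E(2) unfolding negligible_iff_null_sets
    by (elim AE_E3) (auto simp: subset_iff)
  obtain r where r: "r > 0" "cball x r \<subseteq> reg" using reg_open assms by (meson open_contains_cball)
  have sub: "{x - r..x + r} \<subseteq> reg" using r by (auto simp: cball_def dist_real_def subset_eq abs_le_iff)
  have AC: "abs_continuous_on reg F"
    using cl E(2) abs_continuous_on_subset unfolding classical_on_def F_def by blast
  have "((\<lambda>y. integral {x - r..y} k) has_real_derivative k x) (at x within {x - r..x + r})"
    using r(1) by (intro integral_has_real_derivative continuous_on_subset[OF k sub]) auto
  then have *: "((\<lambda>y. integral {x - r..y} k) has_real_derivative k x) (at x)"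
    using at_within_Icc_at[of "x - r" x "x + r"] r(1) by (simp del: add_uminus_conv_diff)
  have "F y = F (x - r) + integral {x - r..y} k" if "y \<in> {x - r<..<x + r}" for y
  proof -
    have "(k has_integral (F y - F (x - r))) {x - r..y}"
    proof (rule abs_continuous_on_has_integral[OF _ _ N])
      show "abs_continuous_on {x - r..y} F"
        using that sub by (intro abs_continuous_on_subset[OF AC]) auto
      show "(F has_real_derivative k z) (at z within {x - r..y})" if "z \<in> {x - r..y} - N" for z
        using that sub \<open>y \<in> _\<close> by (intro has_field_derivative_at_within[OF kN]) auto
    qed (use that in auto)
    then show ?thesis by (simp add: integral_unique)
  qed
  then have "\<forall>\<^sub>F y in nhds x. F y = F (x - r) + integral {x - r..y} k"
    using r(1) unfolding eventually_nhds
    by (intro exI[of _ "{x - r<..<x + r}"]) auto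
  moreover have "((\<lambda>y. F (x - r) + integral {x - r..y} k) has_real_derivative k x) (at x)"
    using * by (auto intro!: derivative_eq_intros)
  ultimately have "(F has_real_derivative k x) (at x)" by (metis DERIV_cong_ev)
  then show ?thesis by (simp add: k_def)
qed

lemma W_deriv:
  assumes "x \<in> reg"
  shows "(W has_real_derivative - g (\<phi> x)) (at x)"
proof -
  have "((\<lambda>x. f (\<phi> x)) has_real_derivative h (\<phi> x) * deriv \<phi> x) (at x)"
    by (rule DERIV_chain2[OF f_deriv[OF reg_range[OF assms]] \<phi>_deriv[OF assms]])
  then have "((\<lambda>x. F x - f (\<phi> x) + c * \<phi> x) has_real_derivative
      (- (c - h (\<phi> x)) * deriv \<phi> x - g (\<phi> x)) - h (\<phi> x) * deriv \<phi> x + c * deriv \<phi> x) (at x)"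
    by (intro derivative_intros F_deriv \<phi>_deriv assms DERIV_cmult)
  then show ?thesis unfolding W_def[abs_def] by (simp add: algebra_simps)
qed

lemma F_nonpos: "x \<in> reg \<Longrightarrow> F x \<le> 0"
proof -
  assume x: "x \<in> reg"
  have "deriv \<phi> x \<le> 0"
  proof (rule ccontr)
    assume "\<not> ?thesis"
    then obtain d where d: "d > 0" "\<And>u. u > 0 \<Longrightarrow> u < d \<Longrightarrow> \<phi> x < \<phi> (x + u)"
      using DERIV_pos_inc_right[OF \<phi>_deriv[OF x]] by force
    obtain r where r: "r > 0" "ball x r \<subseteq> reg" using reg_open x by (meson openE)
    define u where "u = min d r / 2"
    have "u > 0" "u < d" "x + u \<in> ball x r" using d r by (auto simp: u_def dist_real_def)
    then show False using d(2)[of u] anti_D[of "x + u" x] r(2) reg_sub by force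
  qed
  then show ?thesis using D_pos[OF reg_range[OF x]] by (simp add: F_def mult_nonneg_nonpos)
qed

text \<open>At a zero of \<open>F\<close> also \<open>deriv \<phi>\<close> vanishes, and the
  equation leaves \<open>- g (\<phi> x) < 0\<close> as derivative of \<open>F\<close>; then
  \<open>F\<close> would be positive just to the left, against \<open>F_nonpos\<close>.\<close>

lemma F_neg: assumes x: "x \<in> reg" shows "F x < 0"
proof (rule ccontr)
  assume "\<not> F x < 0"
  then have "F x = 0" using F_nonpos[OF x] by simp
  then have "deriv \<phi> x = 0" using D_pos[OF reg_range[OF x]] by (simp add: F_def)
  then have "(F has_real_derivative - g (\<phi> x)) (at x)" using F_deriv[OF x] by simp
  moreover have "- g (\<phi> x) < 0" using g_pos[OF reg_range[OF x]] by simp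
  ultimately obtain d where d: "d > 0" "\<And>u. u > 0 \<Longrightarrow> u < d \<Longrightarrow> F (x - u) > F x"
    using DERIV_neg_dec_left by blast
  obtain r where r: "r > 0" "ball x r \<subseteq> reg" using reg_open x by (meson openE)
  define u where "u = min d r / 2"
  have "u > 0" "u < d" "x - u \<in> ball x r" using d r by (auto simp: u_def dist_real_def)
  then show False using d(2)[of u] F_nonpos[of "x - u"] \<open>F x = 0\<close> r(2) by force
qed

lemma deriv_\<phi>_neg: "x \<in> reg \<Longrightarrow> deriv \<phi> x < 0"
  using F_neg[of x] D_pos[OF reg_range[of x]] by (simp add: F_def mult_less_0_iff)

lemma \<phi>_strict: assumes "x \<in> reg" "y \<in> reg" "x < y" shows "\<phi> y < \<phi> x"
proof (rule DERIV_neg_imp_decreasing[OF assms(3)])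
  fix z assume "x \<le> z" "z \<le> y"
  then have "z \<in> reg" using reg_between[OF assms(1,2)] by auto
  then show "\<exists>d. (\<phi> has_real_derivative d) (at z) \<and> d < 0" using \<phi>_deriv deriv_\<phi>_neg by blast
qed

section \<open>The flux where the profile tends to \<open>R\<close> or touches it\<close>

lemma left_edge:
  assumes "x1 \<in> I" "\<phi> x1 = R"
  obtains a where "a < 0" "\<And>x. x \<in> I \<Longrightarrow> \<phi> x = R \<longleftrightarrow> x \<le> a"
proof -
  define S where "S = {x \<in> {..0}. \<phi> x = R}"
  have sub: "{..0} \<subseteq> I" using I_down zero_I by auto
  have neg: "x < 0" if "x \<in> I" "\<phi> x = R" for x
    using anti_D[OF that(1), of 0] that(2) \<phi>_0 R_pos by (cases "x < 0") auto
  have "x1 \<in> S" using neg assms by (force simp: S_def)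
  have "closed S"
  proof -
    have "S = {..0} \<inter> \<phi> -` {R}" by (auto simp: S_def)
    then show ?thesis
      using continuous_on_subset[OF \<phi>_cont sub] by (auto intro: continuous_closed_preimage)
  qed
  have bdd: "bdd_above S" by (auto simp: S_def)
  define a where "a = Sup S"
  have aS: "a \<in> S" unfolding a_def using closed_contains_Sup[OF _ bdd \<open>closed S\<close>] \<open>x1 \<in> S\<close> by blast
  show thesis
  proof (rule that)
    show "a < 0" using aS sub neg by (auto simp: S_def)
    show "\<phi> x = R \<longleftrightarrow> x \<le> a" if "x \<in> I" for x
    proof
      assume "\<phi> x = R"
      then have "x \<in> S" using neg[OF that] by (simp add: S_def)
      then show "x \<le> a" unfolding a_def using bdd by (rule cSup_upper)
    next
      assume "x \<le> a"
      then show "\<phi> x = R"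
        using anti_D[of a x] aS sub \<phi>_range[OF that] by (auto simp: S_def)
    qed
  qed
qed

text \<open>Monotonicity of \<open>W\<close> propagates a large value of
  \<open>\<bar>F\<bar>\<close> to the right. If such values occur arbitrarily far to the left, then
  \<open>F \<le> - \<epsilon> / 2\<close> on a whole half-line, and the bound on \<open>D\<close>
  forces a slope too steep for a bounded profile.\<close>

lemma F_vanishes_unbounded:
  assumes all: "\<And>x. x \<in> I \<Longrightarrow> \<phi> x < R" and \<epsilon>: "\<epsilon> > 0"
  shows "\<exists>X\<le>0. \<forall>x\<le>X. \<bar>F x\<bar> < \<epsilon>"
proof (rule ccontr)
  assume no: "\<not> ?thesis"
  have reg: "x \<in> reg" if "x \<le> 0" for x
  proof -
    have "x \<in> I" using I_down zero_I that by blast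
    then show ?thesis using all anti_D[of 0 x] that zero_I \<phi>_0 R_pos by (auto simp: reg_def)
  qed
  have Wmono: "W y \<le> W x" if "x \<le> y" "y \<le> 0" for x y
  proof (rule DERIV_nonpos_imp_nonincreasing[OF that(1)])
    fix z assume "x \<le> z" "z \<le> y"
    then have "z \<in> reg" using reg that by auto
    then show "\<exists>d. (W has_real_derivative d) (at z) \<and> d \<le> 0"
      using W_deriv g_pos[OF reg_range] by (meson less_imp_le neg_le_0_iff_le)
  qed
  define q where "q = (\<lambda>x. f (\<phi> x) - c * \<phi> x)"
  have Wq: "F x = W x + q x" for x by (simp add: q_def W_def)
  have ev: "\<forall>\<^sub>F x in at_bot. \<phi> x \<in> {0..R}"
    using eventually_le_at_bot[of 0] by eventually_elim (use reg \<phi>_range reg_sub in auto)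
  have "continuous_on {0..R} f" using f_C1 unfolding C1_on_def by (meson DERIV_continuous_on)
  then have "continuous_on {0..R} (\<lambda>s. f s - c * s)" by (intro continuous_intros)
  then have "((\<lambda>x. (\<lambda>s. f s - c * s) (\<phi> x)) \<longlongrightarrow> f R - c * R) at_bot"
    by (rule continuous_on_tendsto_compose[OF _ lim_bot _ ev]) (use R_pos in auto)
  then have "\<forall>\<^sub>F x in at_bot. dist (q x) (f R - c * R) < \<epsilon> / 4"
    unfolding q_def by (rule tendstoD) (use \<epsilon> in auto)
  then obtain X0 where X0: "\<And>x. x \<le> X0 \<Longrightarrow> dist (q x) (f R - c * R) < \<epsilon> / 4"
    unfolding eventually_at_bot_linorder by blast
  define X where "X = min X0 0"
  have Fle: "F x \<le> - \<epsilon> / 2" if "x \<le> X" for x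
  proof -
    have "x \<le> 0" using that by (simp add: X_def)
    then obtain y where y: "y \<le> x" "\<not> \<bar>F y\<bar> < \<epsilon>" using no by blast
    then have "F y \<le> - \<epsilon>" using F_nonpos[OF reg, of y] \<open>x \<le> 0\<close> by auto
    moreover have "W x \<le> W y" using Wmono y \<open>x \<le> 0\<close> by blast
    moreover have "\<bar>q x - q y\<bar> < \<epsilon> / 2"
    proof -
      have "x \<le> X0" "y \<le> X0" using that y by (auto simp: X_def)
      then have "\<bar>q x - (f R - c * R)\<bar> < \<epsilon> / 4" "\<bar>q y - (f R - c * R)\<bar> < \<epsilon> / 4"
        using X0 by (simp_all add: dist_real_def)
      then show ?thesis by linarith
    qed
    ultimately show ?thesis using Wq[of x] Wq[of y] by linarith
  qed
  obtain M where M: "M > 0" "\<And>s. s \<in> {0..R} \<Longrightarrow> D s \<le> M"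
  proof -
    have "bounded (D ` {0..R})"
      by (intro compact_imp_bounded compact_continuous_image D_cont) simp
    then show thesis using that unfolding bounded_pos by (force simp: abs_le_iff)
  qed
  have slope: "deriv \<phi> x \<le> - (\<epsilon> / (2 * M))" if "x \<le> X" for x
  proof -
    have r: "x \<in> reg" using reg that by (simp add: X_def)
    have "D (\<phi> x) * deriv \<phi> x \<le> - \<epsilon> / 2" using Fle[OF that] by (simp add: F_def)
    moreover have "M * deriv \<phi> x \<le> D (\<phi> x) * deriv \<phi> x"
      using M(2)[of "\<phi> x"] deriv_\<phi>_neg[OF r] reg_range[OF r] by (intro mult_right_mono_neg) auto
    ultimately show ?thesis using M(1) by (simp add: field_simps)
  qed
  \<comment> \<open>Over this length the slope bound \<open>- (\<epsilon> / (2 * M))\<close> forces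
    a drop of \<open>2 * R\<close>, twice the available range.\<close>
  define Y where "Y = X - 4 * M * R / \<epsilon>"
  have "Y < X" using M \<epsilon> R_pos by (simp add: Y_def)
  moreover have "\<And>x. Y \<le> x \<Longrightarrow> x \<le> X \<Longrightarrow> (\<phi> has_real_derivative deriv \<phi> x) (at x)"
    using \<phi>_deriv reg by (simp add: X_def)
  ultimately obtain z where z: "Y < z" "z < X" "\<phi> X - \<phi> Y = (X - Y) * deriv \<phi> z"
    using MVT2[of Y X \<phi> "deriv \<phi>"] by blast
  have "(X - Y) * deriv \<phi> z \<le> (X - Y) * - (\<epsilon> / (2 * M))"
    using slope[of z] z \<open>Y < X\<close> by (intro mult_left_mono) auto
  also have "\<dots> = - 2 * R" using M \<epsilon> by (simp add: Y_def)
  finally have "\<phi> Y \<ge> \<phi> X + 2 * R" using z by simp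
  moreover have "\<phi> Y \<le> R" "\<phi> X \<ge> 0" using \<phi>_range reg reg_sub \<open>Y < X\<close> by (auto simp: X_def subset_iff)
  ultimately show False using R_pos by linarith
qed

lemma W_eq_left_of_edge:
  assumes "\<And>x. x \<in> I \<Longrightarrow> \<phi> x = R \<longleftrightarrow> x \<le> a" "x < a" "a \<in> I"
  shows "W x = c * R - f R" "F x = 0"
proof -
  have "\<forall>\<^sub>F y in nhds x. y < a" using assms(2) unfolding eventually_nhds by (intro exI[of _ "{..<a}"]) auto
  then have "\<forall>\<^sub>F y in nhds x. \<phi> y = R" by eventually_elim (use assms I_down in \<open>auto intro: less_imp_le\<close>)
  then have "(\<phi> has_real_derivative 0) (at x)" using DERIV_cong_ev[of x x \<phi> "\<lambda>_. R" 0 0] by simp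
  then have "deriv \<phi> x = 0" by (rule DERIV_imp_deriv)
  moreover have "\<phi> x = R" using assms I_down[OF assms(3), of x] by simp
  ultimately show "F x = 0" "W x = c * R - f R" by (simp_all add: F_def W_def)
qed

text \<open>On each side of \<open>a\<close> the function \<open>W\<close> is a primitive of
  \<open>- g (\<phi> x)\<close> up to a constant, \<open>C\<close> on the left and \<open>K\<close>
  on the right. Once the step \<open>j\<close> is subtracted, a continuous primitive remains, which
  integration by parts annihilates; what is left of the weak formulation is
  \<open>(K - C) * \<psi> a = 0\<close> up to sign.\<close>

lemma W_right_of_edge:
  assumes edge: "\<And>x. x \<in> I \<Longrightarrow> \<phi> x = R \<longleftrightarrow> x \<le> a" and a: "a < 0" and x: "a < x" "x < 0"
  shows "W x = c * R - f R - integral {a - 1..x} (\<lambda>y. g (\<phi> y))"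
proof -
  define I0 where "I0 = {a - 1<..<0}"
  have I0: "open I0" "is_interval I0" "I0 \<noteq> {}" "I0 \<subseteq> I" "a \<in> I0"
    using a zero_I I_down by (auto simp: I0_def)
  have "{a - 1..0} \<subseteq> I" using zero_I I_down by auto
  then have kc: "continuous_on {a - 1..0} (\<lambda>y. g (\<phi> y))"
    using continuous_on_subset[OF comp_\<phi>_cont[OF g_cont]] by blast
  \<comment> \<open>\<open>g (\<phi> y)\<close> vanishes for \<open>y \<le> a\<close>, so with a
    base point left of \<open>a\<close> the primitive \<open>G\<close> is \<open>0\<close> up to the
    edge.\<close>
  define G where "G = (\<lambda>x. integral {a - 1..x} (\<lambda>y. g (\<phi> y)))"
  have G: "(G has_real_derivative g (\<phi> y)) (at y)" if "y \<in> I0" for y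
    using integral_has_real_derivative[OF kc, of y] that at_within_Icc_at[of "a - 1" y 0]
    by (simp add: G_def I0_def)
  define C where "C = c * R - f R"
  define K where "K = W (a / 2) + G (a / 2)"
  have reg: "y \<in> reg" if "a < y" "y < 0" for y
  proof -
    have "y \<in> I" using I_down[OF zero_I] that by simp
    then show ?thesis
      using edge[of y] anti_D[OF zero_I, of y] that \<phi>_range[of y] \<phi>_0 R_pos by (auto simp: reg_def)
  qed
  have WK: "W y = K - G y" if "a < y" "y < 0" for y
  proof -
    have "((\<lambda>y. W y + G y) has_real_derivative 0) (at z)" if "a < z" "z < 0" for z
    proof -
      have "((\<lambda>y. W y + G y) has_real_derivative - g (\<phi> z) + g (\<phi> z)) (at z)"
        using that by (intro DERIV_add W_deriv G reg) (auto simp: I0_def)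
      then show ?thesis by simp
    qed
    then have "W y + G y = W (a / 2) + G (a / 2)"
      using that a by (intro DERIV_isconst3[of a 0]) auto
    then show ?thesis by (simp add: K_def)
  qed
  have G0: "G y = 0" if "y \<le> a" for y
  proof -
    have "g (\<phi> z) = 0" if "z \<in> {a - 1..y}" for z
    proof -
      have "z \<le> a" using that \<open>y \<le> a\<close> by simp
      moreover have "z \<in> I" using I_down[OF zero_I, of z] a \<open>z \<le> a\<close> by simp
      ultimately show ?thesis using edge g_R by auto
    qed
    then show ?thesis unfolding G_def by (intro integral_unique has_integral_is_0)
  qed
  obtain \<psi> where \<psi>: "test_function I0 \<psi>" "\<psi> a \<noteq> 0" using ex_test_function[OF I0(1,5)] by blast
  then have \<psi>I: "test_function I \<psi>" using I0(4) unfolding test_function_def by blast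
  obtain u v where uv: "u < v" "{u..v} \<subseteq> I0" and out: "\<And>t. t \<notin> {u<..<v} \<Longrightarrow> \<psi> t = 0 \<and> deriv \<psi> t = 0"
    using test_function_support[OF \<psi>(1) I0(1,2,3)] by blast
  have av: "a \<in> {u<..<v}" using \<psi>(2) out by blast
  note \<psi>' = test_function_has_derivative[OF \<psi>(1)]
  define j where "j = (\<lambda>t. if a \<le> t then K - C else 0)"
  let ?k = "\<lambda>t. g (\<phi> t)"
  have V_cont: "continuous_on I0 (\<lambda>t. C - G t)"
    using G by (intro continuous_intros) (auto intro: DERIV_isCont continuous_at_imp_continuous_on)
  have k_cont: "continuous_on I0 ?k" by (rule continuous_on_subset[OF kc]) (auto simp: I0_def)
  have V_deriv: "((\<lambda>t. C - G t) has_real_derivative - ?k t) (at t)" if "t \<in> I0 - {}" for t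
    using G[of t] that by (auto intro!: derivative_eq_intros)
  \<comment> \<open>The point \<open>a\<close> is excluded, as \<open>W a\<close> involves a
    derivative that may not exist.\<close>
  have W_V: "W t - j t = C - G t" if "t \<in> I0 - {a}" for t
  proof (cases "t < a")
    case True
    then show ?thesis
      using W_eq_left_of_edge[OF edge, of t] I0(4,5) G0[of t] by (auto simp: j_def C_def)
  next
    case False
    then show ?thesis using WK[of t] that by (auto simp: j_def I0_def)
  qed
  have parts: "(LINT t:I0|lebesgue. (W t - j t) * deriv \<psi> t - ?k t * \<psi> t) = 0"
    "set_integrable lebesgue I0 (\<lambda>t. (W t - j t) * deriv \<psi> t - ?k t * \<psi> t)"
    using weak_form_by_parts[OF I0(1,2,3) \<psi>(1) V_cont k_cont finite.emptyI V_deriv, of "{a}" "\<lambda>t. W t - j t"] W_V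
    by simp_all
  have "(\<lambda>t. (K - C) * deriv \<psi> t) absolutely_integrable_on {a..v}"
    by (intro absolutely_integrable_continuous_real continuous_intros continuous_on_subset[OF \<psi>'(2)]) auto
  then have jump1: "set_integrable lebesgue {a..v} (\<lambda>t. (K - C) * deriv \<psi> t)" .
  have "((\<lambda>t. (K - C) * deriv \<psi> t) has_integral ((K - C) * \<psi> v - ((K - C) * \<psi> a))) {a..v}"
    using av by (intro fundamental_theorem_of_calculus)
      (auto simp: has_real_derivative_iff_has_vector_derivative[symmetric]
        intro!: DERIV_cmult has_field_derivative_at_within[OF \<psi>'(1)])
  then have jump2: "(LINT t:{a..v}|lebesgue. (K - C) * deriv \<psi> t) = - ((K - C) * \<psi> a)"
    using out[of v] unfolding set_lebesgue_integral_eq_integral(2)[OF jump1]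
    by (subst integral_unique) auto
  have ind: "indicator {a..v} t *\<^sub>R ((K - C) * deriv \<psi> t) = indicator I0 t *\<^sub>R (j t * deriv \<psi> t)" for t
    using out[of t] uv(2) av by (cases "t \<in> {u<..<v}") (auto simp: j_def indicator_def subset_iff)
  have j1: "set_integrable lebesgue I0 (\<lambda>t. j t * deriv \<psi> t)"
    using jump1 unfolding set_integrable_def ind .
  have j2: "(LINT t:I0|lebesgue. j t * deriv \<psi> t) = - ((K - C) * \<psi> a)"
    using jump2 unfolding set_lebesgue_integral_def ind .
  have "(LINT t:I0|lebesgue. ((W t - j t) * deriv \<psi> t - ?k t * \<psi> t) + j t * deriv \<psi> t) = - ((K - C) * \<psi> a)"
    by (subst set_integral_add(2)[OF parts(2) j1]) (simp add: parts(1) j2)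
  moreover have "(LINT t:I0|lebesgue. ((W t - j t) * deriv \<psi> t - ?k t * \<psi> t) + j t * deriv \<psi> t)
     = (LINT t:I|lebesgue. W t * deriv \<psi> t - ?k t * \<psi> t)"
  proof -
    have "indicator I0 t *\<^sub>R (((W t - j t) * deriv \<psi> t - ?k t * \<psi> t) + j t * deriv \<psi> t) =
      indicator I t *\<^sub>R (W t * deriv \<psi> t - ?k t * \<psi> t)" for t
      using out[of t] uv(2) I0(4) by (cases "t \<in> {u<..<v}") (auto simp: indicator_def subset_iff algebra_simps)
    then show ?thesis unfolding set_lebesgue_integral_def by simp
  qed
  moreover have "(LINT t:I|lebesgue. W t * deriv \<psi> t - ?k t * \<psi> t) = 0"
    using wave \<psi>I unfolding traveling_wave_def W_def F_def by blast
  ultimately have "K = C" using \<psi>(2) by simp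
  then show ?thesis using WK[OF x] by (simp add: C_def G_def)
qed

text \<open>Smallness is tied to the value \<open>\<phi> x\<close> and not to the position
  \<open>x\<close>, so that it reads as a limit of the flux in the variable
  \<open>s = \<phi> x\<close>, whether or not \<open>R\<close> is reached at a finite point.\<close>

lemma F_vanishes_at_R:
  assumes \<epsilon>: "\<epsilon> > 0"
  shows "\<exists>s<R. \<forall>x\<in>reg. s < \<phi> x \<longrightarrow> \<bar>F x\<bar> < \<epsilon>"
proof (cases "\<exists>x\<in>I. \<phi> x = R")
  case False
  then have "\<And>x. x \<in> I \<Longrightarrow> \<phi> x < R" using \<phi>_range by (meson order_le_less)
  then obtain X where X: "X \<le> 0" "\<And>x. x \<le> X \<Longrightarrow> \<bar>F x\<bar> < \<epsilon>"
    using F_vanishes_unbounded \<epsilon> by blast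
  have "X \<in> I" using I_down zero_I X(1) by blast
  moreover have "x \<le> X" if "x \<in> reg" "\<phi> X < \<phi> x" for x
    using anti_D[of x X] that reg_sub by (cases "x \<le> X") auto
  ultimately show ?thesis using X(2) \<open>\<And>x. x \<in> I \<Longrightarrow> \<phi> x < R\<close> by blast
next
  case True
  then obtain a where a: "a < 0" and edge: "\<And>x. x \<in> I \<Longrightarrow> \<phi> x = R \<longleftrightarrow> x \<le> a"
    using left_edge by metis
  have sub: "{a - 1..0} \<subseteq> I" using zero_I I_down by auto
  \<comment> \<open>The flux to the right of the edge in integral form. It is continuous across
    \<open>a\<close>, and there its terms cancel because \<open>\<phi> a = R\<close>.\<close>
  define H where "H = (\<lambda>x. c * R - f R - integral {a - 1..x} (\<lambda>y. g (\<phi> y)) + f (\<phi> x) - c * \<phi> x)"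
  have f: "continuous_on {0..R} f" using f_C1 unfolding C1_on_def by (meson DERIV_continuous_on)
  have "continuous_on {a - 1..0} H"
    unfolding H_def
    by (intro continuous_intros indefinite_integral_continuous_1 integrable_continuous_real
        continuous_on_subset[OF comp_\<phi>_cont sub] continuous_on_subset[OF \<phi>_cont sub] f g_cont)
  then have "isCont H a"
    using continuous_on_interior[of "{a - 1..0}" H a] a by (simp add: interior_atLeastAtMost_real)
  moreover have "H a = 0"
  proof -
    have "g (\<phi> z) = 0" if "z \<in> {a - 1..a}" for z
      using edge[of z] that a sub g_R by (auto simp: subset_iff)
    then have "integral {a - 1..a} (\<lambda>y. g (\<phi> y)) = 0" by (intro integral_unique has_integral_is_0)
    moreover have "\<phi> a = R" using edge[of a] a sub by (auto simp: subset_iff)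
    ultimately show ?thesis by (simp add: H_def)
  qed
  ultimately obtain d where d: "d > 0" "\<And>x. \<bar>x - a\<bar> < d \<Longrightarrow> \<bar>H x\<bar> < \<epsilon>"
    using \<epsilon> unfolding continuous_at_eps_delta by (metis dist_real_def diff_zero)
  define b where "b = min (a + d / 2) (a / 2)"
  have b: "a < b" "b < 0" "b < a + d" using a d(1) by (auto simp: b_def min_def)
  have bI: "b \<in> I" using I_down zero_I b(2) by (meson less_imp_le)
  have "\<bar>F x\<bar> < \<epsilon>" if x: "x \<in> reg" "\<phi> b < \<phi> x" for x
  proof -
    have "x < b" using anti_D[of x b] x reg_sub by (cases "x < b") auto
    moreover have "a < x" using edge[of x] x by (auto simp: reg_def)
    ultimately have "F x = H x"
      using W_right_of_edge[OF edge a, of x] b by (simp add: H_def W_def)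
    then show ?thesis using d(2)[of x] \<open>a < x\<close> \<open>x < b\<close> b by simp
  qed
  moreover have "\<phi> b < R" using edge[OF bI] \<phi>_range[OF bI] b by auto
  ultimately show ?thesis by blast
qed

end

section \<open>The first-order equation for the flux\<close>

text \<open>A differentiable substitute for the positive part: a comparison argument can
  differentiate it without locating sign changes.\<close>

lemma has_real_derivative_max_0_squared:
  "((\<lambda>x::real. (max 0 x)\<^sup>2) has_real_derivative 2 * max 0 x) (at x)"
proof -
  have "\<bar>(max 0 y)\<^sup>2 - (max 0 x)\<^sup>2 - 2 * max 0 x * (y - x)\<bar> \<le> \<bar>y - x\<bar> * \<bar>y - x\<bar>" for y
  proof -
    consider "x \<ge> 0" "y \<ge> 0" | "x \<ge> 0" "y < 0" | "x < 0" "y \<ge> 0" | "x < 0" "y < 0" by linarith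
    then show ?thesis
    proof cases
      case 1
      then have "(max 0 y)\<^sup>2 - (max 0 x)\<^sup>2 - 2 * max 0 x * (y - x) = (y - x) * (y - x)"
        by (simp add: power2_eq_square algebra_simps)
      then show ?thesis by (simp add: abs_mult)
    next
      case 2
      then have eq: "(max 0 y)\<^sup>2 - (max 0 x)\<^sup>2 - 2 * max 0 x * (y - x) = x * x - 2 * (x * y)"
        by (simp add: power2_eq_square algebra_simps)
      have "x * y \<le> 0" using 2 by (simp add: mult_nonneg_nonpos)
      then have "\<bar>x * x - 2 * (x * y)\<bar> = x * x - 2 * (x * y)" using zero_le_square[of x] by (intro abs_of_nonneg) linarith
      also have "\<dots> \<le> (y - x) * (y - x)" by (simp add: algebra_simps)
      also have "\<dots> = \<bar>y - x\<bar> * \<bar>y - x\<bar>" by simp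
      finally show ?thesis unfolding eq .
    next
      case 3
      have "y * y \<le> (y - x) * (y - x)" using 3 by (intro mult_mono) auto
      then show ?thesis using 3 by (simp add: power2_eq_square abs_mult[symmetric])
    qed simp
  qed
  then have *: "\<bar>(max 0 y)\<^sup>2 - (max 0 x)\<^sup>2 - 2 * max 0 x * (y - x)\<bar> \<le> e * \<bar>y - x\<bar>" if "\<bar>y - x\<bar> < e" for y e
    using mult_right_mono[of "\<bar>y - x\<bar>" e "\<bar>y - x\<bar>"] that by (meson abs_ge_zero less_imp_le order_trans)
  show ?thesis
    unfolding has_field_derivative_def has_derivative_within_alt
  proof (intro conjI allI impI bounded_linear_mult_right)
    fix e :: real assume "e > 0"
    then show "\<exists>d>0. \<forall>y\<in>UNIV. norm (y - x) < d \<longrightarrow>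
        norm ((max 0 y)\<^sup>2 - (max 0 x)\<^sup>2 - 2 * max 0 x * (y - x)) \<le> e * norm (y - x)"
      using * by (intro exI[of _ e]) simp
  qed
qed

text \<open>The equation \<open>z' = h - c - D * g / z\<close> with the terms of \<open>f\<close>
  and \<open>c\<close> carried to the left, where they cancel in a difference of two solutions. The
  boundary condition is set at \<open>R\<close>, the end from which solutions are compared.\<close>

definition reduced ::
  "real \<Rightarrow> real \<Rightarrow> (real \<Rightarrow> real) \<Rightarrow> (real \<Rightarrow> real) \<Rightarrow> (real \<Rightarrow> real) \<Rightarrow> (real \<Rightarrow> real) \<Rightarrow> bool"
where
  "reduced R c D f g z \<longleftrightarrow>
     (\<forall>s\<in>{0<..<R}. z s < 0 \<and>
        ((\<lambda>s. z s - f s + c * s) has_real_derivative - (D s * g s / z s)) (at s)) \<and>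
     (z \<longlongrightarrow> 0) (at_left R)"

lemma reduced_diff_deriv:
  assumes "reduced R c D f g\<^sub>1 z\<^sub>1" "reduced R c D f g\<^sub>2 z\<^sub>2" "s \<in> {0<..<R}"
  shows "((\<lambda>s. z\<^sub>1 s - z\<^sub>2 s) has_real_derivative D s * g\<^sub>2 s / z\<^sub>2 s - D s * g\<^sub>1 s / z\<^sub>1 s) (at s)"
proof -
  have "((\<lambda>s. (z\<^sub>1 s - f s + c * s) - (z\<^sub>2 s - f s + c * s)) has_real_derivative
      - (D s * g\<^sub>1 s / z\<^sub>1 s) - - (D s * g\<^sub>2 s / z\<^sub>2 s)) (at s)"
    using assms unfolding reduced_def by (intro DERIV_diff) auto
  then show ?thesis by (simp add: algebra_simps)
qed

text \<open>Where \<open>z\<^sub>1 > z\<^sub>2\<close>, the larger source and the smaller modulus of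
  \<open>z\<^sub>1\<close> both make \<open>z\<^sub>1\<close> grow faster. Hence the squared
  positive part \<open>P\<close> of the difference is nondecreasing, and since it tends to
  \<open>0\<close> at \<open>R\<close> it vanishes.\<close>

lemma reduced_mono:
  assumes 1: "reduced R c D f g\<^sub>1 z\<^sub>1" and 2: "reduced R c D f g\<^sub>2 z\<^sub>2"
    and D: "\<And>s. s \<in> {0<..<R} \<Longrightarrow> D s > 0"
    and g: "\<And>s. s \<in> {0<..<R} \<Longrightarrow> 0 \<le> g\<^sub>2 s \<and> g\<^sub>2 s \<le> g\<^sub>1 s"
    and s: "s \<in> {0<..<R}"
  shows "z\<^sub>1 s \<le> z\<^sub>2 s"
proof -
  define P where "P = (\<lambda>s. (max 0 (z\<^sub>1 s - z\<^sub>2 s))\<^sup>2)"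
  have neg: "z\<^sub>1 t < 0" "z\<^sub>2 t < 0" if "t \<in> {0<..<R}" for t
    using 1 2 that unfolding reduced_def by auto
  have mono: "P s \<le> P t" if "t \<in> {s<..<R}" for t
  proof (rule DERIV_nonneg_imp_nondecreasing[of s t])
    show "s \<le> t" using that by simp
    fix x assume "s \<le> x" "x \<le> t"
    then have x: "x \<in> {0<..<R}" using that s by auto
    let ?d = "D x * g\<^sub>2 x / z\<^sub>2 x - D x * g\<^sub>1 x / z\<^sub>1 x"
    have "(P has_real_derivative 2 * max 0 (z\<^sub>1 x - z\<^sub>2 x) * ?d) (at x)"
      unfolding P_def by (rule DERIV_chain2[OF has_real_derivative_max_0_squared reduced_diff_deriv[OF 1 2 x]])
    moreover have "2 * max 0 (z\<^sub>1 x - z\<^sub>2 x) * ?d \<ge> 0"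
    proof (cases "z\<^sub>1 x \<le> z\<^sub>2 x")
      case False
      have "D x * g\<^sub>1 x / z\<^sub>1 x \<le> D x * g\<^sub>2 x / z\<^sub>1 x"
        using D[OF x] g[OF x] neg[OF x] by (intro divide_right_mono_neg mult_left_mono) auto
      also have "\<dots> \<le> D x * g\<^sub>2 x / z\<^sub>2 x"
        using D[OF x] g[OF x] neg[OF x] False by (intro divide_left_mono mult_nonneg_nonneg mult_neg_neg) auto
      finally show ?thesis by simp
    qed (simp add: max_def)
    ultimately show "\<exists>d. (P has_real_derivative d) (at x) \<and> 0 \<le> d" by blast
  qed
  have "((\<lambda>t. z\<^sub>1 t - z\<^sub>2 t) \<longlongrightarrow> 0 - 0) (at_left R)"
    using 1 2 unfolding reduced_def by (intro tendsto_diff) auto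
  then have "(P \<longlongrightarrow> (max 0 0)\<^sup>2) (at_left R)"
    unfolding P_def by (intro tendsto_intros) simp
  then have lim: "(P \<longlongrightarrow> 0) (at_left R)" by simp
  have "P s \<le> 0"
  proof (rule tendsto_lowerbound[OF lim])
    show "\<forall>\<^sub>F t in at_left R. P s \<le> P t"
      using mono s unfolding eventually_at_left_field by (intro exI[of _ s]) auto
  qed simp
  then show ?thesis by (simp add: P_def max_def split: if_splits)
qed

text \<open>Replacing \<open>z\<^sub>0\<close> by the lower \<open>z\<^sub>1\<close> in the
  denominator has a favourable sign, so the gap does not feed its own growth: the difference of the
  sources enters linearly, without an exponential factor.\<close>

lemma reduced_gap_estimate:
  assumes 0: "reduced R c D f g\<^sub>0 z\<^sub>0" and 1: "reduced R c D f g\<^sub>1 z\<^sub>1"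
    and D: "\<And>s. s \<in> {0<..<R} \<Longrightarrow> D s > 0"
    and g: "\<And>s. s \<in> {0<..<R} \<Longrightarrow> 0 \<le> g\<^sub>1 s"
    and le: "\<And>s. s \<in> {0<..<R} \<Longrightarrow> z\<^sub>1 s \<le> z\<^sub>0 s"
    and sq: "0 < s" "s \<le> q" "q < R"
    and \<kappa>: "\<And>t. t \<in> {s..q} \<Longrightarrow> D t * (g\<^sub>1 t - g\<^sub>0 t) \<le> \<kappa> * (- z\<^sub>0 t)"
  shows "z\<^sub>0 s - z\<^sub>1 s \<le> z\<^sub>0 q - z\<^sub>1 q + \<kappa> * (q - s)"
proof -
  have "(\<lambda>t. z\<^sub>0 t - z\<^sub>1 t + \<kappa> * t) s \<le> (\<lambda>t. z\<^sub>0 t - z\<^sub>1 t + \<kappa> * t) q"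
  proof (rule DERIV_nonneg_imp_nondecreasing[OF sq(2)])
    fix x assume "s \<le> x" "x \<le> q"
    then have x: "x \<in> {0<..<R}" "x \<in> {s..q}" using sq by auto
    have neg: "z\<^sub>0 x < 0" "z\<^sub>1 x < 0" using 0 1 x unfolding reduced_def by auto
    have "((\<lambda>t. z\<^sub>0 t - z\<^sub>1 t + \<kappa> * t) has_real_derivative
        (D x * g\<^sub>1 x / z\<^sub>1 x - D x * g\<^sub>0 x / z\<^sub>0 x) + \<kappa> * 1) (at x)"
      by (intro DERIV_add reduced_diff_deriv[OF 0 1 x(1)] DERIV_cmult DERIV_ident)
    moreover have "D x * g\<^sub>1 x / z\<^sub>0 x \<le> D x * g\<^sub>1 x / z\<^sub>1 x"
      using D[OF x(1)] g[OF x(1)] neg le[OF x(1)] by (intro divide_left_mono mult_nonneg_nonneg mult_neg_neg) auto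
    moreover have "D x * g\<^sub>1 x / z\<^sub>0 x - D x * g\<^sub>0 x / z\<^sub>0 x \<ge> - \<kappa>"
      using \<kappa>[OF x(2)] neg(1) by (simp add: field_simps)
    ultimately show "\<exists>d. ((\<lambda>t. z\<^sub>0 t - z\<^sub>1 t + \<kappa> * t) has_real_derivative d) (at x) \<and> 0 \<le> d"
      by (intro exI[of _ "(D x * g\<^sub>1 x / z\<^sub>1 x - D x * g\<^sub>0 x / z\<^sub>0 x) + \<kappa> * 1"]) simp
  qed
  then show ?thesis by (simp add: algebra_simps)
qed

lemma reduced_cont:
  assumes "reduced R c D f g z" "continuous_on {0..R} f"
  shows "continuous_on {0<..<R} z"
proof -
  have "continuous_on {0<..<R} (\<lambda>s. z s - f s + c * s)"
    using assms(1) unfolding reduced_def by (auto intro: DERIV_isCont continuous_at_imp_continuous_on)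
  then have "continuous_on {0<..<R} (\<lambda>s. (z s - f s + c * s) + f s - c * s)"
    by (intro continuous_on_add[of _ "\<lambda>s. z s - f s + c * s"] continuous_on_diff continuous_on_subset[OF assms(2)]
        continuous_on_mult_left continuous_on_id) auto
  then show ?thesis by (rule continuous_on_eq) simp
qed

lemma reduced_uniform_limit:
  fixes g z :: "nat \<Rightarrow> real \<Rightarrow> real"
  assumes red: "\<And>n. reduced R c D f (g n) (z n)"
    and f: "continuous_on {0..R} f" and Dc: "continuous_on {0..R} D"
    and D: "\<And>s. s \<in> {0<..<R} \<Longrightarrow> D s > 0"
    and g: "\<And>n s. s \<in> {0<..<R} \<Longrightarrow> 0 \<le> g n s"
    and g0: "\<And>n s. s \<in> {0<..<R} \<Longrightarrow> g 0 s \<le> g n s"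
    and g1: "\<And>n s. s \<in> {0<..<R} \<Longrightarrow> n \<ge> 1 \<Longrightarrow> g n s \<le> g 1 s"
    and lim: "uniform_limit {0..R} g (g 0) sequentially"
    and pq: "0 < p" "p \<le> q" "q < R"
  shows "uniform_limit {p..q} z (z 0) sequentially"
proof (rule uniform_limitI)
  fix e :: real assume e: "e > 0"
  have le0: "z n s \<le> z 0 s" if "s \<in> {0<..<R}" for n s
    using reduced_mono[OF red[of n] red[of 0] D _ that] g g0 by blast
  have ge1: "z 1 s \<le> z n s" if "s \<in> {0<..<R}" "n \<ge> 1" for n s
    using reduced_mono[OF red[of 1] red[of n] D _ that(1)] g g1[OF _ that(2)] by blast
  have "\<forall>\<^sub>F t in at_left R. dist (z 1 t) 0 < e / 2"
    using red[of 1] e unfolding reduced_def by (intro tendstoD) auto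
  moreover have "\<forall>\<^sub>F t in at_left R. t \<in> {q<..<R}"
    using pq eventually_at_left_real by blast
  ultimately have "\<forall>\<^sub>F t in at_left R. dist (z 1 t) 0 < e / 2 \<and> t \<in> {q<..<R}" by (rule eventually_conj)
  \<comment> \<open>\<open>r\<close> depends on \<open>e\<close> alone: since
    \<open>z 1 \<le> z n \<le> z 0 < 0\<close>, smallness of \<open>z 1 r\<close> bounds the gap at
    \<open>r\<close> for all \<open>n \<ge> 1\<close> simultaneously.\<close>
  then obtain r where r: "\<bar>z 1 r\<bar> < e / 2" "q < r" "r < R"
    using eventually_happens' by (metis (no_types, lifting) trivial_limit_at_left_real dist_real_def diff_zero greaterThanLessThan_iff)
  have zc: "continuous_on {p..r} (z 0)"
    using pq r by (intro continuous_on_subset[OF reduced_cont[OF red f]]) auto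
  have neg: "z 0 t < 0" if "t \<in> {p..r}" for t
    using red[of 0] that pq r unfolding reduced_def by auto
  have "continuous_on {p..r} (\<lambda>t. D t / (- z 0 t))"
    using neg pq r by (intro continuous_intros zc continuous_on_subset[OF Dc]) force+
  then have "bounded ((\<lambda>t. D t / (- z 0 t)) ` {p..r})"
    by (intro compact_imp_bounded compact_continuous_image) auto
  then obtain M where M: "M > 0" "\<And>t. t \<in> {p..r} \<Longrightarrow> D t / (- z 0 t) \<le> M"
    unfolding bounded_pos by (force simp: abs_le_iff)
  \<comment> \<open>Integrated over a length of at most \<open>R\<close>, this allows an error
    \<open>e / 4\<close>; together with the \<open>e / 2\<close> inherited at \<open>r\<close> the
    total stays below \<open>e\<close>.\<close>
  define \<kappa> where "\<kappa> = e / (4 * R)"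
  have "R > 0" using pq by simp
  then have \<kappa>: "\<kappa> > 0" using e by (simp add: \<kappa>_def)
  have "\<forall>\<^sub>F n in sequentially. \<forall>t\<in>{0..R}. dist (g n t) (g 0 t) < \<kappa> / M"
    using M \<kappa> by (intro uniform_limitD[OF lim]) auto
  then show "\<forall>\<^sub>F n in sequentially. \<forall>s\<in>{p..q}. dist (z n s) (z 0 s) < e"
    using eventually_ge_at_top[of 1]
  proof eventually_elim
    case (elim n)
    show ?case
    proof
      fix s assume s: "s \<in> {p..q}"
      have "z 0 s - z n s \<le> z 0 r - z n r + \<kappa> * (r - s)"
      proof (rule reduced_gap_estimate[OF red red D g le0])
        fix t assume t: "t \<in> {s..r}"
        then have t': "t \<in> {0<..<R}" "t \<in> {p..r}" "t \<in> {0..R}" using s pq r by auto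
        have "g n t - g 0 t \<le> \<kappa> / M" using elim(1) t'(3) by (force simp: dist_real_def)
        then have "D t * (g n t - g 0 t) \<le> D t * (\<kappa> / M)"
          using D[OF t'(1)] by (intro mult_left_mono) auto
        also have "D t \<le> M * (- z 0 t)" using M(2)[OF t'(2)] neg[OF t'(2)] by (simp add: field_simps)
        then have "D t * (\<kappa> / M) \<le> M * (- z 0 t) * (\<kappa> / M)" using \<kappa> M by (intro mult_right_mono) auto
        also have "\<dots> = \<kappa> * (- z 0 t)" using M by simp
        finally show "D t * (g n t - g 0 t) \<le> \<kappa> * (- z 0 t)" by simp
      qed (use s pq r in auto)
      moreover have rI: "r \<in> {0<..<R}" "s \<in> {0<..<R}" using s pq r by auto
      moreover have "z 0 r < 0" using red[of 0] rI unfolding reduced_def by auto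
      moreover have "- z n r < e / 2" using ge1[OF rI(1) elim(2)] r by auto
      moreover have "\<kappa> * (r - s) \<le> \<kappa> * R" using \<kappa> s pq r by (intro mult_left_mono) auto
      moreover have "\<kappa> * R = e / 4" using pq by (simp add: \<kappa>_def)
      ultimately have "z 0 s - z n s < e" using e by linarith
      then show "dist (z n s) (z 0 s) < e" using le0[OF rI(2), of n] by (simp add: dist_real_def)
    qed
  qed
qed

section \<open>Convergence of profiles\<close>

context profile
begin

definition "T = inv_into reg \<phi>"

lemma inj_reg: "inj_on \<phi> reg"
  by (rule inj_onI) (metis \<phi>_strict less_irrefl linorder_less_linear)

lemma T_reg: "s \<in> \<phi> ` reg \<Longrightarrow> T s \<in> reg" and \<phi>_T: "s \<in> \<phi> ` reg \<Longrightarrow> \<phi> (T s) = s"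
  unfolding T_def by (simp_all add: inv_into_into f_inv_into_f)

lemma T_\<phi>: "x \<in> reg \<Longrightarrow> T (\<phi> x) = x"
  unfolding T_def by (rule inv_into_f_f[OF inj_reg])

lemma value_attained:
  assumes "x \<in> reg" "\<phi> x \<le> s" "s < R"
  shows "s \<in> \<phi> ` reg"
proof -
  have "\<forall>\<^sub>F y in at_bot. s < \<phi> y" by (rule order_tendstoD(1)[OF lim_bot assms(3)])
  moreover have "\<forall>\<^sub>F y in at_bot. y \<le> x" by (rule eventually_le_at_bot)
  ultimately have "\<forall>\<^sub>F y in at_bot. s < \<phi> y \<and> y \<le> x" by (rule eventually_conj)
  then obtain y where y: "s < \<phi> y" "y \<le> x"
    unfolding eventually_at_bot_linorder by blast
  have "{y..x} \<subseteq> I" using I_down reg_sub assms(1) by auto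
  then have "continuous_on {y..x} \<phi>" using continuous_on_subset[OF \<phi>_cont] by blast
  then obtain z where z: "y \<le> z" "z \<le> x" "\<phi> z = s"
    using IVT2'[of \<phi> x s y] y assms by auto
  moreover have "z \<in> I" using \<open>{y..x} \<subseteq> I\<close> z by auto
  moreover have "0 < s" using assms reg_range[of x] by auto
  ultimately show ?thesis using assms by (auto simp: reg_def)
qed

lemma \<phi>_reg_open: "open (\<phi> ` reg)"
proof -
  have "\<exists>r>0. ball s r \<subseteq> \<phi> ` reg" if s: "s \<in> \<phi> ` reg" for s
  proof -
    obtain x where x: "x \<in> reg" "s = \<phi> x" using s by blast
    obtain d where d: "d > 0" "ball x d \<subseteq> reg" using reg_open x by (meson openE)
    then have "x + d / 2 \<in> reg" by (auto simp: subset_iff dist_real_def)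
    then have lt: "\<phi> (x + d / 2) < \<phi> x" using \<phi>_strict[OF x(1)] d(1) by auto
    moreover have "\<phi> x < R" using reg_range[OF x(1)] by simp
    ultimately show ?thesis
      using value_attained[OF \<open>x + d / 2 \<in> reg\<close>] x(2)
      by (intro exI[of _ "min (\<phi> x - \<phi> (x + d / 2)) (R - \<phi> x)"]) (auto simp: dist_real_def)
  qed
  then show ?thesis by (simp add: open_contains_ball)
qed

lemma T_deriv:
  assumes s: "s \<in> \<phi> ` reg"
  shows "(T has_real_derivative D s / F (T s)) (at s)"
proof -
  obtain r where r: "r > 0" "ball s r \<subseteq> \<phi> ` reg" using \<phi>_reg_open s by (meson openE)
  obtain d where d: "d > 0" "cball (T s) d \<subseteq> reg" using reg_open T_reg[OF s] by (meson open_contains_cball)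
  have "isCont T (\<phi> (T s))"
  proof (rule isCont_inverse_function[where x = "T s" and f = \<phi> and g = T, OF d(1)])
    fix z assume "\<bar>z - T s\<bar> \<le> d"
    then have z: "z \<in> reg" using d(2) by (auto simp: subset_iff dist_real_def)
    then show "T (\<phi> z) = z" "isCont \<phi> z" using T_\<phi> \<phi>_deriv DERIV_isCont by blast+
  qed
  then have "(T has_real_derivative inverse (deriv \<phi> (T s))) (at s)"
  proof (intro DERIV_inverse_function[where f = \<phi> and g = T and x = s and a = "s - r" and b = "s + r"]
      \<phi>_deriv[OF T_reg[OF s]])
    show "\<phi> (T y) = y" if "s - r < y" "y < s + r" for y
      using r(2) that by (intro \<phi>_T) (auto simp: subset_iff dist_real_def)
  qed (use r deriv_\<phi>_neg[OF T_reg[OF s]] \<phi>_T[OF s] in auto)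
  moreover have "inverse (deriv \<phi> (T s)) = D s / F (T s)"
    using deriv_\<phi>_neg[OF T_reg[OF s]] D_pos[OF reg_range[OF T_reg[OF s]]] \<phi>_T[OF s] by (simp add: F_def field_simps)
  ultimately show ?thesis by simp
qed

lemma reduced_deriv:
  assumes s: "s \<in> \<phi> ` reg"
  shows "((\<lambda>s. F (T s) - f s + c * s) has_real_derivative - (D s * g s / F (T s))) (at s)"
proof -
  have "((\<lambda>s. W (T s)) has_real_derivative - g (\<phi> (T s)) * (D s / F (T s))) (at s)"
    by (rule DERIV_chain2[OF W_deriv[OF T_reg[OF s]] T_deriv[OF s]])
  moreover have "\<forall>\<^sub>F t in nhds s. W (T t) = F (T t) - f t + c * t"
    using \<phi>_reg_open s \<phi>_T unfolding eventually_nhds W_def by (intro exI[of _ "\<phi> ` reg"]) auto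
  ultimately have "((\<lambda>s. F (T s) - f s + c * s) has_real_derivative - g (\<phi> (T s)) * (D s / F (T s))) (at s)"
    using DERIV_cong_ev[of s s "\<lambda>t. W (T t)" "\<lambda>s. F (T s) - f s + c * s"
        "- g (\<phi> (T s)) * (D s / F (T s))" "- g (\<phi> (T s)) * (D s / F (T s))"] by blast
  moreover have "- g (\<phi> (T s)) * (D s / F (T s)) = - (D s * g s / F (T s))" using \<phi>_T[OF s] by simp
  ultimately show ?thesis by (simp only:)
qed

lemma F_T_tendsto: "((\<lambda>s. F (T s)) \<longlongrightarrow> 0) (at_left R)"
proof (rule tendstoI)
  fix e :: real assume "e > 0"
  then obtain s where s: "s < R" "\<And>x. x \<in> reg \<Longrightarrow> s < \<phi> x \<Longrightarrow> \<bar>F x\<bar> < e"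
    using F_vanishes_at_R by blast
  have "\<forall>\<^sub>F t in at_left R. t \<in> {max s (R / 2)<..<R}"
    using s(1) R_pos by (intro eventually_at_left_real) auto
  then show "\<forall>\<^sub>F t in at_left R. dist (F (T t)) 0 < e"
  proof eventually_elim
    case (elim t)
    then have "t \<in> \<phi> ` reg" using value_attained[OF zero_reg] \<phi>_0 by auto
    then show ?case using s(2)[OF T_reg] \<phi>_T elim by auto
  qed
qed

lemma reduced_profile:
  assumes "{0<..<R} \<subseteq> \<phi> ` reg"
  shows "reduced R c D f g (\<lambda>s. F (T s))"
  unfolding reduced_def using assms reduced_deriv F_T_tendsto F_neg T_reg by blast

lemma T_half: "T (R / 2) = 0"
  using T_\<phi>[OF zero_reg] \<phi>_0 by simp

lemma C1_on_reg: "S \<subseteq> reg \<Longrightarrow> \<phi> C1_differentiable_on S"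
  unfolding C1_differentiable_on_def
  using \<phi>_deriv continuous_on_subset[OF deriv_\<phi>_cont]
  by (intro exI[of _ "deriv \<phi>"]) (auto simp: has_real_derivative_iff_has_vector_derivative[symmetric])

lemma deriv_\<phi>_eq: "x \<in> reg \<Longrightarrow> deriv \<phi> x = F (T (\<phi> x)) / D (\<phi> x)"
  using D_pos[OF reg_range, of x] by (simp add: T_\<phi> F_def)

end

text \<open>The profiles are compared through their inverses \<open>T n\<close>, which share the
  domain \<open>(0, R)\<close> and the value \<open>0\<close> at \<open>R / 2\<close>. Uniform
  convergence of the slopes \<open>D / z n\<close> thus gives that of \<open>T n\<close>, and a
  lower bound on the steepness of \<open>T 0\<close> allows it to be inverted.\<close>

lemma profiles_converge:
  fixes g \<phi> :: "nat \<Rightarrow> real \<Rightarrow> real" and I :: "nat \<Rightarrow> real set"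
  assumes prof: "\<And>n. profile R c D f h (g n) (\<phi> n) (I n)"
    and full: "\<And>n. {0<..<R} \<subseteq> \<phi> n ` profile.reg R (\<phi> n) (I n)"
    and g0: "\<And>n s. s \<in> {0<..<R} \<Longrightarrow> g 0 s \<le> g n s"
    and g1: "\<And>n s. s \<in> {0<..<R} \<Longrightarrow> n \<ge> 1 \<Longrightarrow> g n s \<le> g 1 s"
    and lim: "uniform_limit {0..R} g (g 0) sequentially"
    and ab: "\<alpha> \<le> \<beta>" "\<And>\<xi>. \<xi> \<in> {\<alpha>..\<beta>} \<Longrightarrow> \<xi> \<in> I 0 \<and> 0 < \<phi> 0 \<xi> \<and> \<phi> 0 \<xi> < R"
  shows "\<phi> 0 C1_differentiable_on {\<alpha>..\<beta>} \<and>
        (\<forall>\<^sub>F n in sequentially. {\<alpha>..\<beta>} \<subseteq> I n \<and> \<phi> n C1_differentiable_on {\<alpha>..\<beta>}) \<and>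
        uniform_limit {\<alpha>..\<beta>} \<phi> (\<phi> 0) sequentially \<and>
        uniform_limit {\<alpha>..\<beta>} (\<lambda>n. deriv (\<phi> n)) (deriv (\<phi> 0)) sequentially"
proof -
  interpret P: profile R c D f h "g n" "\<phi> n" "I n" for n by (rule prof)
  define reg where "reg = (\<lambda>n. profile.reg R (\<phi> n) (I n))"
  define T where "T = (\<lambda>n. profile.T R (\<phi> n) (I n))"
  define z where "z = (\<lambda>n s. profile.F D (\<phi> n) (T n s))"
  have full': "s \<in> \<phi> n ` reg n" if "s \<in> {0<..<R}" for n s
    using full that unfolding reg_def by blast
  have red: "reduced R c D f (g n) (z n)" for n
    unfolding z_def T_def using P.reduced_profile full by blast
  have f: "continuous_on {0..R} f"
    using P.f_C1 unfolding C1_on_def by (meson DERIV_continuous_on)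
  have zneg: "z n s < 0" if "s \<in> {0<..<R}" for n s using red that unfolding reduced_def by blast
  have Tder: "(T n has_real_derivative D s / z n s) (at s)" if "s \<in> {0<..<R}" for n s
    unfolding T_def z_def using P.T_deriv full'[OF that] unfolding reg_def by blast
  have sub: "{\<alpha>..\<beta>} \<subseteq> reg 0" using ab(2) unfolding reg_def P.reg_def by auto
  \<comment> \<open>\<open>[p, q]\<close> contains the range of \<open>\<phi> 0\<close> over
    \<open>[\<alpha>, \<beta>]\<close> with a margin on both sides, to leave room for shifts of the
    level, and also \<open>R / 2\<close>, where the inverses are anchored.\<close>
  define p where "p = min (\<phi> 0 \<beta>) (R / 2) / 2"
  define q where "q = (max (\<phi> 0 \<alpha>) (R / 2) + R) / 2"
  have \<alpha>\<beta>: "\<phi> 0 \<alpha> < R" "\<phi> 0 \<beta> > 0" using ab by auto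
  have pq: "0 < p" "p \<le> q" "q < R" "p < \<phi> 0 \<beta>" "\<phi> 0 \<alpha> < q" "p \<le> R / 2" "R / 2 \<le> q"
    using P.R_pos \<alpha>\<beta> by (auto simp: p_def q_def min_def max_def field_simps)
  have pqR: "{p..q} \<subseteq> {0<..<R}" using pq by auto
  have zc: "continuous_on {p..q} (z n)" for n
    using pqR by (intro continuous_on_subset[OF reduced_cont[OF red f]])
  have Dc: "continuous_on {p..q} D" using pqR by (intro continuous_on_subset[OF P.D_cont]) auto
  have zlim: "uniform_limit {p..q} z (z 0) sequentially"
    using pq P.g_pos by (intro reduced_uniform_limit[OF red f P.D_cont P.D_pos _ g0 g1 lim]) (auto intro: less_imp_le)
  have D_bd: "bounded (D ` {p..q})" "bounded (z 0 ` {p..q})"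
    using Dc zc by (auto intro: compact_imp_bounded compact_continuous_image)
  obtain s1 where s1: "s1 \<in> {p..q}" "\<And>s. s \<in> {p..q} \<Longrightarrow> - z 0 s1 \<le> - z 0 s"
    using continuous_attains_inf[of "{p..q}" "\<lambda>s. - z 0 s"] pq continuous_on_minus[OF zc[of 0]] by auto
  have Dlim: "uniform_limit {p..q} (\<lambda>_. D) D sequentially" by (rule uniform_limit_const)
  have slim: "uniform_limit {p..q} (\<lambda>n s. D s / z n s) (\<lambda>s. D s / z 0 s) sequentially"
  proof (rule uniform_lim_divide[OF Dlim zlim D_bd(1)])
    show "- z 0 s1 \<le> norm (z 0 s)" if "s \<in> {p..q}" for s
      using s1(2)[OF that] zneg[of s 0] that pqR by auto
    show "0 < - z 0 s1" using zneg[of s1 0] s1(1) pqR by auto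
  qed
  obtain s2 where s2: "s2 \<in> {p..q}" "\<And>s. s \<in> {p..q} \<Longrightarrow> D s2 \<le> D s"
    using continuous_attains_inf[of "{p..q}" D] pq Dc by auto
  have vlim: "uniform_limit {p..q} (\<lambda>n s. z n s / D s) (\<lambda>s. z 0 s / D s) sequentially"
  proof (rule uniform_lim_divide[OF zlim Dlim D_bd(2)])
    show "D s2 \<le> norm (D s)" if "s \<in> {p..q}" for s
      using s2(2)[OF that] by auto
    show "0 < D s2" using P.D_pos[of s2] s2(1) pqR by auto
  qed
  have Tlim: "\<forall>\<^sub>F n in sequentially. \<forall>s\<in>{p..q}. \<bar>T n s - T 0 s\<bar> < e" if e: "e > 0" for e
  proof -
    have "\<forall>\<^sub>F n in sequentially. \<forall>s\<in>{p..q}. dist (D s / z n s) (D s / z 0 s) < e / (2 * R)"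
      using e P.R_pos by (intro uniform_limitD[OF slim]) auto
    then show ?thesis
    proof eventually_elim
      case (elim n)
      show ?case
      proof
        fix s assume s: "s \<in> {p..q}"
        have "norm ((T n s - T 0 s) - (T n (R / 2) - T 0 (R / 2))) \<le> e / (2 * R) * norm (s - R / 2)"
        proof (rule field_differentiable_bound[of "{p..q}" "\<lambda>s. T n s - T 0 s" "\<lambda>s. D s / z n s - D s / z 0 s"])
          show "((\<lambda>s. T n s - T 0 s) has_real_derivative D x / z n x - D x / z 0 x) (at x within {p..q})"
            if "x \<in> {p..q}" for x
            using that pqR by (intro has_field_derivative_at_within[OF DERIV_diff[OF Tder Tder]]) auto
          show "norm (D x / z n x - D x / z 0 x) \<le> e / (2 * R)" if "x \<in> {p..q}" for x
            using elim that by (force simp: dist_real_def)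
        qed (use s pq in auto)
        also have "\<dots> \<le> e / (2 * R) * R"
          using s pq e P.R_pos by (intro mult_left_mono) (auto simp: abs_le_iff)
        also have "\<dots> < e" using e P.R_pos by simp
        finally show "\<bar>T n s - T 0 s\<bar> < e" using P.T_half unfolding T_def by simp
      qed
    qed
  qed
  obtain s3 where s3: "s3 \<in> {p..q}" "\<And>s. s \<in> {p..q} \<Longrightarrow> D s3 / (- z 0 s3) \<le> D s / (- z 0 s)"
  proof -
    have "continuous_on {p..q} (\<lambda>s. D s / (- z 0 s))"
      using zneg[of _ 0] pqR by (intro continuous_intros Dc zc) force
    then show thesis using that continuous_attains_inf[of "{p..q}" "\<lambda>s. D s / (- z 0 s)"] pq by auto
  qed
  \<comment> \<open>Minimal steepness of \<open>T 0\<close> on \<open>[p, q]\<close>; it converts an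
    error in \<open>T\<close> into an error in \<open>\<phi>\<close>.\<close>
  define m where "m = D s3 / (- z 0 s3)"
  have m: "m > 0" 
  proof -
    have "s3 \<in> {0<..<R}" using s3(1) pqR by blast
    then have "D s3 > 0" "z 0 s3 < 0" using P.D_pos zneg by auto
    then show ?thesis unfolding m_def by (intro divide_pos_pos) auto
  qed
  have Tdrop: "T 0 v \<le> T 0 u - m * (v - u)" if "u \<in> {p..q}" "v \<in> {p..q}" "u \<le> v" for u v
  proof -
    have "(\<lambda>s. T 0 s + m * s) v \<le> (\<lambda>s. T 0 s + m * s) u"
    proof (rule DERIV_nonpos_imp_nonincreasing[OF that(3)])
      fix x assume "u \<le> x" "x \<le> v"
      then have "x \<in> {p..q}" using that by auto
      then have x: "x \<in> {p..q}" "x \<in> {0<..<R}" using pqR by blast+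
      have "((\<lambda>s. T 0 s + m * s) has_real_derivative D x / z 0 x + m * 1) (at x)"
        by (intro DERIV_add Tder x DERIV_cmult DERIV_ident)
      moreover have "D x / z 0 x + m * 1 \<le> 0" using s3(2)[OF x(1)] by (simp add: m_def)
      ultimately show "\<exists>d. ((\<lambda>s. T 0 s + m * s) has_real_derivative d) (at x) \<and> d \<le> 0" by blast
    qed
    then show ?thesis by (simp add: algebra_simps)
  qed
  have close: "\<forall>\<^sub>F n in sequentially. \<forall>\<xi>\<in>{\<alpha>..\<beta>}. \<xi> \<in> reg n \<and> \<phi> n \<xi> \<in> {p..q} \<and> \<bar>\<phi> n \<xi> - \<phi> 0 \<xi>\<bar> < e"
    if e: "e > 0" for e
  proof -
    \<comment> \<open>Small enough for \<open>s - \<eta>\<close> and \<open>s + \<eta>\<close> to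
      stay in \<open>[p, q]\<close>. On each side of \<open>s\<close> the function
      \<open>T 0\<close> changes by at least \<open>m * \<eta>\<close>, so an error below
      \<open>m * \<eta>\<close> leaves \<xi> strictly between \<open>T n (s + \<eta>)\<close> and
      \<open>T n (s - \<eta>)\<close>; this also places \<xi> in the domain of
      \<open>\<phi> n\<close>.\<close>
    define \<eta> where "\<eta> = min (e / 2) (min (\<phi> 0 \<beta> - p) (q - \<phi> 0 \<alpha>))"
    have \<eta>: "\<eta> > 0" "\<eta> < e" "\<eta> \<le> \<phi> 0 \<beta> - p" "\<eta> \<le> q - \<phi> 0 \<alpha>" using e pq by (auto simp: \<eta>_def)
    have "\<forall>\<^sub>F n in sequentially. \<forall>s\<in>{p..q}. \<bar>T n s - T 0 s\<bar> < m * \<eta>"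
      using m \<eta> by (intro Tlim) auto
    then show ?thesis
    proof eventually_elim
      case (elim n)
      show ?case
      proof
        fix \<xi> assume \<xi>: "\<xi> \<in> {\<alpha>..\<beta>}"
        then have \<xi>r: "\<xi> \<in> reg 0" using sub by blast
        define s where "s = \<phi> 0 \<xi>"
        have T0: "T 0 s = \<xi>" using P.T_\<phi> \<xi>r unfolding s_def T_def reg_def by blast
        have "\<phi> 0 \<beta> \<le> s" "s \<le> \<phi> 0 \<alpha>"
          unfolding s_def using P.anti_D[of _ 0] ab \<xi> by auto
        then have sp: "s - \<eta> \<in> {p..q}" "s + \<eta> \<in> {p..q}" "s \<in> {p..q}" using \<eta> pq by auto
        have "T 0 (s + \<eta>) \<le> \<xi> - m * \<eta>" using Tdrop[OF sp(3,2)] T0 \<eta> by simp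
        then have 1: "T n (s + \<eta>) < \<xi>" using bspec[OF elim sp(2)] by linarith
        have "\<xi> \<le> T 0 (s - \<eta>) - m * \<eta>" using Tdrop[OF sp(1,3)] T0 \<eta> by simp
        then have 2: "\<xi> < T n (s - \<eta>)" using bspec[OF elim sp(1)] by linarith
        have im: "s - \<eta> \<in> \<phi> n ` reg n" "s + \<eta> \<in> \<phi> n ` reg n" using sp pqR by (blast intro: full')+
        then have Tr: "T n (s - \<eta>) \<in> reg n" "T n (s + \<eta>) \<in> reg n"
          unfolding T_def reg_def by (auto intro: P.T_reg)
        then have "\<xi> \<in> reg n" using P.reg_between 1 2 unfolding reg_def by (meson atLeastAtMost_iff less_imp_le subsetD)
        moreover have "\<phi> n \<xi> \<le> s + \<eta>" "s - \<eta> \<le> \<phi> n \<xi>"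
          using P.\<phi>_strict[of _ n] Tr \<open>\<xi> \<in> reg n\<close> 1 2 P.\<phi>_T im unfolding reg_def T_def by (metis less_imp_le)+
        ultimately show "\<xi> \<in> reg n \<and> \<phi> n \<xi> \<in> {p..q} \<and> \<bar>\<phi> n \<xi> - \<phi> 0 \<xi>\<bar> < e"
          using sp \<eta>(2) unfolding s_def by auto
      qed
    qed
  qed
  have "\<forall>\<^sub>F n in sequentially. {\<alpha>..\<beta>} \<subseteq> I n \<and> \<phi> n C1_differentiable_on {\<alpha>..\<beta>}"
    using close[OF zero_less_one]
  proof eventually_elim
    case (elim n)
    then have "{\<alpha>..\<beta>} \<subseteq> reg n" by blast
    then show ?case using P.C1_on_reg P.reg_sub unfolding reg_def by blast
  qed
  moreover have "\<phi> 0 C1_differentiable_on {\<alpha>..\<beta>}" using P.C1_on_reg sub unfolding reg_def by blast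
  moreover have "uniform_limit {\<alpha>..\<beta>} \<phi> (\<phi> 0) sequentially"
  proof (rule uniform_limitI)
    fix e :: real assume "e > 0"
    from close[OF this] show "\<forall>\<^sub>F n in sequentially. \<forall>x\<in>{\<alpha>..\<beta>}. dist (\<phi> n x) (\<phi> 0 x) < e"
      by eventually_elim (simp add: dist_real_def)
  qed
  moreover have "uniform_limit {\<alpha>..\<beta>} (\<lambda>n. deriv (\<phi> n)) (deriv (\<phi> 0)) sequentially"
  proof (rule uniform_limitI)
    fix e :: real assume e: "e > 0"
    have "D s \<noteq> 0" if "s \<in> {p..q}" for s using P.D_pos[of s] that pqR by auto
    then have "continuous_on {p..q} (\<lambda>s. z 0 s / D s)" by (intro continuous_intros zc Dc) auto
    then have "uniformly_continuous_on {p..q} (\<lambda>s. z 0 s / D s)"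
      by (rule compact_uniformly_continuous) simp
    \<comment> \<open>Two errors are separated: moving from \<open>\<phi> 0 x\<close> to
      \<open>\<phi> n x\<close> inside the fixed function \<open>z 0 / D\<close> costs uniform
      continuity, and replacing \<open>z 0\<close> by \<open>z n\<close> at the same point is
      \<open>vlim\<close>.\<close>
    then obtain d where d: "d > 0" "\<And>s t. s \<in> {p..q} \<Longrightarrow> t \<in> {p..q} \<Longrightarrow> dist t s < d \<Longrightarrow> dist (z 0 t / D t) (z 0 s / D s) < e / 2"
      using e unfolding uniformly_continuous_on_def by (metis half_gt_zero)
    have "\<forall>\<^sub>F n in sequentially. \<forall>s\<in>{p..q}. dist (z n s / D s) (z 0 s / D s) < e / 2"
      using e by (intro uniform_limitD[OF vlim]) auto
    with close[OF d(1)] show "\<forall>\<^sub>F n in sequentially. \<forall>x\<in>{\<alpha>..\<beta>}. dist (deriv (\<phi> n) x) (deriv (\<phi> 0) x) < e"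
    proof eventually_elim
      case (elim n)
      show ?case
      proof
        fix x assume x: "x \<in> {\<alpha>..\<beta>}"
        have eq: "deriv (\<phi> k) x = z k (\<phi> k x) / D (\<phi> k x)" if "x \<in> reg k" for k
          using P.deriv_\<phi>_eq that unfolding reg_def z_def T_def by blast
        have n: "x \<in> reg n" "\<phi> n x \<in> {p..q}" "\<bar>\<phi> n x - \<phi> 0 x\<bar> < d" using elim(1) x by auto
        have "\<phi> 0 x \<in> {p..q}" using P.anti_D[of _ 0] ab x pq
          by (smt (verit, ccfv_threshold) atLeastAtMost_iff)
        then have "dist (z 0 (\<phi> n x) / D (\<phi> n x)) (z 0 (\<phi> 0 x) / D (\<phi> 0 x)) < e / 2"
          using n by (intro d(2)) (auto simp: dist_real_def)
        moreover have "dist (z n (\<phi> n x) / D (\<phi> n x)) (z 0 (\<phi> n x) / D (\<phi> n x)) < e / 2"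
          using elim(2) n(2) by blast
        ultimately show "dist (deriv (\<phi> n) x) (deriv (\<phi> 0) x) < e"
          using eq[OF n(1)] eq[of 0] sub x dist_triangle_half_r[of "z 0 (\<phi> n x) / D (\<phi> n x)"]
          by (metis dist_commute subsetD)
      qed
    qed
  qed
  ultimately show ?thesis by blast
qed

section \<open>Continuation of semi-wavefronts\<close>

lemma divide_max_lipschitz:
  fixes a m M u v :: real
  assumes "0 \<le> a" "a \<le> M" "m > 0"
  shows "\<bar>a / max m u - a / max m v\<bar> \<le> M / m\<^sup>2 * \<bar>u - v\<bar>"
proof -
  have pos: "max m u \<ge> m" "max m v \<ge> m" by auto
  have "a / max m u - a / max m v = a * (max m v - max m u) / (max m u * max m v)"
    using pos assms by (simp add: field_simps)
  then have "\<bar>a / max m u - a / max m v\<bar> = a * \<bar>max m v - max m u\<bar> / (max m u * max m v)"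
    using pos assms by (simp add: abs_mult)
  also have "\<dots> \<le> M * \<bar>u - v\<bar> / (m * m)"
    using pos assms by (intro frac_le mult_mono mult_nonneg_nonneg) auto
  finally show ?thesis by (simp add: power2_eq_square)
qed

text \<open>Truncating the denominator at \<open>m\<close> makes the right-hand side Lipschitz in
  \<open>y\<close> with constant \<open>M / m\<^sup>2\<close>, so on an interval this short the
  integral operator at least halves distances. In the application \<open>b s = f s - c * s\<close>,
  hence \<open>y + b\<close> is the flux, and the truncation is idle while the flux is at most
  \<open>- m\<close>.\<close>

lemma picard_left:
  fixes A b :: "real \<Rightarrow> real"
  assumes pl: "p \<le> l" and A: "continuous_on {p..l} A" and b: "continuous_on {p..l} b"
    and AM: "\<And>t. t \<in> {p..l} \<Longrightarrow> 0 \<le> A t \<and> A t \<le> M" and m: "m > 0"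
    and small: "M / m\<^sup>2 * (l - p) \<le> 1 / 2"
  obtains y where "continuous_on {p..l} y"
    "\<And>s. s \<in> {p..l} \<Longrightarrow> y s = y\<^sub>l - integral {s..l} (\<lambda>t. A t / max m (- (y t + b t)))"
proof -
  \<comment> \<open>The type of bounded continuous functions lives on the whole line; the clamp
    extends the iterates from \<open>[p, l]\<close> by constants.\<close>
  define cl where "cl = (\<lambda>s. max p (min l s))"
  have cl: "cl s \<in> {p..l}" for s using pl by (auto simp: cl_def)
  have clc: "continuous_on UNIV cl" unfolding cl_def by (intro continuous_intros)
  define k where "k = (\<lambda>y t. A t / max m (- (y t + b t)))"
  have k: "continuous_on {p..l} (k y)" if "continuous_on {p..l} y" for y
    unfolding k_def using m by (intro continuous_intros A b that) (auto simp: max_def)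
  define \<Phi> where "\<Phi> = (\<lambda>y s. y\<^sub>l - integral {cl s..l} (k (apply_bcontfun y)))"
  have bc: "continuous_on S (apply_bcontfun y)" for y :: "real \<Rightarrow>\<^sub>C real" and S
    using apply_bcontfun[of y] by (auto simp: bcontfun_def intro: continuous_on_subset)
  have \<Phi>: "\<Phi> y \<in> bcontfun" for y
  proof -
    have c: "continuous_on {p..l} (\<lambda>s. y\<^sub>l - integral {s..l} (k (apply_bcontfun y)))"
      by (intro continuous_intros indefinite_integral_continuous_1' integrable_continuous_real k bc)
    have "continuous_on UNIV (\<Phi> y)"
      unfolding \<Phi>_def using cl by (intro continuous_on_compose2[OF c clc]) auto
    moreover have "bounded ((\<lambda>s. y\<^sub>l - integral {s..l} (k (apply_bcontfun y))) ` {p..l})"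
      using c by (intro compact_imp_bounded compact_continuous_image) auto
    then have "bounded (range (\<Phi> y))"
      by (rule bounded_subset) (use cl in \<open>auto simp: \<Phi>_def\<close>)
    ultimately show ?thesis by (simp add: bcontfun_def)
  qed
  have "dist (Bcontfun (\<Phi> x)) (Bcontfun (\<Phi> y)) \<le> 1 / 2 * dist x y" for x y
  proof (rule dist_bound)
    fix s
    let ?x = "apply_bcontfun x" and ?y = "apply_bcontfun y"
    have ki: "k ?x integrable_on {cl s..l}" "k ?y integrable_on {cl s..l}"
      using cl[of s] by (auto intro!: integrable_continuous_real continuous_on_subset[OF k[OF bc]])
    have "\<Phi> x s - \<Phi> y s = integral {cl s..l} (\<lambda>t. k ?y t - k ?x t)"
      unfolding \<Phi>_def using ki by (simp add: integral_diff)
    also have "norm \<dots> \<le> (M / m\<^sup>2 * dist x y) * (l - cl s)"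
    proof (rule integral_bound)
      show "cl s \<le> l" using cl[of s] by simp
      show "continuous_on {cl s..l} (\<lambda>t. k ?y t - k ?x t)"
        using cl[of s] by (intro continuous_on_diff continuous_on_subset[OF k[OF bc]]) auto
      fix t assume "t \<in> {cl s..l}"
      then have t: "t \<in> {p..l}" using cl[of s] by auto
      have "M \<ge> 0" using AM[of p] pl by auto
      have "norm (k ?y t - k ?x t) \<le> M / m\<^sup>2 * \<bar>- (?y t + b t) - - (?x t + b t)\<bar>"
        unfolding k_def real_norm_def by (rule divide_max_lipschitz) (use AM[OF t] m in auto)
      also have "\<bar>- (?y t + b t) - - (?x t + b t)\<bar> = dist (?x t) (?y t)" by (simp add: dist_real_def)
      also have "M / m\<^sup>2 * dist (?x t) (?y t) \<le> M / m\<^sup>2 * dist x y"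
        using \<open>M \<ge> 0\<close> by (intro mult_left_mono dist_bounded) auto
      finally show "norm (k ?y t - k ?x t) \<le> M / m\<^sup>2 * dist x y" .
    qed
    also have "\<dots> = (M / m\<^sup>2 * (l - cl s)) * dist x y" by simp
    also have "\<dots> \<le> (M / m\<^sup>2 * (l - p)) * dist x y"
      using cl[of s] AM[of p] pl by (intro mult_right_mono mult_left_mono) auto
    also have "\<dots> \<le> 1 / 2 * dist x y" using small by (intro mult_right_mono) auto
    finally show "dist (apply_bcontfun (Bcontfun (\<Phi> x)) s) (apply_bcontfun (Bcontfun (\<Phi> y)) s) \<le> 1 / 2 * dist x y"
      by (simp add: Bcontfun_inverse[OF \<Phi>] dist_norm)
  qed
  then obtain y where "Bcontfun (\<Phi> y) = y"
    using banach_fix_type[of "1/2" "\<lambda>y. Bcontfun (\<Phi> y)"] by auto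
  then have y: "apply_bcontfun y = \<Phi> y" by (metis Bcontfun_inverse[OF \<Phi>])
  show thesis
  proof (rule that[of "apply_bcontfun y"])
    show "continuous_on {p..l} (apply_bcontfun y)" by (rule bc)
    fix s assume "s \<in> {p..l}"
    then have "cl s = s" by (simp add: cl_def)
    then show "apply_bcontfun y s = y\<^sub>l - integral {s..l} (\<lambda>t. A t / max m (- (apply_bcontfun y t + b t)))"
      by (subst y) (simp add: \<Phi>_def k_def)
  qed
qed

lemma bounded_increasing_limit_right:
  fixes Y :: "real \<Rightarrow> real"
  assumes "l < r" and mono: "\<And>s t. l < s \<Longrightarrow> s \<le> t \<Longrightarrow> t < r \<Longrightarrow> Y s \<le> Y t"
    and bd: "\<And>s. l < s \<Longrightarrow> s < r \<Longrightarrow> B \<le> Y s"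
  obtains y where "(Y \<longlongrightarrow> y) (at_right l)"
proof -
  define y where "y = Inf (Y ` {l<..<r})"
  have bb: "bdd_below (Y ` {l<..<r})" using bd by (auto intro!: bdd_belowI[of _ B])
  have ne: "Y ` {l<..<r} \<noteq> {}" using assms(1) dense by auto
  have "(Y \<longlongrightarrow> y) (at_right l)"
  proof (rule order_tendstoI)
    fix a assume "a < y"
    have "\<forall>\<^sub>F s in at_right l. s \<in> {l<..<r}" using assms(1) by (rule eventually_at_right_real)
    then show "\<forall>\<^sub>F s in at_right l. a < Y s"
    proof eventually_elim
      case (elim s)
      then have "y \<le> Y s" unfolding y_def using bb by (intro cInf_lower) auto
      then show ?case using \<open>a < y\<close> by simp
    qed
  next
    fix a assume "y < a"
    then obtain t where t: "t \<in> {l<..<r}" "Y t < a"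
      using cInf_lessD[OF ne] unfolding y_def by blast
    then have "\<forall>\<^sub>F s in at_right l. s \<in> {l<..<t}" by (intro eventually_at_right_real) auto
    then show "\<forall>\<^sub>F s in at_right l. Y s < a"
    proof eventually_elim
      case (elim s)
      then show ?case using mono[of s t] t by auto
    qed
  qed
  then show thesis by (rule that)
qed

section \<open>Continuation of a profile below a positive infimum\<close>

context profile
begin

text \<open>A profile that reaches \<open>0\<close> before \<omega> stays there, and on such a
  stretch the equation reads \<open>g 0 = 0\<close>. It holds almost everywhere only, but a
  non-empty open interval is not negligible, so one good point exists.\<close>

lemma profile_pos:
  assumes I: "I = {..<\<omega>}" and g0: "g 0 > 0" and x: "x \<in> I"
  shows "\<phi> x > 0"
proof (rule ccontr)
  assume "\<not> \<phi> x > 0"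
  then have x0: "\<phi> x = 0" using \<phi>_range[OF x] by simp
  have z: "\<phi> y = 0" if "y \<in> {x<..<\<omega>}" for y
    using anti_D[of y x] \<phi>_range[of y] that x0 I by auto
  have F0: "F y = 0" "deriv \<phi> y = 0" if "y \<in> {x<..<\<omega>}" for y
  proof -
    have "\<forall>\<^sub>F t in nhds y. \<phi> t = 0"
      using z that unfolding eventually_nhds by (intro exI[of _ "{x<..<\<omega>}"]) auto
    then have "(\<phi> has_real_derivative 0) (at y)" using DERIV_cong_ev[of y y \<phi> "\<lambda>_. 0" 0 0] by simp
    then show "deriv \<phi> y = 0" "F y = 0" by (simp_all add: DERIV_imp_deriv F_def)
  qed
  obtain E where E: "finite E" "classical_on D h g c (I - E) \<phi>" using classical_on_reg by blast
  have "AE \<xi> in lebesgue. \<xi> \<in> I - E \<longrightarrow> (\<exists>w. (F has_real_derivative w) (at \<xi>) \<and>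
             w + (c - h (\<phi> \<xi>)) * deriv \<phi> \<xi> + g (\<phi> \<xi>) = 0)"
    using E(2) unfolding classical_on_def F_def by blast
  then obtain N where N: "N \<in> null_sets lebesgue" and Nsub: "{\<xi> \<in> space lebesgue. \<not> (\<xi> \<in> I - E \<longrightarrow>
      (\<exists>w. (F has_real_derivative w) (at \<xi>) \<and> w + (c - h (\<phi> \<xi>)) * deriv \<phi> \<xi> + g (\<phi> \<xi>) = 0))} \<subseteq> N"
    unfolding eventually_ae_filter by (elim bexE)
  have "negligible (E \<union> N)"
    using N E(1) by (intro negligible_Un negligible_finite[of E]) (simp_all add: negligible_iff_null_sets)
  moreover have "negligible (E \<union> N) \<Longrightarrow> \<not> {x<..<\<omega>} \<subseteq> E \<union> N"
  proof -
    have "{x<..<\<omega>} \<noteq> {}" using x I by simp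
    then have "\<not> negligible {x<..<\<omega>}" by (intro open_not_negligible) auto
    then show "negligible (E \<union> N) \<Longrightarrow> \<not> {x<..<\<omega>} \<subseteq> E \<union> N" using negligible_subset by blast
  qed
  ultimately obtain \<xi> where \<xi>: "\<xi> \<in> {x<..<\<omega>}" "\<xi> \<notin> E" "\<xi> \<notin> N" by blast
  moreover have "\<xi> \<in> I" using \<xi> I by simp
  ultimately obtain w where w: "(F has_real_derivative w) (at \<xi>)"
    "w + (c - h (\<phi> \<xi>)) * deriv \<phi> \<xi> + g (\<phi> \<xi>) = 0" using Nsub by fastforce
  have "\<forall>\<^sub>F t in nhds \<xi>. F t = 0"
    using F0 \<xi> unfolding eventually_nhds by (intro exI[of _ "{x<..<\<omega>}"]) auto
  then have "(F has_real_derivative 0) (at \<xi>)" using DERIV_cong_ev[of \<xi> \<xi> F "\<lambda>_. 0" 0 0] by simp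
  then have "w = 0" using w(1) DERIV_unique by blast
  then show False using w(2) F0(2)[OF \<xi>(1)] z[OF \<xi>(1)] g0 by simp
qed

text \<open>At a sharp point \<open>deriv \<phi>\<close>, and hence \<open>W\<close>, is a junk value; \<open>V\<close> is its continuous repair.\<close>

lemma continuous_flux:
  assumes pos: "\<And>x. x \<in> I \<Longrightarrow> \<phi> x > 0"
  shows "\<exists>V E. finite E \<and> continuous_on I V \<and> (\<forall>x\<in>reg. V x = W x) \<and>
    (\<forall>x\<in>I - E. (V has_real_derivative - g (\<phi> x)) (at x) \<and> W x = V x)"
proof (cases "\<exists>x\<in>I. \<phi> x = R")
  case False
  then have "I = reg" using pos \<phi>_range by (force simp: reg_def)
  then have "\<And>x. x \<in> I - {} \<Longrightarrow> (W has_real_derivative - g (\<phi> x)) (at x)" using W_deriv by blast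
  moreover from this have "continuous_on I W" by (blast intro: DERIV_isCont continuous_at_imp_continuous_on)
  ultimately show ?thesis by (intro exI[of _ W] exI[of _ "{}"]) simp
next
  case True
  then obtain a where a: "a < 0" and edge: "\<And>x. x \<in> I \<Longrightarrow> \<phi> x = R \<longleftrightarrow> x \<le> a"
    using left_edge by metis
  have aI: "a \<in> I" using I_down zero_I a by (meson less_imp_le)
  define V where "V = (\<lambda>x. if x \<le> a then c * R - f R else W x)"
  have reg: "x \<in> reg \<longleftrightarrow> a < x" if "x \<in> I" for x
    using edge[OF that] pos[OF that] \<phi>_range[OF that] that by (auto simp: reg_def)
  have V1: "V x = W x" if "x \<in> I - {a}" for x
    using W_eq_left_of_edge[OF edge, of x] that aI by (auto simp: V_def)
  have V2: "(V has_real_derivative - g (\<phi> x)) (at x)" if "x \<in> I - {a}" for x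
  proof (cases "x < a")
    case True
    then have "\<forall>\<^sub>F y in nhds x. V y = c * R - f R"
      unfolding eventually_nhds V_def by (intro exI[of _ "{..<a}"]) auto
    then have "(V has_real_derivative 0) (at x)" using DERIV_cong_ev[of x x V "\<lambda>_. c * R - f R" 0 0] by simp
    moreover have "g (\<phi> x) = 0" using edge[of x] True that g_R by auto
    ultimately show ?thesis by simp
  next
    case False
    then have "x \<in> reg" using that reg by auto
    then have "\<forall>\<^sub>F y in nhds x. V y = W y"
      unfolding eventually_nhds V_def using reg_open reg reg_sub by (intro exI[of _ reg]) force
    then show ?thesis using DERIV_cong_ev[of x x V W] W_deriv[OF \<open>x \<in> reg\<close>] by blast
  qed
  have sub: "{a - 1..0} \<subseteq> I" using zero_I I_down by auto
  define H where "H = (\<lambda>x. c * R - f R - integral {a - 1..x} (\<lambda>y. g (\<phi> y)))"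
  have "continuous_on {a - 1..0} H"
    unfolding H_def
    by (intro continuous_intros indefinite_integral_continuous_1 integrable_continuous_real
        continuous_on_subset[OF comp_\<phi>_cont sub] g_cont)
  then have "isCont H a"
    using continuous_on_interior[of "{a - 1..0}" H a] a by (simp add: interior_atLeastAtMost_real)
  moreover have "V x = H x" if "x \<in> {a - 1<..<0}" for x
  proof (cases "x \<le> a")
    case True
    have "g (\<phi> z) = 0" if "z \<in> {a - 1..x}" for z
      using edge[of z] that True a sub g_R by (auto simp: subset_iff)
    then have "integral {a - 1..x} (\<lambda>y. g (\<phi> y)) = 0" by (intro integral_unique has_integral_is_0)
    then show ?thesis using True by (simp add: V_def H_def)
  next
    case False
    then show ?thesis using W_right_of_edge[OF edge a, of x] that by (simp add: V_def H_def)
  qed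
  then have "\<forall>\<^sub>F x in nhds a. V x = H x"
    using a unfolding eventually_nhds by (intro exI[of _ "{a - 1<..<0}"]) auto
  ultimately have "isCont V a" using isCont_cong by blast
  then have "isCont V x" if "x \<in> I" for x
    using V2[of x] DERIV_isCont that by (cases "x = a") auto
  then have "continuous_on I V" by (intro continuous_at_imp_continuous_on) blast
  moreover have "V x = W x" if "x \<in> reg" for x using that reg reg_sub by (auto simp: V_def)
  ultimately show ?thesis using V1 V2 by (intro exI[of _ V] exI[of _ "{a}"]) auto
qed

text \<open>\<open>S\<close> agrees with \<open>\<phi>\<close> on \<open>(0, \<omega>)\<close>, so
  the seam at \<omega> lies inside the region described by \<open>S\<close>, while to the left of
  \<omega> all local properties, sharp points included, are inherited from \<open>\<phi>\<close>.
  The work lies in the global requirements: integrability, the weak formulation and absolute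
  continuity on one set.\<close>

lemma semi_wavefront_extension:
  fixes S S' :: "real \<Rightarrow> real"
  assumes I: "I = {..<\<omega>}" and w: "\<omega> < \<omega>''" "\<omega>'' < \<omega>'" and pos: "\<And>x. x \<in> I \<Longrightarrow> \<phi> x > 0"
    and eq: "\<And>x. 0 < x \<Longrightarrow> x < \<omega> \<Longrightarrow> S x = \<phi> x"
    and S_range: "\<And>x. x \<in> {0<..<\<omega>'} \<Longrightarrow> S x \<in> {0<..<R}"
    and S_deriv: "\<And>x. x \<in> {0<..<\<omega>'} \<Longrightarrow> (S has_real_derivative S' x) (at x)"
    and S'_neg: "\<And>x. x \<in> {0<..<\<omega>'} \<Longrightarrow> S' x \<le> 0"
    and S'_cont: "continuous_on {0<..<\<omega>'} S'"
    and S_ode: "\<And>x. x \<in> {0<..<\<omega>'} \<Longrightarrow>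
      ((\<lambda>x. D (S x) * S' x - f (S x) + c * S x) has_real_derivative - g (S x)) (at x)"
  shows "semi_wavefront R D f h g c \<omega>'' (\<lambda>x. if x < \<omega> then \<phi> x else S x)"
proof -
  define \<eta> where "\<eta> = (\<lambda>x. if x < \<omega> then \<phi> x else S x)"
  have \<omega>: "0 < \<omega>" using zero_I I by simp
  \<comment> \<open>A point inside the overlap, at which sets and fluxes are split into a part for
    \<open>\<phi>\<close> and a part for \<open>S\<close>.\<close>
  define q where "q = \<omega> / 2"
  have q: "0 < q" "q < \<omega>" "q \<in> I" using \<omega> I by (auto simp: q_def)
  let ?I = "{..<\<omega>''}"
  have \<eta>\<phi>: "\<eta> x = \<phi> x" if "x < \<omega>" for x using that by (simp add: \<eta>_def)
  have \<eta>S: "\<eta> x = S x" if "0 < x" for x using that eq by (simp add: \<eta>_def)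
  have ev\<phi>: "\<forall>\<^sub>F y in nhds x. \<eta> y = \<phi> y" if "x < \<omega>" for x
    unfolding eventually_nhds using that \<eta>\<phi> by (intro exI[of _ "{..<\<omega>}"]) auto
  have evS: "\<forall>\<^sub>F y in nhds x. \<eta> y = S y" if "0 < x" for x
    unfolding eventually_nhds using that \<eta>S by (intro exI[of _ "{0<..}"]) auto
  have diff\<phi>: "\<eta> differentiable (at x) \<longleftrightarrow> \<phi> differentiable (at x)" if "x < \<omega>" for x
    unfolding real_differentiable_def using DERIV_cong_ev[OF refl ev\<phi>[OF that] refl] by blast
  have d\<phi>: "deriv \<eta> x = deriv \<phi> x" if "x < \<omega>" for x
    using deriv_cong_ev[OF ev\<phi>[OF that] refl] .
  have dS: "(\<eta> has_real_derivative S' x) (at x)" "deriv \<eta> x = S' x" if "x \<in> {0<..<\<omega>'}" for x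
  proof -
    show "(\<eta> has_real_derivative S' x) (at x)"
      using DERIV_cong_ev[OF refl evS refl, of x "S' x"] S_deriv that by auto
    then show "deriv \<eta> x = S' x" by (rule DERIV_imp_deriv)
  qed
  define B where "B = (\<lambda>x. D (S x) * S' x)"
  have B: "D (\<eta> x) * deriv \<eta> x = B x" if "x \<in> {0<..<\<omega>'}" for x
    using dS(2)[OF that] \<eta>S that by (simp add: B_def)
  have F: "D (\<eta> x) * deriv \<eta> x = F x" if "x < \<omega>" for x
    using d\<phi> \<eta>\<phi> that by (simp add: F_def)
  have S_cont: "continuous_on {0<..<\<omega>'} S"
    using S_deriv DERIV_isCont by (blast intro: continuous_at_imp_continuous_on)
  have compS: "continuous_on {0<..<\<omega>'} (\<lambda>x. u (S x))" if "continuous_on {0..R} u" for u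
  proof (rule continuous_on_compose2[OF that S_cont])
    show "S ` {0<..<\<omega>'} \<subseteq> {0..R}" using S_range by fastforce
  qed
  have B_deriv: "(B has_real_derivative (- g (S x) + h (S x) * S' x - c * S' x)) (at x)"
    if "x \<in> {0<..<\<omega>'}" for x
  proof -
    have "((\<lambda>x. (D (S x) * S' x - f (S x) + c * S x) + f (S x) - c * S x) has_real_derivative
        - g (S x) + h (S x) * S' x - c * S' x) (at x)"
      by (intro DERIV_diff DERIV_add S_ode[OF that] DERIV_cmult S_deriv[OF that]
          DERIV_chain2[OF f_deriv[OF S_range[OF that]] S_deriv[OF that]])
    then show ?thesis by (simp add: B_def)
  qed
  have h_cont: "continuous_on {0..R} h" using f_C1 by (simp add: C1_on_def)
  have B'_cont: "continuous_on {0<..<\<omega>'} (\<lambda>x. - g (S x) + h (S x) * S' x - c * S' x)"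
    by (intro continuous_intros compS S'_cont g_cont h_cont)
  have B_cont: "continuous_on {0<..<\<omega>'} B"
    unfolding B_def by (intro continuous_intros compS S'_cont D_cont)
  obtain E where E: "finite E" "reg \<subseteq> I - E" "E \<subseteq> I" "inj_on \<phi> E"
    "\<forall>\<xi>\<in>E. g (\<phi> \<xi>) = 0 \<and> \<not> \<phi> differentiable (at \<xi>)" "classical_on D h g c (I - E) \<phi>"
    using classical_on_reg by blast
  have reg: "x \<in> reg" if "0 < x" "x < \<omega>" for x
  proof -
    have "x \<in> I" using that I by simp
    then show ?thesis unfolding reg_def using pos[of x] S_range[of x] eq[of x] that w by auto
  qed
  have \<eta>_diff: "\<eta> differentiable (at x)" if "x \<in> ?I - E" for x
  proof (cases "x < \<omega>")
    case True
    then have "\<phi> differentiable (at x)" using E(6) that I unfolding classical_on_def by auto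
    then show ?thesis using diff\<phi>[OF True] by simp
  next
    case False
    then show ?thesis using dS(1)[of x] that w \<omega> unfolding real_differentiable_def by auto
  qed
  have \<eta>_range: "\<eta> x \<in> {0..R}" if "x \<in> ?I" for x
  proof (cases "x < \<omega>")
    case True then show ?thesis using \<phi>_range[of x] \<eta>\<phi>[of x] I by auto
  next
    case False then show ?thesis using S_range[of x] \<eta>S[of x] that w \<omega> by auto
  qed
  have \<eta>_cont: "continuous_on ?I \<eta>"
  proof (intro continuous_at_imp_continuous_on ballI)
    fix x assume x: "x \<in> ?I"
    show "isCont \<eta> x"
    proof (cases "x < \<omega>")
      case True
      then have "isCont \<phi> x" using \<phi>_cont I_open I by (simp add: continuous_on_eq_continuous_at)
      then show ?thesis using isCont_cong[OF ev\<phi>[OF True]] by simp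
    next
      case False then show ?thesis using dS(1)[of x] x w \<omega> DERIV_isCont by auto
    qed
  qed
  have \<eta>_anti: "\<eta> y \<le> \<eta> x" if "x \<le> y" "y < \<omega>''" for x y
  proof -
    have Sa: "S v \<le> S u" if "0 < u" "u \<le> v" "v < \<omega>''" for u v
    proof (rule DERIV_nonpos_imp_nonincreasing[OF that(2)])
      fix t assume "u \<le> t" "t \<le> v"
      then have "t \<in> {0<..<\<omega>'}" using that w by auto
      then show "\<exists>d. (S has_real_derivative d) (at t) \<and> d \<le> 0" using S_deriv S'_neg by blast
    qed
    consider "y < \<omega>" | "0 < x" | "\<omega> \<le> y" "x \<le> 0" by linarith
    then show ?thesis
    proof cases
      case 1 then show ?thesis using anti_D[of y x] that I \<eta>\<phi> by auto
    next
      case 2 then show ?thesis using Sa[of x y] that \<eta>S by auto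
    next
      case 3
      have "\<phi> q \<le> \<phi> x" using 3 q by (intro anti_D) auto
      moreover have "S y \<le> S q" using 3 q that by (intro Sa) auto
      ultimately show ?thesis using 3 q \<omega> eq[of q] \<eta>\<phi>[of x] \<eta>S[of y] by auto
    qed
  qed
  have not_const: "\<not> \<eta> constant_on ?I"
  proof
    assume "\<eta> constant_on ?I"
    then obtain k where k: "\<And>x. x < \<omega>'' \<Longrightarrow> \<eta> x = k" unfolding constant_on_def by auto
    have "\<forall>\<^sub>F x in at_bot. R / 2 < \<phi> x" by (rule order_tendstoD(1)[OF lim_bot]) (use R_pos in simp)
    moreover have "\<forall>\<^sub>F x in at_bot. x < (0::real)" by (rule eventually_gt_at_bot)
    ultimately have "\<forall>\<^sub>F x in at_bot. R / 2 < \<phi> x \<and> x < 0" by (rule eventually_conj)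
    then obtain x where "R / 2 < \<phi> x" "x < 0" unfolding eventually_at_bot_linorder by blast
    moreover have "\<eta> x = \<phi> x" "\<eta> 0 = R / 2" using \<eta>\<phi> \<phi>_0 \<omega> \<open>x < 0\<close> by auto
    ultimately show False using k[of x] k[of 0] \<omega> w by auto
  qed
  have \<eta>_lim: "(\<eta> \<longlongrightarrow> R) at_bot"
  proof (rule Lim_transform_eventually[OF lim_bot])
    show "\<forall>\<^sub>F x in at_bot. \<phi> x = \<eta> x"
      using eventually_gt_at_bot[of \<omega>] by eventually_elim (simp add: \<eta>\<phi>)
  qed
  have flux_int: "set_integrable lebesgue K (\<lambda>x. D (\<eta> x) * deriv \<eta> x)" if K: "compact K" "K \<subseteq> ?I" for K
  proof -
    have K1: "compact (K \<inter> {..q})" "K \<inter> {..q} \<subseteq> I" using K q I by auto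
    have "set_integrable lebesgue (K \<inter> {..q}) (\<lambda>x. D (\<phi> x) * deriv \<phi> x)"
      using wave K1 unfolding traveling_wave_def by blast
    moreover have "set_integrable lebesgue (K \<inter> {..q}) (\<lambda>x. D (\<phi> x) * deriv \<phi> x) \<longleftrightarrow>
        set_integrable lebesgue (K \<inter> {..q}) (\<lambda>x. D (\<eta> x) * deriv \<eta> x)"
    proof (intro set_integrable_cong refl)
      fix x assume "x \<in> K \<inter> {..q}"
      then show "D (\<phi> x) * deriv \<phi> x = D (\<eta> x) * deriv \<eta> x" using F[of x] q by (simp add: F_def)
    qed
    ultimately have 1: "set_integrable lebesgue (K \<inter> {..q}) (\<lambda>x. D (\<eta> x) * deriv \<eta> x)" by blast
    have "B absolutely_integrable_on {q..\<omega>''}"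
      using w q by (intro absolutely_integrable_continuous_real continuous_on_subset[OF B_cont]) auto
    moreover have "set_integrable lebesgue {q..\<omega>''} (\<lambda>x. D (\<eta> x) * deriv \<eta> x) \<longleftrightarrow>
        set_integrable lebesgue {q..\<omega>''} B"
      using B w q by (intro set_integrable_cong refl) auto
    ultimately have "set_integrable lebesgue {q..\<omega>''} (\<lambda>x. D (\<eta> x) * deriv \<eta> x)" by blast
    then have 2: "set_integrable lebesgue (K \<inter> {q..}) (\<lambda>x. D (\<eta> x) * deriv \<eta> x)"
      by (rule set_integrable_subset) (use K in \<open>auto simp: compact_imp_closed less_imp_le subset_iff\<close>)
    have "set_integrable lebesgue ((K \<inter> {..q}) \<union> (K \<inter> {q..})) (\<lambda>x. D (\<eta> x) * deriv \<eta> x)"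
      using 1 2 by (rule set_integrable_Un) (use K in \<open>auto simp: compact_imp_closed\<close>)
    moreover have "(K \<inter> {..q}) \<union> (K \<inter> {q..}) = K" by auto
    ultimately show ?thesis by simp
  qed
  have weak: "(LINT x:?I|lebesgue. (D (\<eta> x) * deriv \<eta> x - f (\<eta> x) + c * \<eta> x) * deriv \<psi> x - g (\<eta> x) * \<psi> x) = 0"
    if \<psi>: "test_function ?I \<psi>" for \<psi>
  proof -
    obtain V E0 where V: "finite E0" "continuous_on I V" "\<And>x. x \<in> reg \<Longrightarrow> V x = W x"
      "\<And>x. x \<in> I - E0 \<Longrightarrow> (V has_real_derivative - g (\<phi> x)) (at x)"
      "\<And>x. x \<in> I - E0 \<Longrightarrow> W x = V x"
      using continuous_flux pos by blast
    define WS where "WS = (\<lambda>x. D (S x) * S' x - f (S x) + c * S x)"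
    \<comment> \<open>One continuous primitive for the whole extension: the repaired flux left of
      \<omega>, the flux of \<open>S\<close> from \<omega> on. The two coincide on the overlap, so
      there is no jump at \<omega>.\<close>
    define V' where "V' = (\<lambda>x. if x < \<omega> then V x else WS x)"
    have V'S: "V' x = WS x" if "x \<in> {0<..<\<omega>'}" for x
    proof (cases "x < \<omega>")
      case True
      then have "V' x = W x" using V(3)[OF reg] that by (simp add: V'_def)
      also have "\<dots> = WS x" using F[OF True] B[OF that] eq[of x] that True by (simp add: W_def WS_def B_def)
      finally show ?thesis .
    qed (simp add: V'_def)
    have evV: "\<forall>\<^sub>F y in nhds x. V' y = V y" if "x < \<omega>" for x
      unfolding eventually_nhds using that by (intro exI[of _ "{..<\<omega>}"]) (auto simp: V'_def)
    have evW: "\<forall>\<^sub>F y in nhds x. V' y = WS y" if "x \<in> {0<..<\<omega>'}" for x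
      unfolding eventually_nhds using that V'S by (intro exI[of _ "{0<..<\<omega>'}"]) auto
    have S1: "(V' has_real_derivative - g (\<eta> x)) (at x)" if "x \<in> {0<..<\<omega>'}" for x
      using DERIV_cong_ev[OF refl evW[OF that] refl] S_ode[OF that] \<eta>S that unfolding WS_def by auto
    show ?thesis
    proof (rule weak_form_by_parts(1)[OF _ _ _ \<psi>, where V = V' and E = E0 and E' = E0])
      show "continuous_on ?I V'"
      proof (intro continuous_at_imp_continuous_on ballI)
        fix x assume x: "x \<in> ?I"
        show "isCont V' x"
        proof (cases "x < \<omega>")
          case True
          then have "isCont V x" using V(2) I_open I by (simp add: continuous_on_eq_continuous_at)
          then show ?thesis using isCont_cong[OF evV[OF True]] by simp
        next
          case False then show ?thesis using S1[of x] x w \<omega> DERIV_isCont by auto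
        qed
      qed
      show "continuous_on ?I (\<lambda>x. g (\<eta> x))"
        using \<eta>_range by (intro continuous_on_compose2[OF g_cont \<eta>_cont]) auto
      show "(V' has_real_derivative - g (\<eta> x)) (at x)" if "x \<in> ?I - E0" for x
      proof (cases "x < \<omega>")
        case True
        then show ?thesis
          using DERIV_cong_ev[OF refl evV[OF True] refl] V(4)[of x] that I \<eta>\<phi>[OF True] by simp
      next
        case False then show ?thesis using S1[of x] that w \<omega> by auto
      qed
      show "D (\<eta> x) * deriv \<eta> x - f (\<eta> x) + c * \<eta> x = V' x" if "x \<in> ?I - E0" for x
      proof (cases "x < \<omega>")
        case True
        then show ?thesis
          using V(5)[of x] that I F[OF True] \<eta>\<phi>[OF True] by (simp add: V'_def W_def)
      next
        case False
        then have "x \<in> {0<..<\<omega>'}" using that w \<omega> by auto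
        then show ?thesis using V'S B \<eta>S by (simp add: WS_def B_def)
      qed
    qed (use V(1) in auto)
  qed
  have tw: "traveling_wave R D f g c ?I \<eta>"
    unfolding traveling_wave_def
  proof (intro conjI allI impI)
    have "E \<in> null_sets lebesgue" using E(1) unfolding negligible_iff_null_sets[symmetric] by (rule negligible_finite)
    then have "AE \<xi> in lebesgue. \<xi> \<notin> E" by (rule AE_not_in)
    then show "AE \<xi> in lebesgue. \<xi> \<in> ?I \<longrightarrow> \<eta> differentiable (at \<xi>)"
      by eventually_elim (use \<eta>_diff in auto)
    show "is_interval ?I" by (auto simp: is_interval_1)
    show "?I \<noteq> {}" by (metis lessThan_iff empty_iff lt_ex)
  qed (use \<eta>_range \<eta>_cont flux_int weak in auto)
  have "abs_continuous_on (?I - E) (\<lambda>x. D (\<eta> x) * deriv \<eta> x)"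
  proof -
    have "q \<in> reg" using reg q by simp
    have AC: "abs_continuous_on (I - E) F" using E(6) unfolding classical_on_def F_def by blast
    \<comment> \<open>The flux is split into a part frozen beyond \<open>q\<close> and a part that
      vanishes up to \<open>q\<close>. The former inherits absolute continuity from \<open>F\<close>
      through a clamp; the latter is Lipschitz, because the derivative of \<open>B\<close> is
      bounded up to \<open>\<omega>''\<close>.\<close>
    have A1: "abs_continuous_on (?I - E) (\<lambda>x. F (min x q))"
    proof (rule abs_continuous_on_comp[OF AC])
      show "{min x q..min y q} \<subseteq> I - E" if "x \<le> y" "{x..y} \<subseteq> ?I - E" for x y
      proof
        fix t assume t: "t \<in> {min x q..min y q}"
        show "t \<in> I - E"
        proof (cases "x \<le> q")
          case True
          then have "t \<in> {x..y}" "t \<le> q" using t by auto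
          then show ?thesis using that(2) q I by (auto simp: subset_iff)
        next
          case False
          then have "t = q" using t that(1) by auto
          then show ?thesis using \<open>q \<in> reg\<close> E(2) by blast
        qed
      qed
    qed (auto simp: mono_def min_def)
    have "bounded ((\<lambda>x. - g (S x) + h (S x) * S' x - c * S' x) ` {q..\<omega>''})"
      using q w by (intro compact_imp_bounded compact_continuous_image continuous_on_subset[OF B'_cont]) auto
    then obtain L where L: "L > 0" "\<And>x. x \<in> {q..\<omega>''} \<Longrightarrow> \<bar>- g (S x) + h (S x) * S' x - c * S' x\<bar> \<le> L"
      unfolding bounded_pos by auto
    have A2: "abs_continuous_on (?I - E) (\<lambda>x. B (max x q) - F q)"
    proof (rule abs_continuous_on_lipschitz)
      fix x y assume xy: "x \<in> ?I - E" "y \<in> ?I - E" "x \<le> y"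
      have "norm (B (max y q) - B (max x q)) \<le> L * norm (max y q - max x q)"
      proof (rule field_differentiable_bound[of "{q..\<omega>''}" B "\<lambda>x. - g (S x) + h (S x) * S' x - c * S' x"])
        show "(B has_real_derivative - g (S t) + h (S t) * S' t - c * S' t) (at t within {q..\<omega>''})"
          if "t \<in> {q..\<omega>''}" for t
          using that q w by (intro has_field_derivative_at_within[OF B_deriv]) auto
      qed (use L xy q w in auto)
      also have "\<dots> \<le> L * (y - x)" using L(1) xy by (intro mult_left_mono) auto
      finally show "\<bar>B (max y q) - F q - (B (max x q) - F q)\<bar> \<le> L * (y - x)" by simp
    qed
    have "D (\<eta> x) * deriv \<eta> x = F (min x q) + (B (max x q) - F q)" if "x \<in> ?I - E" for x
    proof (cases "x \<le> q")
      case True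
      have "B q = F q" using B[of q] F[of q] q w by simp
      then show ?thesis using True F[of x] q by simp
    next
      case False
      then show ?thesis using B[of x] q w that by simp
    qed
    moreover have "abs_continuous_on (?I - E) (\<lambda>x. F (min x q) + (B (max x q) - F q))"
      by (rule abs_continuous_on_add[OF A1 A2])
    ultimately show ?thesis by (rule abs_continuous_on_eq[rotated])
  qed
  moreover have "AE \<xi> in lebesgue. \<xi> \<in> ?I - E \<longrightarrow>
      (\<exists>w. ((\<lambda>\<xi>. D (\<eta> \<xi>) * deriv \<eta> \<xi>) has_real_derivative w) (at \<xi>) \<and>
           w + (c - h (\<eta> \<xi>)) * deriv \<eta> \<xi> + g (\<eta> \<xi>) = 0)"
  proof -
    have "AE \<xi> in lebesgue. \<xi> \<in> I - E \<longrightarrow> (\<exists>w. (F has_real_derivative w) (at \<xi>) \<and>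
             w + (c - h (\<phi> \<xi>)) * deriv \<phi> \<xi> + g (\<phi> \<xi>) = 0)"
      using E(6) unfolding classical_on_def F_def by blast
    then show ?thesis
    proof eventually_elim
      case (elim \<xi>)
      show ?case
      proof
        assume \<xi>: "\<xi> \<in> ?I - E"
        show "\<exists>w. ((\<lambda>\<xi>. D (\<eta> \<xi>) * deriv \<eta> \<xi>) has_real_derivative w) (at \<xi>) \<and>
           w + (c - h (\<eta> \<xi>)) * deriv \<eta> \<xi> + g (\<eta> \<xi>) = 0"
        proof (cases "\<xi> < \<omega>")
          case True
          then obtain w where w: "(F has_real_derivative w) (at \<xi>)"
             "w + (c - h (\<phi> \<xi>)) * deriv \<phi> \<xi> + g (\<phi> \<xi>) = 0" using elim \<xi> I by auto
          have "\<forall>\<^sub>F y in nhds \<xi>. D (\<eta> y) * deriv \<eta> y = F y"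
            unfolding eventually_nhds using True F by (intro exI[of _ "{..<\<omega>}"]) auto
          then have "((\<lambda>\<xi>. D (\<eta> \<xi>) * deriv \<eta> \<xi>) has_real_derivative w) (at \<xi>)"
            using DERIV_cong_ev[of \<xi> \<xi> "\<lambda>\<xi>. D (\<eta> \<xi>) * deriv \<eta> \<xi>" F w w] w(1) by blast
          then show ?thesis using w(2) d\<phi>[OF True] \<eta>\<phi>[OF True] by (intro exI[of _ w]) simp
        next
          case False
          then have x: "\<xi> \<in> {0<..<\<omega>'}" using \<xi> w \<omega> by auto
          let ?w = "- g (S \<xi>) + h (S \<xi>) * S' \<xi> - c * S' \<xi>"
          have "\<forall>\<^sub>F y in nhds \<xi>. D (\<eta> y) * deriv \<eta> y = B y"
            unfolding eventually_nhds using x B by (intro exI[of _ "{0<..<\<omega>'}"]) auto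
          then have "((\<lambda>\<xi>. D (\<eta> \<xi>) * deriv \<eta> \<xi>) has_real_derivative ?w) (at \<xi>)"
            using DERIV_cong_ev[of \<xi> \<xi> "\<lambda>\<xi>. D (\<eta> \<xi>) * deriv \<eta> \<xi>" B ?w ?w] B_deriv[OF x] by blast
          moreover have "?w + (c - h (\<eta> \<xi>)) * deriv \<eta> \<xi> + g (\<eta> \<xi>) = 0"
            using dS(2)[OF x] \<eta>S[of \<xi>] x by (simp add: algebra_simps)
          ultimately show ?thesis by blast
        qed
      qed
    qed
  qed
  ultimately have cl: "classical_on D h g c (?I - E) \<eta>"
    using \<eta>_diff unfolding classical_on_def by blast
  have "classical_or_sharp D h g c ?I \<eta>"
    unfolding classical_or_sharp_def
  proof (intro exI[of _ E] conjI cl E(1))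
    have "x < \<omega>" if "x \<in> E" for x using E(3) I that by auto
    then show "E \<subseteq> ?I" "inj_on \<eta> E" "\<forall>\<xi>\<in>E. g (\<eta> \<xi>) = 0 \<and> \<not> \<eta> differentiable (at \<xi>)"
      using E(4,5) w \<eta>\<phi> diff\<phi> by (force simp: inj_on_def)+
  qed
  then have "semi_wavefront R D f h g c \<omega>'' \<eta>"
    unfolding semi_wavefront_def using tw \<eta>_anti not_const g_R \<eta>_lim by (auto simp: monotone_on_def)
  then show ?thesis by (simp add: \<eta>_def[abs_def])
qed

text \<open>The delicate point is the flux at the infimum \<open>l\<close> of the range. Its limit
  exists because \<open>Y\<close> is monotone and the finite \<omega> bounds it from below; it is
  not \<open>0\<close>, because the term \<open>A / \<bar>Z\<bar>\<close> would then force
  \<open>Z\<close> to increase away from \<open>l\<close>, although \<open>Z\<close> is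
  negative.\<close>

lemma all_values_attained:
  assumes I: "I = {..<\<omega>}" and gp: "\<And>s. s \<in> {0..<R} \<Longrightarrow> g s > 0"
    and maximal: "\<And>\<omega>' \<eta>. \<omega> < \<omega>' \<Longrightarrow> semi_wavefront R D f h g c \<omega>' \<eta> \<Longrightarrow> \<exists>\<xi><\<omega>. \<eta> \<xi> \<noteq> \<phi> \<xi>"
  shows "{0<..<R} \<subseteq> \<phi> ` reg"
proof (rule ccontr)
  assume "\<not> ?thesis"
  then obtain s0 where s0: "0 < s0" "s0 < R" "s0 \<notin> \<phi> ` reg"
    by (meson greaterThanLessThan_iff subsetI)
  have \<omega>: "0 < \<omega>" using zero_I I by simp
  have pos: "\<phi> x > 0" if "x \<in> I" for x
    using profile_pos[OF I _ that] gp[of 0] R_pos by simp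
  have above: "s0 < s" if s: "s \<in> \<phi> ` reg" for s
  proof (rule ccontr)
    assume "\<not> s0 < s"
    then show False using s s0 value_attained[of _ s0] by force
  qed
  define l where "l = Inf (\<phi> ` reg)"
  have ne: "\<phi> ` reg \<noteq> {}" using zero_reg by auto
  have bdd: "bdd_below (\<phi> ` reg)" using above by (auto intro!: bdd_belowI[of _ s0] less_imp_le)
  have l0: "l > 0" using cInf_greatest[OF ne, of s0] above s0(1) unfolding l_def by fastforce
  have l_notin: "l \<notin> \<phi> ` reg"
  proof
    assume "l \<in> \<phi> ` reg"
    then obtain r where r: "r > 0" "ball l r \<subseteq> \<phi> ` reg" using \<phi>_reg_open by (meson openE)
    then have "l - r / 2 \<in> \<phi> ` reg" by (auto simp: subset_iff dist_real_def)
    then have "l \<le> l - r / 2" unfolding l_def using bdd by (rule cInf_lower)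
    then show False using r(1) by simp
  qed
  have im: "s \<in> \<phi> ` reg \<longleftrightarrow> s \<in> {l<..<R}" for s
  proof
    assume s: "s \<in> \<phi> ` reg"
    then have "l \<le> s" unfolding l_def using bdd by (rule cInf_lower)
    moreover have "s \<noteq> l" using s l_notin by blast
    moreover have "s < R" using s reg_range by force
    ultimately show "s \<in> {l<..<R}" by simp
  next
    assume "s \<in> {l<..<R}"
    then have "Inf (\<phi> ` reg) < s" by (simp add: l_def)
    then obtain t where "t \<in> \<phi> ` reg" "t < s" using cInf_lessD[OF ne] by blast
    then show "s \<in> \<phi> ` reg" using value_attained[of _ s] \<open>s \<in> {l<..<R}\<close> by force
  qed
  have half: "l < R / 2" using im[of "R / 2"] zero_reg \<phi>_0 by force
  define Z where "Z = (\<lambda>s. F (T s))"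
  define A where "A = (\<lambda>s. D s * g s)"
  define b where "b = (\<lambda>s. f s - c * s)"
  define Y where "Y = (\<lambda>s. Z s - b s)"
  have Zneg: "Z s < 0" if "s \<in> {l<..<R}" for s using F_neg[OF T_reg] im that unfolding Z_def by blast
  have Yder: "(Y has_real_derivative - (A s / Z s)) (at s)" if "s \<in> {l<..<R}" for s
    using reduced_deriv[of s] im that unfolding Y_def Z_def A_def b_def by (simp add: algebra_simps)
  have Apos: "A s > 0" if "s \<in> {0<..<R}" for s
    using D_pos[OF that] g_pos[OF that] by (simp add: A_def)
  have f_cont: "continuous_on {0..R} f" using f_C1 unfolding C1_on_def by (meson DERIV_continuous_on)
  have h_cont: "continuous_on {0..R} h" using f_C1 by (simp add: C1_on_def)
  have A_cont: "continuous_on {0..R} A" unfolding A_def by (intro continuous_intros D_cont g_cont)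
  have b_cont: "continuous_on {0..R} b" unfolding b_def by (intro continuous_intros f_cont)
  have bound: "\<exists>M>0. \<forall>s\<in>{0..R}. \<bar>u s\<bar> \<le> M" if "continuous_on {0..R} u" for u :: "real \<Rightarrow> real"
  proof -
    have "bounded (u ` {0..R})" by (intro compact_imp_bounded compact_continuous_image that) simp
    then show ?thesis unfolding bounded_pos by auto
  qed
  obtain G where G: "G > 0" "\<And>s. s \<in> {0..R} \<Longrightarrow> \<bar>g s\<bar> \<le> G" using bound[OF g_cont] by blast
  obtain M where M: "M > 0" "\<And>s. s \<in> {0..R} \<Longrightarrow> \<bar>A s\<bar> \<le> M" using bound[OF A_cont] by blast
  obtain H where H: "H > 0" "\<And>s. s \<in> {0..R} \<Longrightarrow> \<bar>h s\<bar> \<le> H" using bound[OF h_cont] by blast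
  \<comment> \<open>\<open>W\<close> falls at a rate of at most \<open>G\<close>, and the profile
    descends from \<open>R / 2\<close> to \<open>s\<close> within a length below \<omega>.\<close>
  have lb: "W 0 - G * \<omega> \<le> Y s" if s: "l < s" "s < R / 2" for s
  proof -
    have sim: "s \<in> \<phi> ` reg" using im s R_pos by auto
    have Ts: "T s \<in> reg" "\<phi> (T s) = s" using T_reg[OF sim] \<phi>_T[OF sim] by auto
    have T0: "0 \<le> T s" using anti_D[OF zero_I, of "T s"] Ts s \<phi>_0 by (cases "0 \<le> T s") auto
    have "(\<lambda>x. W x + G * x) 0 \<le> (\<lambda>x. W x + G * x) (T s)"
    proof (rule DERIV_nonneg_imp_nondecreasing[OF T0])
      fix x assume "0 \<le> x" "x \<le> T s"
      then have x: "x \<in> reg" using reg_between[OF zero_reg Ts(1)] by auto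
      have "((\<lambda>x. W x + G * x) has_real_derivative - g (\<phi> x) + G * 1) (at x)"
        by (intro DERIV_add W_deriv[OF x] DERIV_cmult DERIV_ident)
      moreover have "- g (\<phi> x) + G * 1 \<ge> 0" using G(2)[of "\<phi> x"] reg_range[OF x] by auto
      ultimately show "\<exists>d. ((\<lambda>x. W x + G * x) has_real_derivative d) (at x) \<and> 0 \<le> d" by blast
    qed
    moreover have "W (T s) = Y s" using Ts by (simp add: W_def Y_def Z_def b_def)
    moreover have "T s < \<omega>" using Ts(1) reg_sub I by auto
    then have "G * T s \<le> G * \<omega>" using G(1) by simp
    ultimately show ?thesis by simp
  qed
  have Ymono: "Y s \<le> Y t" if "l < s" "s \<le> t" "t < R" for s t
  proof (rule DERIV_nonneg_imp_nondecreasing[OF that(2)])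
    fix x assume "s \<le> x" "x \<le> t"
    then have x: "x \<in> {l<..<R}" "x \<in> {0<..<R}" using that l0 by auto
    have "- (A x / Z x) \<ge> 0" using Apos[OF x(2)] Zneg[OF x(1)] by (simp add: divide_nonneg_neg)
    then show "\<exists>d. (Y has_real_derivative d) (at x) \<and> 0 \<le> d" using Yder[OF x(1)] by blast
  qed
  obtain yl where yl: "(Y \<longlongrightarrow> yl) (at_right l)"
  proof (rule bounded_increasing_limit_right[OF half, of Y])
    show "Y s \<le> Y t" if "l < s" "s \<le> t" "t < R / 2" for s t using Ymono that R_pos by auto
  qed (use lb in auto)
  have lI: "l \<in> {0<..<R}" using l0 half R_pos by auto
  have "continuous_on {0<..<R} b" using b_cont by (rule continuous_on_subset) auto
  then have b_at: "isCont b l" using lI by (simp add: continuous_on_eq_continuous_at)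
  define zl where "zl = yl + b l"
  have "((\<lambda>s. Y s + b s) \<longlongrightarrow> zl) (at_right l)"
    unfolding zl_def using b_at by (intro tendsto_add yl) (simp add: continuous_at_imp_continuous_at_within continuous_within[symmetric])
  then have Zlim: "(Z \<longlongrightarrow> zl) (at_right l)" by (simp add: Y_def)
  have near: "\<forall>\<^sub>F s in at_right l. s \<in> {l<..<R / 2}" using half by (rule eventually_at_right_real)
  have "zl \<le> 0"
  proof (rule tendsto_upperbound[OF Zlim])
    show "\<forall>\<^sub>F s in at_right l. Z s \<le> 0"
      using near by eventually_elim (use Zneg R_pos in \<open>auto intro!: less_imp_le\<close>)
  qed simp
  moreover have "zl \<noteq> 0"
  proof
    assume "zl = 0"
    obtain s1 where s1: "s1 \<in> {l..R / 2}" "\<And>s. s \<in> {l..R / 2} \<Longrightarrow> A s1 \<le> A s"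
      using continuous_attains_inf[of "{l..R / 2}" A] half l0 R_pos continuous_on_subset[OF A_cont] by auto
    define \<mu> where "\<mu> = A s1"
    have \<mu>: "\<mu> > 0" unfolding \<mu>_def using s1(1) l0 R_pos by (intro Apos) auto
    \<comment> \<open>For \<open>\<bar>Z\<bar> < e\<close> the term \<open>A / \<bar>Z\<bar>\<close>
      is at least \<open>H + \<bar>c\<bar> + 1\<close> and outweighs \<open>h - c\<close>; so
      \<open>Z\<close> is increasing right of \<open>l\<close>, and its limit at \<open>l\<close>
      cannot exceed the negative value \<open>Z t\<close>.\<close>
    define e where "e = \<mu> / (H + \<bar>c\<bar> + 1)"
    have e: "e > 0" using \<mu> H(1) by (simp add: e_def)
    have "\<forall>\<^sub>F s in at_right l. dist (Z s) 0 < e" using tendstoD[OF Zlim e] \<open>zl = 0\<close> by simp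
    then obtain r where r: "r > l" "\<And>s. l < s \<Longrightarrow> s < r \<Longrightarrow> \<bar>Z s\<bar> < e"
      unfolding eventually_at_right_field by auto
    define t where "t = (l + min r (R / 2)) / 2"
    have t: "l < t" "t < r" "t < R / 2" using r half by (auto simp: t_def min_def)
    have Zmono: "Z s \<le> Z t" if "s \<in> {l<..<t}" for s
    proof (rule DERIV_nonneg_imp_nondecreasing[of s t])
      fix x assume "s \<le> x" "x \<le> t"
      then have x: "x \<in> {l<..<R}" "x \<in> {l..R / 2}" "l < x" "x < r" "x \<in> {0<..<R}" "x \<in> {0..R}"
        using that t l0 R_pos by auto
      have "((\<lambda>s. Y s + (f s - c * s)) has_real_derivative - (A x / Z x) + (h x - c * 1)) (at x)"
        by (intro DERIV_add DERIV_diff Yder[OF x(1)] f_deriv[OF x(5)] DERIV_cmult DERIV_ident)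
      then have "(Z has_real_derivative - (A x / Z x) + (h x - c)) (at x)" by (simp add: Y_def b_def)
      moreover have "- (A x / Z x) \<ge> H + \<bar>c\<bar> + 1"
      proof -
        have "(H + \<bar>c\<bar> + 1) * (- Z x) \<le> (H + \<bar>c\<bar> + 1) * e"
          using r(2)[OF x(3,4)] H(1) by (intro mult_left_mono) auto
        also have "\<dots> = \<mu>" using H(1) by (simp add: e_def)
        also have "\<mu> \<le> A x" using s1(2)[OF x(2)] by (simp add: \<mu>_def)
        finally show ?thesis using Zneg[OF x(1)] by (simp add: field_simps)
      qed
      ultimately show "\<exists>d. (Z has_real_derivative d) (at x) \<and> 0 \<le> d"
        using H(2)[OF x(6)] by (intro exI[of _ "- (A x / Z x) + (h x - c)"]) auto
    qed (use that in auto)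
    have "\<forall>\<^sub>F s in at_right l. s \<in> {l<..<t}" using t(1) by (rule eventually_at_right_real)
    then have "\<forall>\<^sub>F s in at_right l. Z s \<le> Z t" by eventually_elim (rule Zmono)
    then have "zl \<le> Z t" using tendsto_upperbound[OF Zlim] by simp
    then show False using Zneg[of t] t \<open>zl = 0\<close> R_pos by auto
  qed
  ultimately have zl: "zl < 0" by simp
  \<comment> \<open>Half of the limiting modulus: the other half is reserved for the variation of
    \<open>b\<close> near \<open>l\<close>, so that the truncation at \<open>m\<close> never
    acts.\<close>
  define m where "m = - zl / 2"
  have m: "m > 0" using zl by (simp add: m_def)
  obtain d where d: "d > 0" "\<And>s. \<bar>s - l\<bar> < d \<Longrightarrow> \<bar>b s - b l\<bar> < m"
    using b_at m unfolding continuous_at_eps_delta by (metis dist_real_def)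
  \<comment> \<open>The three bounds on \<open>l - p\<close> keep \<open>b\<close> within
    \<open>m\<close> of \<open>b l\<close>, keep \<open>p\<close> positive and make the Picard
    operator a contraction.\<close>
  define p where "p = l - min (d / 2) (min (l / 2) (m\<^sup>2 / (2 * M)))"
  have "m\<^sup>2 / (2 * M) > 0" using m M(1) by simp
  then have p: "0 < p" "p < l" "l - p < d" "l - p \<le> m\<^sup>2 / (2 * M)"
    using d(1) l0 by (auto simp: p_def min_def)
  have pl: "{p..l} \<subseteq> {0..R}" using p lI by auto
  have small: "M / m\<^sup>2 * (l - p) \<le> 1 / 2"
  proof -
    have "M / m\<^sup>2 * (l - p) \<le> M / m\<^sup>2 * (m\<^sup>2 / (2 * M))" using p(4) M(1) m by (intro mult_left_mono) auto
    also have "\<dots> = 1 / 2" using M(1) m by simp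
    finally show ?thesis .
  qed
  have A_pl: "0 \<le> A t \<and> A t \<le> M" if "t \<in> {p..l}" for t
    using Apos[of t] M(2)[of t] that p lI by auto
  obtain y where y_cont: "continuous_on {p..l} y"
    and y_eq: "\<And>s. s \<in> {p..l} \<Longrightarrow> y s = yl - integral {s..l} (\<lambda>t. A t / max m (- (y t + b t)))"
    using picard_left[OF less_imp_le[OF p(2)] continuous_on_subset[OF A_cont pl]
        continuous_on_subset[OF b_cont pl] A_pl m small, of yl] by metis
  define k where "k = (\<lambda>t. A t / max m (- (y t + b t)))"
  have k_cont: "continuous_on {p..l} k"
    unfolding k_def using m
    by (intro continuous_intros continuous_on_subset[OF A_cont pl] continuous_on_subset[OF b_cont pl] y_cont)
      (auto simp: max_def)
  \<comment> \<open>The integrand is nonnegative, so \<open>y \<le> yl\<close> to the left of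
    \<open>l\<close>; starting from \<open>yl + b l = - 2 * m\<close>, the flux stays at most
    \<open>- m\<close> and solves the equation without truncation.\<close>
  have yneg: "y s + b s \<le> - m" if s: "s \<in> {p..l}" for s
  proof -
    have "integral {s..l} k \<ge> 0"
      using A_pl s m by (intro integral_nonneg integrable_continuous_real continuous_on_subset[OF k_cont])
        (auto simp: k_def intro!: divide_nonneg_pos)
    then have "y s \<le> yl" using y_eq[OF s] by (simp add: k_def)
    moreover have "\<bar>b s - b l\<bar> < m" using d(2)[of s] s p by auto
    moreover have "yl + b l = - 2 * m" by (simp add: m_def zl_def)
    ultimately show ?thesis by linarith
  qed
  have k_eq: "k s = - (A s / (y s + b s))" if "s \<in> {p..l}" for s
  proof -
    have "max m (- (y s + b s)) = - (y s + b s)" using yneg[OF that] by (simp add: max_def)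
    then show ?thesis by (simp only: k_def minus_divide_right)
  qed
  have y_deriv: "(y has_real_derivative k s) (at s)" if s: "s \<in> {p<..<l}" for s
  proof -
    have "((\<lambda>s. integral {p..s} k) has_real_derivative k s) (at s within {p..l})"
      using s by (intro integral_has_real_derivative[OF k_cont]) auto
    then have "((\<lambda>s. integral {p..s} k) has_real_derivative k s) (at s)"
      using s at_within_Icc_at[of p s l] by simp
    then have "((\<lambda>s. yl - integral {p..l} k + integral {p..s} k) has_real_derivative k s) (at s)"
      by (auto intro!: derivative_eq_intros)
    moreover have "yl - integral {p..l} k + integral {p..t} k = y t" if "t \<in> {p<..<l}" for t
      using Henstock_Kurzweil_Integration.integral_combine[of p t l k] y_eq[of t] that
        integrable_continuous_real[OF k_cont] by (simp add: k_def)
    then have "\<forall>\<^sub>F t in nhds s. yl - integral {p..l} k + integral {p..t} k = y t"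
      using s unfolding eventually_nhds by (intro exI[of _ "{p<..<l}"]) auto
    ultimately show ?thesis
      using DERIV_cong_ev[of s s "\<lambda>s. yl - integral {p..l} k + integral {p..s} k" y "k s" "k s"] by blast
  qed
  have y_l: "y l = yl" using y_eq[of l] p by simp
  define Yt where "Yt = (\<lambda>s. if s \<le> l then y s else Y s)"
  define Zt where "Zt = (\<lambda>s. Yt s + b s)"
  have Zt_neg: "Zt s < 0" if "s \<in> {p<..<R}" for s
    using yneg[of s] Zneg[of s] that m by (auto simp: Zt_def Yt_def Y_def)
  have Zt_Z: "Zt s = Z s" if "l < s" for s using that by (simp add: Zt_def Yt_def Y_def)
  have Yt_deriv0: "(Yt has_real_derivative - (A s / Zt s)) (at s)" if s: "s \<in> {p<..<R} - {l}" for s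
  proof (cases "s < l")
    case True
    then have "\<forall>\<^sub>F t in nhds s. Yt t = y t"
      unfolding eventually_nhds by (intro exI[of _ "{..<l}"]) (auto simp: Yt_def)
    moreover have "k s = - (A s / Zt s)" using k_eq[of s] s True by (simp add: Zt_def Yt_def)
    ultimately show ?thesis
      using DERIV_cong_ev[of s s Yt y "- (A s / Zt s)" "- (A s / Zt s)"] y_deriv[of s] s True by auto
  next
    case False
    then have "\<forall>\<^sub>F t in nhds s. Yt t = Y t"
      unfolding eventually_nhds using s by (intro exI[of _ "{l<..}"]) (auto simp: Yt_def)
    then show ?thesis
      using DERIV_cong_ev[of s s Yt Y "- (A s / Zt s)" "- (A s / Zt s)"] Yder[of s] s False Zt_Z[of s] by auto
  qed
  have "isCont Yt l"
    unfolding isCont_def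
  proof (rule filterlim_split_at)
    have "(y \<longlongrightarrow> y l) (at l within {p..l})" using y_cont p by (simp add: continuous_on_def)
    then have "(y \<longlongrightarrow> y l) (at_left l)" using p(2) by (simp add: at_within_Icc_at_left)
    moreover have "\<forall>\<^sub>F s in at_left l. y s = Yt s"
      by (auto simp: eventually_at_filter Yt_def)
    ultimately show "(Yt \<longlongrightarrow> Yt l) (at_left l)" by (simp add: Yt_def tendsto_cong)
    have "\<forall>\<^sub>F s in at_right l. Y s = Yt s"
      by (auto simp: eventually_at_filter Yt_def)
    then show "(Yt \<longlongrightarrow> Yt l) (at_right l)"
      using yl y_l Lim_transform_eventually by (fastforce simp: Yt_def)
  qed
  then have Yt_cont: "continuous_on {p<..<R} Yt"
    using Yt_deriv0 DERIV_isCont by (intro continuous_at_imp_continuous_on) blast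
  have pR: "{p<..<R} \<subseteq> {0..R}" using p by auto
  have Zt_cont: "continuous_on {p<..<R} Zt"
    unfolding Zt_def by (intro continuous_intros Yt_cont continuous_on_subset[OF b_cont pR])
  have Yt_deriv: "(Yt has_real_derivative - (A s / Zt s)) (at s)" if "s \<in> {p<..<R}" for s
  proof (rule has_real_derivative_continuous_extension[of "{p<..<R}" Yt _ "{l}"])
    show "continuous_on {p<..<R} (\<lambda>s. - (A s / Zt s))"
      using Zt_neg by (intro continuous_intros Zt_cont continuous_on_subset[OF A_cont pR]) force
  qed (use Yt_cont Yt_deriv0 that in auto)
  \<comment> \<open>Strictly between \<open>p\<close> and \<open>l\<close>, since the glued equation
    is available on the open interval from \<open>p\<close> to \<open>R\<close>.\<close>
  define p' where "p' = (p + l) / 2"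
  have p': "p < p'" "p' < l" "p' < R / 2" using p half by (auto simp: p'_def)
  have sub: "{p'..R / 2} \<subseteq> {p<..<R}" using p' R_pos by auto
  define j where "j = (\<lambda>t. D t / Zt t)"
  have j_cont: "continuous_on {p<..<R} j"
    unfolding j_def using Zt_neg by (intro continuous_intros Zt_cont continuous_on_subset[OF D_cont pR]) force
  have Dp: "D s > 0" if "s \<in> {p<..<R}" for s using D_pos[of s] that p by auto
  have j_neg: "j s < 0" if "s \<in> {p<..<R}" for s
    using Dp[OF that] Zt_neg[OF that] by (simp add: j_def divide_pos_neg)
  \<comment> \<open>The inverse of the extended profile, rebuilt as the primitive of
    \<open>D / Zt\<close> that vanishes at \<open>R / 2\<close>; between \<open>l\<close> and
    \<open>R / 2\<close> it has to coincide with \<open>T\<close>.\<close>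
  define Tt where "Tt = (\<lambda>s. integral {p'..s} j - integral {p'..R / 2} j)"
  have Tt_der: "(Tt has_real_derivative j s) (at s within {p'..R / 2})" if "s \<in> {p'..R / 2}" for s
    unfolding Tt_def
    using integral_has_real_derivative[OF continuous_on_subset[OF j_cont sub] that]
    by (auto intro!: derivative_eq_intros)
  have Tt_deriv: "(Tt has_real_derivative j s) (at s)" if "s \<in> {p'<..<R / 2}" for s
    using Tt_der[of s] that at_within_Icc_at[of p' s "R / 2"] by auto
  have Tt_cont: "continuous_on {p'..R / 2} Tt" using Tt_der by (rule DERIV_continuous_on)
  have Tt_dec: "Tt v < Tt u" if "u < v" "u \<in> {p'..R / 2}" "v \<in> {p'..R / 2}" for u v
  proof (rule DERIV_neg_imp_decreasing_open[OF that(1)])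
    show "continuous_on {u..v} Tt" using that by (intro continuous_on_subset[OF Tt_cont]) auto
    fix x assume "u < x" "x < v"
    then have "x \<in> {p'<..<R / 2}" "x \<in> {p<..<R}" using that p' R_pos by auto
    then show "\<exists>d. (Tt has_real_derivative d) (at x) \<and> d < 0" using Tt_deriv j_neg by blast
  qed
  have Tt_T: "Tt s = T s" if s: "l < s" "s < R / 2" for s
  proof -
    have "(\<lambda>s. Tt s - T s) (R / 2) = (\<lambda>s. Tt s - T s) s"
    proof (rule DERIV_isconst_end[OF s(2)])
      have "continuous_on {s..R / 2} T"
      proof (intro continuous_at_imp_continuous_on ballI)
        fix x assume "x \<in> {s..R / 2}"
        then have "x \<in> \<phi> ` reg" using im[of x] s R_pos by auto
        then show "isCont T x" using T_deriv DERIV_isCont by blast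
      qed
      then show "continuous_on {s..R / 2} (\<lambda>s. Tt s - T s)"
        using s p' by (intro continuous_intros continuous_on_subset[OF Tt_cont]) auto
      fix x assume x: "s < x" "x < R / 2"
      have "((\<lambda>s. Tt s - T s) has_real_derivative j x - D x / F (T x)) (at x)"
        using x s p' im[of x] R_pos by (intro DERIV_diff Tt_deriv T_deriv) auto
      then show "((\<lambda>s. Tt s - T s) has_real_derivative 0) (at x)"
        using Zt_Z[of x] x s by (simp add: j_def Z_def)
    qed
    then show ?thesis using T_half by (simp add: Tt_def)
  qed
  define \<omega>' where "\<omega>' = Tt p'"
  have Tt0: "Tt (R / 2) = 0" by (simp add: Tt_def)
  have T\<phi>: "Tt (\<phi> x) = x \<and> \<phi> x \<in> {l<..<R / 2}" if x: "0 < x" "x < \<omega>" for x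
  proof -
    have xI: "x \<in> I" using x I by simp
    have xr: "x \<in> reg"
      using pos[OF xI] anti_D[OF xI, of 0] x \<phi>_0 R_pos xI unfolding reg_def by auto
    have "\<phi> x < R / 2" using \<phi>_strict[OF zero_reg xr x(1)] \<phi>_0 by simp
    moreover have "l < \<phi> x" using im[of "\<phi> x"] xr by auto
    ultimately show ?thesis using Tt_T T_\<phi>[OF xr] by auto
  qed
  \<comment> \<open>A point \<open>x < \<omega>\<close> beyond \<open>Tt l\<close> would satisfy
    \<open>l < \<phi> x\<close> and \<open>Tt (\<phi> x) = x > Tt l\<close>, although
    \<open>Tt\<close> decreases. Levels below \<open>l\<close> are therefore reached after \<omega>,
    and the extension is a genuine one.\<close>
  have "\<omega> \<le> Tt l"
  proof (rule ccontr)
    assume "\<not> \<omega> \<le> Tt l"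
    then obtain x where x: "max 0 (Tt l) < x" "x < \<omega>" using dense[of "max 0 (Tt l)" \<omega>] \<omega> by auto
    then have "Tt (\<phi> x) = x" "\<phi> x \<in> {l<..<R / 2}" using T\<phi>[of x] by auto
    then show False using Tt_dec[of l "\<phi> x"] x(1) p' half by auto
  qed
  moreover have "Tt l < \<omega>'" unfolding \<omega>'_def using p' half by (intro Tt_dec) auto
  ultimately have \<omega>\<omega>': "\<omega> < \<omega>'" by simp
  define S where "S = inv_into {p'..R / 2} Tt"
  have inj: "inj_on Tt {p'..R / 2}"
    by (rule inj_onI) (metis Tt_dec less_irrefl linorder_less_linear)
  have onto: "x \<in> Tt ` {p'..R / 2}" if "x \<in> {0..\<omega>'}" for x
    using IVT2'[of Tt "R / 2" x p'] that Tt0 Tt_cont p' by (auto simp: \<omega>'_def)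
  have S_Tt: "S (Tt s) = s" if "s \<in> {p'..R / 2}" for s
    unfolding S_def using inv_into_f_f[OF inj that] .
  have Tt_S: "Tt (S x) = x" "S x \<in> {p'..R / 2}" if "x \<in> {0..\<omega>'}" for x
    using f_inv_into_f[OF onto[OF that]] inv_into_into[OF onto[OF that]] unfolding S_def by auto
  have S_in: "S x \<in> {p'<..<R / 2}" if x: "x \<in> {0<..<\<omega>'}" for x
  proof -
    have "x \<in> {0..\<omega>'}" using x by auto
    from Tt_S[OF this] show ?thesis using x Tt0 \<omega>'_def
      by (metis atLeastAtMost_iff greaterThanLessThan_iff less_irrefl order_le_less)
  qed
  have S_cont: "continuous_on {0<..<\<omega>'} S"
  proof -
    have "continuous_on (Tt ` {p'..R / 2}) S"
      using S_Tt by (intro continuous_on_inv[OF Tt_cont]) auto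
    then show ?thesis by (rule continuous_on_subset) (use onto in auto)
  qed
  define S' where "S' = (\<lambda>x. Zt (S x) / D (S x))"
  have S_pR: "S x \<in> {p<..<R}" if "x \<in> {0<..<\<omega>'}" for x using S_in[OF that] p' R_pos by auto
  have S_deriv: "(S has_real_derivative S' x) (at x)" if x: "x \<in> {0<..<\<omega>'}" for x
  proof -
    have "(S has_real_derivative inverse (j (S x))) (at x)"
    proof (rule DERIV_inverse_function[where f = Tt and g = S and x = x and a = 0 and b = \<omega>'])
      show "(Tt has_real_derivative j (S x)) (at (S x))" by (rule Tt_deriv[OF S_in[OF x]])
      show "j (S x) \<noteq> 0" using j_neg[OF S_pR[OF x]] by simp
      show "Tt (S y) = y" if "0 < y" "y < \<omega>'" for y using Tt_S[of y] that by simp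
      show "isCont S x" using S_cont x by (simp add: continuous_on_eq_continuous_at)
    qed (use x in auto)
    then show ?thesis by (simp add: S'_def j_def)
  qed
  have S'_neg: "S' x \<le> 0" if "x \<in> {0<..<\<omega>'}" for x
    using Zt_neg[OF S_pR[OF that]] Dp[OF S_pR[OF that]] by (simp add: S'_def divide_nonpos_pos)
  have S'_cont: "continuous_on {0<..<\<omega>'} S'"
    unfolding S'_def
  proof (intro continuous_on_divide)
    show "continuous_on {0<..<\<omega>'} (\<lambda>x. Zt (S x))"
      using S_pR by (intro continuous_on_compose2[OF Zt_cont S_cont]) auto
    show "continuous_on {0<..<\<omega>'} (\<lambda>x. D (S x))"
      by (intro continuous_on_compose2[OF D_cont S_cont]) (use S_pR pR in blast)
    show "\<forall>x\<in>{0<..<\<omega>'}. D (S x) \<noteq> 0" using Dp[OF S_pR] by force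
  qed
  have S_ode: "((\<lambda>x. D (S x) * S' x - f (S x) + c * S x) has_real_derivative - g (S x)) (at x)"
    if x: "x \<in> {0<..<\<omega>'}" for x
  proof -
    have "((\<lambda>x. Yt (S x)) has_real_derivative - (A (S x) / Zt (S x)) * S' x) (at x)"
      by (rule DERIV_chain2[OF Yt_deriv[OF S_pR[OF x]] S_deriv[OF x]])
    moreover have "- (A (S x) / Zt (S x)) * S' x = - g (S x)"
      using Zt_neg[OF S_pR[OF x]] Dp[OF S_pR[OF x]] by (simp add: S'_def A_def)
    moreover have "Yt (S y) = D (S y) * S' y - f (S y) + c * S y" if "y \<in> {0<..<\<omega>'}" for y
      using Dp[OF S_pR[OF that]] by (simp add: S'_def Zt_def b_def)
    then have "\<forall>\<^sub>F y in nhds x. Yt (S y) = D (S y) * S' y - f (S y) + c * S y"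
      unfolding eventually_nhds using x by (intro exI[of _ "{0<..<\<omega>'}"]) auto
    ultimately show ?thesis
      using DERIV_cong_ev[of x x "\<lambda>x. Yt (S x)" "\<lambda>x. D (S x) * S' x - f (S x) + c * S x" "- g (S x)" "- g (S x)"]
      by simp
  qed
  have S_eq: "S x = \<phi> x" if "0 < x" "x < \<omega>" for x
    using T\<phi>[OF that] S_Tt[of "\<phi> x"] p' by auto
  \<comment> \<open>Stopping before \<open>\<omega>'\<close> keeps the closed interval up to
    \<open>\<omega>''\<close> inside the region where \<open>S'\<close> is continuous, hence
    bounded.\<close>
  define \<omega>'' where "\<omega>'' = (\<omega> + \<omega>') / 2"
  have "\<omega> < \<omega>''" "\<omega>'' < \<omega>'" using \<omega>\<omega>' by (auto simp: \<omega>''_def)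
  moreover have "S x \<in> {0<..<R}" if "x \<in> {0<..<\<omega>'}" for x using S_pR[OF that] p by auto
  ultimately have "semi_wavefront R D f h g c \<omega>'' (\<lambda>x. if x < \<omega> then \<phi> x else S x)"
    using S_deriv S'_neg S'_cont S_ode S_eq pos
    by (intro semi_wavefront_extension[OF I, where S' = S' and \<omega>' = \<omega>']) auto
  from maximal[OF \<open>\<omega> < \<omega>''\<close> this] show False by auto
qed

end

section \<open>The theorem\<close>

text \<open>For the front, the values below \<open>R / 2\<close> are supplied by its limit at plus
  infinity and the intermediate value theorem, in place of continuation.\<close>

lemma (in profile) all_values_attained_of_limit:
  assumes I: "I = UNIV" and lim_top: "(\<phi> \<longlongrightarrow> 0) at_top"
  shows "{0<..<R} \<subseteq> \<phi> ` reg"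
proof
  fix s assume s: "s \<in> {0<..<R}"
  show "s \<in> \<phi> ` reg"
  proof (cases "R / 2 \<le> s")
    case True
    then show ?thesis using value_attained[OF zero_reg, of s] \<phi>_0 s by auto
  next
    case False
    have "\<forall>\<^sub>F x in at_top. \<phi> x < s" by (rule order_tendstoD(2)[OF lim_top]) (use s in simp)
    moreover have "\<forall>\<^sub>F x in at_top. (0::real) \<le> x" by (rule eventually_ge_at_top)
    ultimately have "\<forall>\<^sub>F x in at_top. \<phi> x < s \<and> 0 \<le> x" by (rule eventually_conj)
    then obtain x where x: "\<phi> x < s" "0 \<le> x" unfolding eventually_at_top_linorder by blast
    have "continuous_on {0..x} \<phi>" by (rule continuous_on_subset[OF \<phi>_cont]) (simp add: I)
    then obtain z where "\<phi> z = s" using IVT2'[of \<phi> x s 0] x False \<phi>_0 by auto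
    then have "z \<in> reg" unfolding reg_def using s I by auto
    then show ?thesis using \<open>\<phi> z = s\<close> by blast
  qed
qed

text \<open>A nondecreasing function with limit \<open>R\<close> at minus infinity is nowhere below
  \<open>R\<close>, which \<open>\<phi> 0 < R\<close> excludes.\<close>

lemma semi_wavefront_antimono:
  assumes "semi_wavefront R D f h g c \<omega> \<phi>" "0 < \<omega>" "\<phi> 0 < R"
  shows "antimono_on {..<\<omega>} \<phi>"
proof (rule ccontr)
  assume "\<not> ?thesis"
  then have mono: "mono_on {..<\<omega>} \<phi>" and lim: "(\<phi> \<longlongrightarrow> R) at_bot"
    using assms(1) unfolding semi_wavefront_def by auto
  have "R \<le> \<phi> 0"
  proof (rule tendsto_upperbound[OF lim])
    show "\<forall>\<^sub>F x in at_bot. \<phi> x \<le> \<phi> 0"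
      using eventually_le_at_bot[of "0::real"]
      by eventually_elim (use mono assms(2) in \<open>auto simp: monotone_on_def\<close>)
  qed simp
  then show False using assms(3) by simp
qed

theorem theorem2p4:
  fixes R c c\<^sub>0 :: real
    and D f h :: "real \<Rightarrow> real"
    and g \<phi> :: "nat \<Rightarrow> real \<Rightarrow> real"
    and \<omega> :: "nat \<Rightarrow> real"
    and J :: "real set"
  assumes "R > 0"
    and "C1_on {0..R} f h" and "f 0 = 0"
    and "\<And>n. continuous_on {0..R} (g n)"
    and "\<And>\<rho>. \<rho> \<in> {0<..<R} \<Longrightarrow> g 0 \<rho> > 0" and "g 0 0 = 0" and "g 0 R = 0"
    and "Limsup (at_right 0) (\<lambda>\<rho>. ereal (D \<rho> * g 0 \<rho> / \<rho>)) < \<infinity>"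
    and "\<And>n \<rho>. n \<ge> 1 \<Longrightarrow> \<rho> \<in> {0..R} \<Longrightarrow> g (Suc n) \<rho> \<le> g n \<rho>"
    and "\<And>n \<rho>. n \<ge> 1 \<Longrightarrow> \<rho> \<in> {0..<R} \<Longrightarrow> g n \<rho> > 0"
    and "\<And>n. n \<ge> 1 \<Longrightarrow> g n R = 0"
    and "uniform_limit {0..R} g (g 0) sequentially"
    and "D_hat R D \<or> D_tilde R D g"
    and "threshold_speed R D f h (g 0) c\<^sub>0" and "c \<ge> c\<^sub>0"
    and "decreasing_wavefront R D f h (g 0) c (\<phi> 0)" and "\<phi> 0 0 = R / 2"
    and "\<And>n. n \<ge> 1 \<Longrightarrow> maximal_semi_wavefront R D f h (g n) c (\<omega> n) (\<phi> n)"
    and "\<And>n. n \<ge> 1 \<Longrightarrow> 0 < \<omega> n \<and> \<phi> n 0 = R / 2"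
    and "maximal_open_interval (\<lambda>\<xi>. 0 < \<phi> 0 \<xi> \<and> \<phi> 0 \<xi> < R) J"
  shows "C1_loc_convergence J (\<lambda>n. {..<\<omega> n}) \<phi> (\<phi> 0)"
proof -
  note R = assms(1) and fC1 = assms(2) and gc = assms(4) and g0pos = assms(5) and g0R = assms(7) and gdec = assms(9) and gnpos = assms(10) and gnR = assms(11) and glim = assms(12)
    and DD = assms(13) and wf0 = assms(16) and \<phi>00 = assms(17) and swf = assms(18) and \<phi>n0 = assms(19) and J = assms(20)
  \<comment> \<open>Index \<open>0\<close> is the front, which lives on the whole line; the
    half-lines required by the conclusion are recovered for \<open>n \<ge> 1\<close>, that is,
    eventually.\<close>
  define I where "I = (\<lambda>n. if n = 0 then UNIV else {..<\<omega> n})"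
  have gle: "g n s \<le> g m s" if "1 \<le> m" "m \<le> n" "s \<in> {0..R}" for m n s
    using that(2)
  proof (induction n rule: dec_induct)
    case (step k)
    then show ?case using gdec[of k s] that(1,3) by auto
  qed simp
  \<comment> \<open>A decreasing sequence stays above its limit; positivity of \<open>g 0\<close>
    between \<open>0\<close> and \<open>R\<close> thereby passes to all sources.\<close>
  have glow: "g 0 s \<le> g n s" if s: "s \<in> {0..R}" for n s
  proof (cases "n = 0")
    case False
    have "(\<lambda>k. g k s) \<longlonglongrightarrow> g 0 s" using glim s by (rule tendsto_uniform_limitI)
    then show ?thesis
      by (rule LIMSEQ_le_const2) (use gle[of n _ s] False s in \<open>auto intro!: exI[of _ n]\<close>)
  qed simp
  have D_cont: "continuous_on {0..R} D"
    using DD unfolding D_hat_def D_tilde_def C1_on_def by (meson DERIV_continuous_on)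
  have D_pos: "D s > 0" if "s \<in> {0<..<R}" for s
    using DD that unfolding D_hat_def D_tilde_def by blast
  have g_pos: "g n s > 0" if "s \<in> {0<..<R}" for n s
    using g0pos[OF that] glow[of s n] that by auto
  have semi: "semi_wavefront R D f h (g n) c (\<omega> n) (\<phi> n)" if "n \<ge> 1" for n
    using swf[OF that] unfolding maximal_semi_wavefront_def by blast
  have prof: "profile R c D f h (g n) (\<phi> n) (I n)" for n
  proof (cases "n = 0")
    case True
    then show ?thesis
      using wf0 R fC1 gc g_pos g0R D_cont D_pos \<phi>00
      unfolding I_def profile_def decreasing_wavefront_def wavefront_def by auto
  next
    case False
    then have n: "n \<ge> 1" by simp
    have "antimono_on {..<\<omega> n} (\<phi> n)"
      using semi_wavefront_antimono[OF semi[OF n]] \<phi>n0[OF n] R by simp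
    then show ?thesis
      using semi[OF n] R fC1 gc g_pos gnR[OF n] D_cont D_pos \<phi>n0[OF n] False
      unfolding I_def profile_def semi_wavefront_def by auto
  qed
  have full: "{0<..<R} \<subseteq> \<phi> n ` profile.reg R (\<phi> n) (I n)" for n
  proof (cases "n = 0")
    case True
    then show ?thesis
      using profile.all_values_attained_of_limit[OF prof[of 0]] wf0
      unfolding I_def decreasing_wavefront_def wavefront_def by simp
  next
    case False
    then have n: "n \<ge> 1" by simp
    show ?thesis
    proof (rule profile.all_values_attained[OF prof])
      show "I n = {..<\<omega> n}" using False by (simp add: I_def)
      show "\<exists>\<xi><\<omega> n. \<eta> \<xi> \<noteq> \<phi> n \<xi>"
        if "\<omega> n < \<omega>'" "semi_wavefront R D f h (g n) c \<omega>' \<eta>" for \<omega>' \<eta>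
        using swf[OF n] that unfolding maximal_semi_wavefront_def by blast
    qed (use gnpos[OF n] in auto)
  qed
  show ?thesis
    unfolding C1_loc_convergence_def
  proof (intro allI impI)
    fix \<alpha> \<beta> assume ab: "\<alpha> \<le> \<beta> \<and> {\<alpha>..\<beta>} \<subseteq> J"
    have "\<xi> \<in> I 0 \<and> 0 < \<phi> 0 \<xi> \<and> \<phi> 0 \<xi> < R" if "\<xi> \<in> {\<alpha>..\<beta>}" for \<xi>
      using J ab that unfolding maximal_open_interval_def I_def by auto
    then have conv: "\<phi> 0 C1_differentiable_on {\<alpha>..\<beta>} \<and>
        (\<forall>\<^sub>F n in sequentially. {\<alpha>..\<beta>} \<subseteq> I n \<and> \<phi> n C1_differentiable_on {\<alpha>..\<beta>}) \<and>
        uniform_limit {\<alpha>..\<beta>} \<phi> (\<phi> 0) sequentially \<and>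
        uniform_limit {\<alpha>..\<beta>} (\<lambda>n. deriv (\<phi> n)) (deriv (\<phi> 0)) sequentially"
      using ab glow gle by (intro profiles_converge[OF prof full _ _ glim]) auto
    then have "\<forall>\<^sub>F n in sequentially. {\<alpha>..\<beta>} \<subseteq> I n \<and> \<phi> n C1_differentiable_on {\<alpha>..\<beta>}" by blast
    then have "\<forall>\<^sub>F n in sequentially. {\<alpha>..\<beta>} \<subseteq> {..<\<omega> n} \<and> \<phi> n C1_differentiable_on {\<alpha>..\<beta>}"
      using eventually_ge_at_top[of "1::nat"] by eventually_elim (simp add: I_def)
    with conv show "\<phi> 0 C1_differentiable_on {\<alpha>..\<beta>} \<and>
        (\<forall>\<^sub>F n in sequentially. {\<alpha>..\<beta>} \<subseteq> {..<\<omega> n} \<and> \<phi> n C1_differentiable_on {\<alpha>..\<beta>}) \<and>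
        uniform_limit {\<alpha>..\<beta>} \<phi> (\<phi> 0) sequentially \<and>
        uniform_limit {\<alpha>..\<beta>} (\<lambda>n. deriv (\<phi> n)) (deriv (\<phi> 0)) sequentially"
      by blast
  qed
qed

end
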